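(* Let $0<p<\infty$. If $\Phi:\ell_p^0\to\ell_p$ is a centralizer, then $\Phi\,\Phi\sim0$; that is, the four-term exact sequence $0\to\ell_p\to Z(\Phi)\to Z(\Phi)\to\ell_p\to0$ obtained by splicing two copies of the short exact sequence induced by $\Phi$ is trivial in $\operatorname{Ext}^2(\ell_p,\ell_p)$ (in the category of quasi Banach spaces).
   Context: Scalars are $\mathbb K=\mathbb R$ or $\mathbb C$. A quasinorm is a function $\|\cdot\|:X\to[0,\infty)$ with $\|\lambda x\|=|\lambda|\|x\|$, $\|x\|=0$ iff $x=0$, and $\|x+y\|\le C(\|x\|+\|y\|)$ for some constant $C$. A quasi Banach space is a complete quasinormed space; operators are bounded linear maps. A sequence of spaces and operators is exact if the kernel of each operator equals the image of the preceding one. $\operatorname{Ext}^2(X,Y)$. Consider four-term exact sequences $\mathscr E:\ 0\to Y\to E_1\to E_2\to X\to0$ of quasi Banach spaces and operators. Write $\mathscr E\to\mathscr F$ if there are operators $u_1:E_1\to F_1$, $u_2:E_2\to F_2$ that, together with the identities of $Y$ and $X$, make the obvious diagram commute. $\operatorname{Ext}^2(X,Y)$ is the set of classes for the equivalence relation generated by $\to$; its zero element is the class of $0\to Y\xrightarrow{\mathbf I}Y\xrightarrow{0}X\xrightarrow{\mathbf I}X\to0$. A sequence is trivial if it is equivalent to this one. Centralizers. $\ell_p^0$ is the subspace of finitely supported sequences of $\ell_p$; $\ell_\infty$ acts on $\ell_p$ by pointwise product. A centralizer $\Phi:\ell_p^0\to\ell_p$ is a homogeneous map ($\Phi(\lambda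 x)=\lambda\Phi(x)$) with $\|\Phi(ax)-a\Phi(x)\|\le C\|a\|_\infty\|x\|$ for some constant $C$ and all $a\in\ell_\infty$, $x\in\ell_p^0$. Such a map is automatically quasilinear: $\|\Phi(x+y)-\Phi(x)-\Phi(y)\|\le Q(\|x\|+\|y\|)$ for some $Q$ and all $x,y$. Induced and spliced sequences. If $X,Y$ are quasi Banach, $X_0$ is dense in $X$ and $\Phi:X_0\to Y$ is quasilinear, let $Z(\Phi)$ be the completion of $Y\times X_0$ with the quasinorm $\|(y,x)\|_\Phi=\|y-\Phi(x)\|+\|x\|$. The induced exact sequence is $0\to Y\xrightarrow{\imath}Z(\Phi)\xrightarrow{\pi}X\to0$, where $\imath(y)=(y,0)$ and $\pi$ extends $(y,x)\mapsto x$. For quasilinear $\Psi:X_0\to E$ and $\Phi:E_0\to Y$ ($X_0$, $E_0$ dense in $X$, $E$), $\Phi\,\Psi$ denotes the four-term sequence $0\to Y\to Z(\Phi)\to Z(\Psi)\to X\to0$ whose middle arrow is the composition $Z(\Phi)\to E\to Z(\Psi)$ of the quotient map and the inclusion; $\Phi\,\Psi\sim0$ means that it is trivial in $\operatorname{Ext}^2(X,Y)$. *)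

theory Defs
  imports
    Complex_Main
    "HOL-Algebra.AbelCoset"
    "HOL-Algebra.Module"
    "HOL-Library.Nat_Bijection"
begin

section \<open>Quasi Banach spaces and operators\<close>

definition scalars :: "'k::real_normed_field ring" where
  "scalars = \<lparr>carrier = UNIV, mult = (*), one = 1, zero = 0, add = (+)\<rparr>"

text \<open>
  Vector spaces over \<open>'k\<close> are modules over \<^const>\<open>scalars\<close>; the ring multiplication and unit that
  the module record inherits play no role and are left \<^const>\<open>undefined\<close> throughout.
\<close>

record ('k, 'a) qspace = "('k, 'a) module" +
  qnorm :: "'a \<Rightarrow> real"

definition quasinormed :: "('k::real_normed_field, 'a) qspace \<Rightarrow> bool" where
  "quasinormed V \<longleftrightarrow>
     Module.module scalars V \<and>
     (\<forall>x\<in>carrier V. 0 \<le> qnorm V x) \<and>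
     (\<forall>c. \<forall>x\<in>carrier V. qnorm V (c \<odot>\<^bsub>V\<^esub> x) = norm c * qnorm V x) \<and>
     (\<forall>x\<in>carrier V. qnorm V x = 0 \<longleftrightarrow> x = \<zero>\<^bsub>V\<^esub>) \<and>
     (\<exists>C. \<forall>x\<in>carrier V. \<forall>y\<in>carrier V. qnorm V (x \<oplus>\<^bsub>V\<^esub> y) \<le> C * (qnorm V x + qnorm V y))"

definition qcauchy :: "('k, 'a) qspace \<Rightarrow> (nat \<Rightarrow> 'a) \<Rightarrow> bool" where
  "qcauchy V s \<longleftrightarrow>
     (\<forall>n. s n \<in> carrier V) \<and>
     (\<forall>e>0. \<exists>N. \<forall>m\<ge>N. \<forall>n\<ge>N. qnorm V (s m \<ominus>\<^bsub>V\<^esub> s n) < e)"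

definition qconverges :: "('k, 'a) qspace \<Rightarrow> (nat \<Rightarrow> 'a) \<Rightarrow> 'a \<Rightarrow> bool" where
  "qconverges V s x \<longleftrightarrow> x \<in> carrier V \<and> (\<lambda>n. qnorm V (s n \<ominus>\<^bsub>V\<^esub> x)) \<longlonglongrightarrow> 0"

definition quasi_banach :: "('k::real_normed_field, 'a) qspace \<Rightarrow> bool" where
  "quasi_banach V \<longleftrightarrow> quasinormed V \<and> (\<forall>s. qcauchy V s \<longrightarrow> (\<exists>x. qconverges V s x))"

definition operators :: "('k, 'a) qspace \<Rightarrow> ('k, 'b) qspace \<Rightarrow> ('a \<Rightarrow> 'b) set" where
  "operators V W = {T. T \<in> carrier V \<rightarrow> carrier W \<and>
     (\<forall>x\<in>carrier V. \<forall>y\<in>carrier V. T (x \<oplus>\<^bsub>V\<^esub> y) = T x \<oplus>\<^bsub>W\<^esub> T y) \<and>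
     (\<forall>c. \<forall>x\<in>carrier V. T (c \<odot>\<^bsub>V\<^esub> x) = c \<odot>\<^bsub>W\<^esub> T x) \<and>
     (\<exists>C. \<forall>x\<in>carrier V. qnorm W (T x) \<le> C * qnorm V x)}"


section \<open>Four-term exact sequences and \<open>Ext\<^sup>2\<close>\<close>

text \<open>
  The record below stands for \<open>0 \<rightarrow> Y \<rightarrow> E\<^sub>1 \<rightarrow> E\<^sub>2 \<rightarrow> X \<rightarrow> 0\<close>; the end spaces are parameters
  of the definitions that follow.
\<close>

record ('k, 'a) four_term =
  mid1 :: "('k, 'a) qspace"
  mid2 :: "('k, 'a) qspace"
  arr1 :: "'a \<Rightarrow> 'a"
  arr2 :: "'a \<Rightarrow> 'a"
  arr3 :: "'a \<Rightarrow> 'a"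

definition exact_sequences ::
    "('k::real_normed_field, 'a) qspace \<Rightarrow> ('k, 'a) qspace \<Rightarrow> ('k, 'a) four_term set" where
  "exact_sequences X Y = {E.
     quasi_banach Y \<and> quasi_banach (mid1 E) \<and> quasi_banach (mid2 E) \<and> quasi_banach X \<and>
     arr1 E \<in> operators Y (mid1 E) \<and>
     arr2 E \<in> operators (mid1 E) (mid2 E) \<and>
     arr3 E \<in> operators (mid2 E) X \<and>
     a_kernel Y (mid1 E) (arr1 E) = {\<zero>\<^bsub>Y\<^esub>} \<and>
     a_kernel (mid1 E) (mid2 E) (arr2 E) = arr1 E ` carrier Y \<and>
     a_kernel (mid2 E) X (arr3 E) = arr2 E ` carrier (mid1 E) \<and>
     arr3 E ` carrier (mid2 E) = carrier X}"

definition ext2_arrow ::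
    "('k::real_normed_field, 'a) qspace \<Rightarrow> ('k, 'a) qspace \<Rightarrow>
      (('k, 'a) four_term \<times> ('k, 'a) four_term) set" where
  "ext2_arrow X Y = {(E, F).
     E \<in> exact_sequences X Y \<and> F \<in> exact_sequences X Y \<and>
     (\<exists>u1\<in>operators (mid1 E) (mid1 F). \<exists>u2\<in>operators (mid2 E) (mid2 F).
        (\<forall>y\<in>carrier Y. u1 (arr1 E y) = arr1 F y) \<and>
        (\<forall>e\<in>carrier (mid1 E). u2 (arr2 E e) = arr2 F (u1 e)) \<and>
        (\<forall>e\<in>carrier (mid2 E). arr3 F (u2 e) = arr3 E e))}"

text \<open>
  All spaces in a zigzag have their carriers inside the one type \<open>'a\<close>. It is instantiated below
  with \<open>nat \<Rightarrow> 'k\<close>, which has room for a copy of every quasi Banach space of cardinality at most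
  that of the continuum, in particular of every separable one.
\<close>

definition ext2_equiv ::
    "('k::real_normed_field, 'a) qspace \<Rightarrow> ('k, 'a) qspace \<Rightarrow>
      (('k, 'a) four_term \<times> ('k, 'a) four_term) set" where
  "ext2_equiv X Y =
     (ext2_arrow X Y \<union> (ext2_arrow X Y)\<inverse>)\<^sup>* \<inter> exact_sequences X Y \<times> exact_sequences X Y"

definition ext2_zero :: "('k, 'a) qspace \<Rightarrow> ('k, 'a) qspace \<Rightarrow> ('k, 'a) four_term" where
  "ext2_zero X Y =
     \<lparr>mid1 = Y, mid2 = X, arr1 = (\<lambda>y. y), arr2 = (\<lambda>_. \<zero>\<^bsub>X\<^esub>), arr3 = (\<lambda>x. x)\<rparr>"

definition ext2_trivial ::
    "('k::real_normed_field, 'a) qspace \<Rightarrow> ('k, 'a) qspace \<Rightarrow> ('k, 'a) four_term \<Rightarrow> bool" where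
  "ext2_trivial X Y E \<longleftrightarrow> (E, ext2_zero X Y) \<in> ext2_equiv X Y"


section \<open>Completions\<close>

definition same_limit :: "('k, 'a) qspace \<Rightarrow> (nat \<Rightarrow> 'a) \<Rightarrow> (nat \<Rightarrow> 'a) \<Rightarrow> bool" where
  "same_limit V s t \<longleftrightarrow> (\<lambda>n. qnorm V (s n \<ominus>\<^bsub>V\<^esub> t n)) \<longlonglongrightarrow> 0"

text \<open>
  The completion is the space of Cauchy sequences modulo null sequences, each class being replaced
  by a chosen member. A quasinorm need not be continuous, so \<open>lim \<parallel>s\<^sub>n\<parallel>\<close> may fail to exist or to
  depend only on the class of \<open>s\<close>. The quasinorm of a class is taken to be the infimum of the bounds
  \<open>r\<close> for which the class has a member in the ball of radius \<open>r\<close>. On the original space this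
  is equivalent to the given quasinorm (and equal to it if the latter is continuous).
\<close>

definition class_rep :: "('k, 'a) qspace \<Rightarrow> (nat \<Rightarrow> 'a) \<Rightarrow> (nat \<Rightarrow> 'a)" where
  "class_rep V s = (SOME t. qcauchy V t \<and> same_limit V s t)"

definition completion :: "('k, 'a) qspace \<Rightarrow> ('k, nat \<Rightarrow> 'a) qspace" where
  "completion V =
     \<lparr>carrier = class_rep V ` {s. qcauchy V s}, mult = undefined, one = undefined,
      zero = class_rep V (\<lambda>_. \<zero>\<^bsub>V\<^esub>),
      add = (\<lambda>s t. class_rep V (\<lambda>n. s n \<oplus>\<^bsub>V\<^esub> t n)),
      smult = (\<lambda>c s. class_rep V (\<lambda>n. c \<odot>\<^bsub>V\<^esub> s n)),
      qnorm = (\<lambda>s. Inf {r. \<exists>t. qcauchy V t \<and> same_limit V s t \<and> (\<forall>n. qnorm V (t n) \<le> r)})\<rparr>"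


section \<open>Coding into \<open>nat \<Rightarrow> 'k\<close>\<close>

definition transport :: "('a \<Rightarrow> 'b) \<Rightarrow> ('k, 'a) qspace \<Rightarrow> ('k, 'b) qspace" where
  "transport f V =
     \<lparr>carrier = f ` carrier V, mult = undefined, one = undefined,
      zero = f \<zero>\<^bsub>V\<^esub>,
      add = (\<lambda>x y. f (inv_into UNIV f x \<oplus>\<^bsub>V\<^esub> inv_into UNIV f y)),
      smult = (\<lambda>c x. f (c \<odot>\<^bsub>V\<^esub> inv_into UNIV f x)),
      qnorm = (\<lambda>x. qnorm V (inv_into UNIV f x))\<rparr>"

definition code_pair :: "(nat \<Rightarrow> 'k) \<times> (nat \<Rightarrow> 'k) \<Rightarrow> (nat \<Rightarrow> 'k)" where
  "code_pair w = (\<lambda>n. case sum_decode n of Inl i \<Rightarrow> fst w i | Inr j \<Rightarrow> snd w j)"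

definition code_seq :: "(nat \<Rightarrow> (nat \<Rightarrow> 'k) \<times> (nat \<Rightarrow> 'k)) \<Rightarrow> (nat \<Rightarrow> 'k)" where
  "code_seq s = (\<lambda>n. case prod_decode n of (i, j) \<Rightarrow> code_pair (s i) j)"

lemma inj_code_pair: "inj code_pair"
proof (rule injI)
  fix v w :: "(nat \<Rightarrow> 'k) \<times> (nat \<Rightarrow> 'k)"
  assume eq: "code_pair v = code_pair w"
  have "fst v i = fst w i" for i
    using fun_cong[OF eq, of "sum_encode (Inl i)"] by (simp add: code_pair_def)
  moreover have "snd v i = snd w i" for i
    using fun_cong[OF eq, of "sum_encode (Inr i)"] by (simp add: code_pair_def)
  ultimately show "v = w" by (simp add: prod_eq_iff fun_eq_iff)
qed

lemma inj_code_seq: "inj code_seq"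
proof (rule injI)
  fix s t :: "nat \<Rightarrow> (nat \<Rightarrow> 'k) \<times> (nat \<Rightarrow> 'k)"
  assume eq: "code_seq s = code_seq t"
  have "code_pair (s i) j = code_pair (t i) j" for i j
    using fun_cong[OF eq, of "prod_encode (i, j)"] by (simp add: code_seq_def)
  then have "code_pair (s i) = code_pair (t i)" for i by blast
  then show "s = t" by (intro ext) (metis injD inj_code_pair)
qed


section \<open>Induced and spliced sequences\<close>

definition twisted_sum ::
    "('k, 'a) qspace \<Rightarrow> ('k, 'b) qspace \<Rightarrow> 'b set \<Rightarrow> ('b \<Rightarrow> 'a) \<Rightarrow> ('k, 'a \<times> 'b) qspace" where
  "twisted_sum Y X X0 \<Phi> =
     \<lparr>carrier = carrier Y \<times> X0, mult = undefined, one = undefined,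
      zero = (\<zero>\<^bsub>Y\<^esub>, \<zero>\<^bsub>X\<^esub>),
      add = (\<lambda>(y, x) (y', x'). (y \<oplus>\<^bsub>Y\<^esub> y', x \<oplus>\<^bsub>X\<^esub> x')),
      smult = (\<lambda>c (y, x). (c \<odot>\<^bsub>Y\<^esub> y, c \<odot>\<^bsub>X\<^esub> x)),
      qnorm = (\<lambda>(y, x). qnorm Y (y \<ominus>\<^bsub>Y\<^esub> \<Phi> x) + qnorm X x)\<rparr>"

type_synonym 'k space = "('k, nat \<Rightarrow> 'k) qspace"

definition Z_space ::
    "'k space \<Rightarrow> 'k space \<Rightarrow> (nat \<Rightarrow> 'k) set \<Rightarrow> ((nat \<Rightarrow> 'k) \<Rightarrow> (nat \<Rightarrow> 'k)) \<Rightarrow> 'k space" where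
  "Z_space Y X X0 \<Phi> = transport code_seq (completion (twisted_sum Y X X0 \<Phi>))"

definition Z_incl ::
    "'k space \<Rightarrow> 'k space \<Rightarrow> (nat \<Rightarrow> 'k) set \<Rightarrow> ((nat \<Rightarrow> 'k) \<Rightarrow> (nat \<Rightarrow> 'k)) \<Rightarrow>
      (nat \<Rightarrow> 'k) \<Rightarrow> (nat \<Rightarrow> 'k)" where
  "Z_incl Y X X0 \<Phi> y = code_seq (class_rep (twisted_sum Y X X0 \<Phi>) (\<lambda>_. (y, \<zero>\<^bsub>X\<^esub>)))"

text \<open>
  The continuous extension of \<open>(y, x) \<mapsto> x\<close>: the class of a Cauchy sequence \<open>(y\<^sub>n, x\<^sub>n)\<close>
  is sent to \<open>lim x\<^sub>n\<close>.
\<close>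

definition Z_proj :: "'k space \<Rightarrow> (nat \<Rightarrow> 'k) \<Rightarrow> (nat \<Rightarrow> 'k)" where
  "Z_proj X z = (THE x. qconverges X (\<lambda>n. snd (inv_into UNIV code_seq z n)) x)"

definition spliced_sequence ::
    "'k space \<Rightarrow> 'k space \<Rightarrow> (nat \<Rightarrow> 'k) set \<Rightarrow> 'k space \<Rightarrow> (nat \<Rightarrow> 'k) set \<Rightarrow>
      ((nat \<Rightarrow> 'k) \<Rightarrow> (nat \<Rightarrow> 'k)) \<Rightarrow> ((nat \<Rightarrow> 'k) \<Rightarrow> (nat \<Rightarrow> 'k)) \<Rightarrow>
      ('k, nat \<Rightarrow> 'k) four_term" where
  "spliced_sequence Y E E0 X X0 \<Phi> \<Psi> =
     \<lparr>mid1 = Z_space Y E E0 \<Phi>,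
      mid2 = Z_space E X X0 \<Psi>,
      arr1 = Z_incl Y E E0 \<Phi>,
      arr2 = Z_incl E X X0 \<Psi> \<circ> Z_proj E,
      arr3 = Z_proj X\<rparr>"


section \<open>Centralizers on \<open>\<ell>\<^sub>p\<close>\<close>

definition lp :: "real \<Rightarrow> 'k::real_normed_field space" where
  "lp p =
     \<lparr>carrier = {x. summable (\<lambda>n. norm (x n) powr p)}, mult = undefined, one = undefined,
      zero = (\<lambda>_. 0),
      add = (\<lambda>x y n. x n + y n),
      smult = (\<lambda>c x n. c * x n),
      qnorm = (\<lambda>x. (\<Sum>n. norm (x n) powr p) powr (1 / p))\<rparr>"

definition lp0 :: "(nat \<Rightarrow> 'k::real_normed_field) set" where
  "lp0 = {x. finite {n. x n \<noteq> 0}}"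

definition centralizer ::
    "real \<Rightarrow> ((nat \<Rightarrow> 'k::real_normed_field) \<Rightarrow> (nat \<Rightarrow> 'k)) \<Rightarrow> bool" where
  "centralizer p \<Phi> \<longleftrightarrow>
     (\<forall>x\<in>lp0. \<Phi> x \<in> carrier (lp p)) \<and>
     (\<forall>c. \<forall>x\<in>lp0. \<Phi> (\<lambda>n. c * x n) = (\<lambda>n. c * \<Phi> x n)) \<and>
     (\<exists>C. \<forall>a. bdd_above (range (\<lambda>n. norm (a n))) \<longrightarrow> (\<forall>x\<in>lp0.
        qnorm (lp p) (\<lambda>n. \<Phi> (\<lambda>k. a k * x k) n - a n * \<Phi> x n)
          \<le> C * (SUP n. norm (a n)) * qnorm (lp p) x))"

end

theory Submission
  imports Defs
begin

text \<open>
  Write \<open>\<Phi> x = x f\<close>, where \<open>f\<close> depends only on the weight \<open>w = |x|\<^sup>p\<close> up to a bounded error. The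
  centralizer inequality says that \<open>f\<^sub>v - f\<^sub>w\<close> is bounded in \<open>L\<^sub>p(v)\<close> for \<open>v \<le> w\<close>. A
  Calderon--Zygmund decomposition in the style of the John--Nirenberg inequality replaces \<open>f\<close> by a
  function \<open>g\<close> within bounded distance such that \<open>g\<^sub>v - g\<^sub>w\<close> is even bounded in \<open>L\<^sub>2\<^sub>p(v)\<close>. Then
  \<open>x \<mapsto> (x g\<^sup>2 / 2, x g)\<close> is a quasilinear lift of \<open>\<Phi>\<close> to \<open>Z(\<Phi>)\<close>: with \<open>s = |x| + |y|\<close>, the
  defect of additivity of \<open>x g\<^sup>2 / 2\<close> is, up to a bounded error, \<open>g\<^sub>s\<close> times the defect \<open>\<Delta>\<close> of
  \<open>x g\<close>, and this is \<open>\<Phi> \<Delta>\<close> up to a bounded error. Such a lift trivializes the spliced sequence.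
\<close>

section \<open>Self-improvement of coherent families\<close>

text \<open>The functions \<open>x\<close>, \<open>x * g\<close>, \<open>x * g\<^sup>2 / 2\<close>
  are the first Taylor coefficients of \<open>x * exp (t * g)\<close>, whence the factor 1/2. The
  exponent \<open>2 * p\<close> is forced by the square: if \<open>e\<close> is the error of
  replacing the section of \<open>x\<close> by a common one, expanding the square leaves
  \<open>x * e\<^sup>2\<close>, and this has a finite modular at \<open>p\<close> when
  \<open>e\<close> is in the weighted L_2p. The centralizer inequality gives only L_p, and this gap
  is the obstacle. The family has to be changed, not merely estimated more carefully, since
  \<open>f\<close> may carry any error bounded in L_p. An improvement is possible because the
  hypothesis is much more than one inequality: it holds for all restrictions of a weight, so that
  oscillation can be localized on subsets, and homogeneity makes the family constant along rays, so
  that the constants need not see how small \<open>v\<close> is compared with \<open>w\<close>. The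
  lift need only cover \<open>\<Phi>\<close> up to a bounded error, and so \<open>x * g\<close> may
  take the place of \<open>\<Phi> x\<close> in its second coordinate; this is what allows exact
  algebra with \<open>g\<close>.\<close>

definition cut :: "(nat \<Rightarrow> real) \<Rightarrow> nat set \<Rightarrow> nat \<Rightarrow> real" where
  "cut w A = (\<lambda>n. if n \<in> A then w n else 0)"

definition coherent :: "real \<Rightarrow> real \<Rightarrow> ((nat \<Rightarrow> real) \<Rightarrow> nat \<Rightarrow> 'b::real_normed_vector) \<Rightarrow> bool" where
  "coherent p C F \<longleftrightarrow>
     (\<forall>S v w. finite S \<longrightarrow> (\<forall>n. n \<notin> S \<longrightarrow> w n = 0) \<longrightarrow> (\<forall>n. 0 \<le> v n \<and> v n \<le> w n) \<longrightarrow>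
        (\<Sum>n\<in>S. v n * norm (F v n - F w n) powr p) \<le> C * (\<Sum>n\<in>S. w n))"

text \<open>Coherence bounds an integral against \<open>v\<close> by the mass of \<open>w\<close>,
  which is poor if \<open>v\<close> is small. Where \<open>w\<close> is about
  \<open>2 ^ j * v\<close>, invariance lets \<open>w / 2 ^ j\<close> replace \<open>w\<close>
  without changing \<open>F w\<close>, and the bound becomes comparable to the mass of
  \<open>v\<close>.\<close>

definition scale_invariant :: "((nat \<Rightarrow> real) \<Rightarrow> 'c) \<Rightarrow> bool" where
  "scale_invariant F \<longleftrightarrow> (\<forall>c w. 0 < c \<longrightarrow> F (\<lambda>n. c * w n) = F w)"

lemma coherentD:
  assumes "coherent p C F" "finite S" "\<And>n. n \<notin> S \<Longrightarrow> w n = 0" "\<And>n. 0 \<le> v n" "\<And>n. v n \<le> w n"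
  shows "(\<Sum>n\<in>S. v n * norm (F v n - F w n) powr p) \<le> C * (\<Sum>n\<in>S. w n)"
  using assms unfolding coherent_def by blast

section \<open>Elementary inequalities for real powers\<close>

lemma powr_le_one_plus:
  fixes t :: real
  assumes "0 \<le> t" "0 < q" "q \<le> p"
  shows "t powr q \<le> 1 + t powr p"
proof (cases "t \<le> 1")
  case True
  then have "t powr q \<le> 1" using assms by (simp add: powr_le1)
  then show ?thesis by (smt (verit) powr_ge_zero)
next
  case False
  then have "t powr q \<le> t powr p" using assms by (intro powr_mono) auto
  then show ?thesis by simp
qed

lemma powr_add_le:
  fixes a b :: real
  assumes "0 \<le> a" "0 \<le> b" "0 < p"
  shows "(a + b) powr p \<le> 2 powr p * (a powr p + b powr p)"
proof -
  have "(a + b) powr p \<le> (2 * max a b) powr p"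
    using assms by (intro powr_mono2) auto
  also have "\<dots> = 2 powr p * max a b powr p" using assms by (simp add: powr_mult)
  also have "max a b powr p \<le> a powr p + b powr p" by (auto simp: max_def)
  finally show ?thesis by simp
qed

lemma powr_subadditive:
  fixes a b :: real
  assumes "0 \<le> a" "0 \<le> b" "0 < q" "q \<le> 1"
  shows "(a + b) powr q \<le> a powr q + b powr q"
proof (cases "a + b = 0")
  case True then show ?thesis using assms by simp
next
  case False
  then have s: "0 < a + b" using assms by simp
  have *: "t \<le> t powr q" if "0 \<le> t" "t \<le> 1" for t :: real
  proof (cases "t = 0")
    case False
    then show ?thesis using powr_mono'[of q 1 t] that assms by simp
  qed (simp)
  have "1 = a / (a + b) + b / (a + b)" using s by (simp add: add_divide_distrib[symmetric])
  also have "\<dots> \<le> (a / (a + b)) powr q + (b / (a + b)) powr q"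
    using assms s by (intro add_mono *) auto
  also have "\<dots> = (a powr q + b powr q) / (a + b) powr q"
    using assms s by (simp add: powr_divide add_divide_distrib)
  finally show ?thesis using s by (simp add: field_simps)
qed

text \<open>For \<open>q \<le> 1\<close> the power of the norm is a metric, so the triangle
  inequality costs no factor. This is the reason for working at an exponent at most 1 first: in the
  comparison of maximizers the same quantity stands on both sides and has to cancel exactly.\<close>

lemma powr_norm_diff_le:
  fixes a b c :: "'b::real_normed_vector"
  assumes "0 < q" "q \<le> 1"
  shows "norm (a - c) powr q \<le> norm (a - b) powr q + norm (b - c) powr q"
proof -
  have "norm (a - c) \<le> norm (a - b) + norm (b - c)"
    using norm_triangle_ineq[of "a - b" "b - c"] by simp
  then have "norm (a - c) powr q \<le> (norm (a - b) + norm (b - c)) powr q"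
    using assms by (intro powr_mono2) auto
  also have "\<dots> \<le> norm (a - b) powr q + norm (b - c) powr q"
    using assms by (intro powr_subadditive) auto
  finally show ?thesis .
qed

section \<open>Coherence at smaller exponents and on restrictions\<close>

lemma coherent_exponent_mono:
  assumes "coherent p C F" "0 < q" "q \<le> p"
  shows "coherent q (1 + C) F"
  unfolding coherent_def
proof (intro allI impI)
  fix S and v w :: "nat \<Rightarrow> real"
  assume S: "finite S" and w: "\<forall>n. n \<notin> S \<longrightarrow> w n = 0" and v: "\<forall>n. 0 \<le> v n \<and> v n \<le> w n"
  have "(\<Sum>n\<in>S. v n * norm (F v n - F w n) powr q)
      \<le> (\<Sum>n\<in>S. w n + v n * norm (F v n - F w n) powr p)"
  proof (rule sum_mono)
    fix n
    have "v n * norm (F v n - F w n) powr q \<le> v n * (1 + norm (F v n - F w n) powr p)"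
      using v assms by (intro mult_left_mono powr_le_one_plus) auto
    also have "\<dots> \<le> w n + v n * norm (F v n - F w n) powr p"
      using v by (simp add: algebra_simps)
    finally show "v n * norm (F v n - F w n) powr q \<le> w n + v n * norm (F v n - F w n) powr p" .
  qed
  also have "\<dots> \<le> (1 + C) * (\<Sum>n\<in>S. w n)"
    using coherentD[OF assms(1) S, of w v] w v by (simp add: sum.distrib algebra_simps)
  finally show "(\<Sum>n\<in>S. v n * norm (F v n - F w n) powr q) \<le> (1 + C) * sum w S" .
qed

lemma coherent_cut:
  assumes "coherent q C F" "finite B" "A \<subseteq> B" "\<And>n. 0 \<le> w n"
  shows "(\<Sum>n\<in>A. w n * norm (F (cut w A) n - F (cut w B) n) powr q) \<le> C * sum w B"
proof -
  have "(\<Sum>n\<in>B. cut w A n * norm (F (cut w A) n - F (cut w B) n) powr q) \<le> C * (\<Sum>n\<in>B. cut w B n)"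
    using assms by (intro coherentD) (auto simp: cut_def)
  moreover have "(\<Sum>n\<in>B. cut w B n) = sum w B" by (simp add: cut_def)
  moreover have "(\<Sum>n\<in>B. cut w A n * norm (F (cut w A) n - F (cut w B) n) powr q)
      = (\<Sum>n\<in>A. w n * norm (F (cut w A) n - F (cut w B) n) powr q)"
    using assms by (intro sum.mono_neutral_cong_right) (auto simp: cut_def)
  ultimately show ?thesis by simp
qed

section \<open>Maximizing sets and exceptional sets\<close>

lemma ex_dyadic_scale:
  fixes \<rho> :: real
  assumes "0 < \<rho>" "\<rho> \<le> 1"
  obtains k :: nat where "\<rho> * 2 ^ k \<le> 1" "1 < \<rho> * 2 ^ Suc k"
proof -
  obtain m where m: "1 / \<rho> < 2 ^ m" using real_arch_pow[of 2 "1 / \<rho>"] by auto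
  define m0 where "m0 = (LEAST m. 1 / \<rho> < (2::real) ^ m)"
  have m0: "1 / \<rho> < 2 ^ m0" unfolding m0_def by (rule LeastI[of _ m]) (rule m)
  have "m0 \<noteq> 0" using m0 assms by (intro notI) (simp add: field_simps)
  then obtain k where k: "m0 = Suc k" by (cases m0) auto
  have "\<not> 1 / \<rho> < 2 ^ k" using not_less_Least[of k "\<lambda>m. 1 / \<rho> < (2::real) ^ m"] k by (simp add: m0_def)
  then show ?thesis using that[of k] m0 k assms by (simp add: field_simps)
qed

text \<open>Maximality is tested against \<open>V \<union> A\<close>: as \<open>q \<le> 1\<close>, the quantity \<open>D\<close> is additive on disjoint
  sets up to the error in coherence.\<close>

lemma penalized_maximizer:
  assumes coh: "coherent q C F" and q: "0 < q" "q \<le> 1" and C: "0 \<le> C"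
    and w: "\<And>n. 0 \<le> w n" and B: "finite B" "B' \<subseteq> B"
  defines "D \<equiv> \<lambda>A. \<Sum>n\<in>A. w n * norm (F (cut w A) n - F (cut w B) n) powr q"
  obtains V where "V \<subseteq> B'" "\<kappa> * sum w V \<le> D V"
    "\<And>A. A \<subseteq> B' - V \<Longrightarrow> D A \<le> \<kappa> * sum w A + 2 * C * (sum w V + sum w A)"
proof -
  define J where "J V = D V - \<kappa> * sum w V" for V
  have finB': "finite B'" using B finite_subset by blast
  have fin: "finite (J ` Pow B')" "J ` Pow B' \<noteq> {}" using finB' by auto
  obtain V where V: "V \<in> Pow B'" "J V = Max (J ` Pow B')"
    using Max_in[OF fin] by (metis imageE)
  have max: "J V' \<le> J V" if "V' \<subseteq> B'" for V'
    using Max_ge[OF fin(1)] that V by auto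
  \<comment> \<open>Competing against the empty set shows that the oscillation on \<open>V\<close>
    averages at least \<open>\<kappa>\<close>; competing against \<open>V \<union> A\<close> shows
    that outside \<open>V\<close> it averages at most about \<open>\<kappa>\<close>. These are the
    two sides of a Calderon--Zygmund stopping rule, with a maximizer in place of maximal
    cubes.\<close>
  have "J {} = 0" by (simp add: J_def D_def)
  then have "\<kappa> * sum w V \<le> D V" using max[of "{}"] by (simp add: J_def)
  moreover have "D A \<le> \<kappa> * sum w A + 2 * C * (sum w V + sum w A)" if A: "A \<subseteq> B' - V" for A
  proof -
    have finAV: "finite A" "finite V" "A \<inter> V = {}"
      using A V finB' by (auto intro: finite_subset)
    define E where "E n = norm (F (cut w (V \<union> A)) n - F (cut w B) n) powr q" for n
    have part: "D X \<le> (\<Sum>n\<in>X. w n * E n) + C * sum w (V \<union> A)" if X: "X \<subseteq> V \<union> A" for X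
    proof -
      have "D X \<le> (\<Sum>n\<in>X. w n * E n + w n * norm (F (cut w X) n - F (cut w (V \<union> A)) n) powr q)"
        unfolding D_def
      proof (rule sum_mono)
        fix n
        have "norm (F (cut w X) n - F (cut w B) n) powr q
           \<le> E n + norm (F (cut w X) n - F (cut w (V \<union> A)) n) powr q"
          unfolding E_def using powr_norm_diff_le[OF q] by (simp add: add.commute)
        then show "w n * norm (F (cut w X) n - F (cut w B) n) powr q
            \<le> w n * E n + w n * norm (F (cut w X) n - F (cut w (V \<union> A)) n) powr q"
          using w[of n] by (simp add: mult_left_mono flip: distrib_left)
      qed
      also have "\<dots> \<le> (\<Sum>n\<in>X. w n * E n) + C * sum w (V \<union> A)"
        using coherent_cut[OF coh _ X w] finAV by (simp add: sum.distrib)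
      finally show ?thesis .
    qed
    have "D (V \<union> A) = (\<Sum>n\<in>V. w n * E n) + (\<Sum>n\<in>A. w n * E n)"
      unfolding D_def E_def using finAV by (subst sum.union_disjoint) auto
    then have "D V + D A \<le> D (V \<union> A) + 2 * C * sum w (V \<union> A)"
      using part[of V] part[of A] by simp
    moreover have "J (V \<union> A) \<le> J V" using A V by (intro max) auto
    moreover have "sum w (V \<union> A) = sum w V + sum w A"
      using finAV by (subst sum.union_disjoint) auto
    ultimately show ?thesis by (simp add: J_def algebra_simps)
  qed
  ultimately show ?thesis using V that by auto
qed

lemma sum_UN_le:
  fixes w :: "'i \<Rightarrow> real"
  assumes "finite K" "\<And>k. k \<in> K \<Longrightarrow> finite (V k)" "\<And>n. 0 \<le> w n"
  shows "sum w (\<Union>k\<in>K. V k) \<le> (\<Sum>k\<in>K. sum w (V k))"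
  using assms
proof (induction K rule: finite_induct)
  case (insert k K)
  have "sum w (V k \<union> (\<Union>k\<in>K. V k)) \<le> sum w (V k) + sum w (\<Union>k\<in>K. V k)"
    using insert by (subst sum.union_inter[symmetric]) (auto simp: sum_nonneg)
  then show ?case using insert by simp
qed simp

text \<open>The exponent improves from \<open>1 - 1 / m\<close> to \<open>1 - 1 / (m + 1)\<close> because, by the former bound, a
  maximizer for the penalty \<open>L 2\<^sup>k\<close> has relative mass at most \<open>2\<^sup>-\<^sup>k\<^sup>m\<close>.\<close>

lemma exceptional_set:
  assumes coh: "coherent q C F" and q: "0 < q" "q \<le> 1" and C: "0 \<le> C" and "0 < \<delta>"
  shows "\<exists>K\<ge>0. \<forall>w B. (\<forall>n. 0 \<le> w n) \<longrightarrow> finite B \<longrightarrow>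
    (\<exists>U\<subseteq>B. sum w U \<le> \<delta> * sum w B \<and>
      (\<forall>A\<subseteq>B - U. (\<Sum>n\<in>A. w n * norm (F (cut w A) n - F (cut w B) n) powr q)
         \<le> K * (sum w B powr (1 / Suc j) * sum w A powr (1 - 1 / Suc j))))"
  using \<open>0 < \<delta>\<close>
proof (induction j arbitrary: \<delta>)
  case 0
  show ?case
  proof (intro exI[of _ C] conjI allI impI C exI[of _ "{}"])
    fix w :: "nat \<Rightarrow> real" and B A :: "nat set"
    assume w: "\<forall>n. 0 \<le> w n" and B: "finite B" and A: "A \<subseteq> B - {}"
    have finA: "finite A" using A B finite_subset by auto
    show "(\<Sum>n\<in>A. w n * norm (F (cut w A) n - F (cut w B) n) powr q)
         \<le> C * (sum w B powr (1 / Suc 0) * sum w A powr (1 - 1 / Suc 0))"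
    \<comment> \<open>The exponent of \<open>sum w A\<close> is zero here and
      \<open>0 powr 0 = 0\<close>, so the right side vanishes for a null set and cannot be read as
      \<open>C * sum w B\<close>.\<close>
    proof (cases "sum w A = 0")
      case True
      then have "\<forall>n\<in>A. w n = 0" using w finA by (simp add: sum_nonneg_eq_0_iff)
      then show ?thesis using True by simp
    next
      case False
      then have "(sum w A) powr 0 = 1" by simp
      moreover have "sum w B powr 1 = sum w B" using w by (simp add: sum_nonneg)
      ultimately show ?thesis using coherent_cut[OF coh B, of A w] w A by simp
    qed
  qed (use 0 in \<open>auto simp: sum_nonneg\<close>)
next
  case (Suc j)
  obtain K where K: "0 \<le> K" and ex: "\<And>w B. (\<forall>n. 0 \<le> w n) \<Longrightarrow> finite B \<Longrightarrow>
    (\<exists>U\<subseteq>B. sum w U \<le> \<delta> / 2 * sum w B \<and>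
      (\<forall>A\<subseteq>B - U. (\<Sum>n\<in>A. w n * norm (F (cut w A) n - F (cut w B) n) powr q)
         \<le> K * (sum w B powr (1 / Suc j) * sum w A powr (1 - 1 / Suc j))))"
    using Suc.IH[of "\<delta> / 2"] Suc.prems by auto
  define m where "m = Suc j"
  \<comment> \<open>Chosen so that \<open>K / L\<close> is at most 1 and at most
    \<open>\<delta> / 4\<close>. The first bound gives the masses of the maximizers the decay
    \<open>(1 / 2 ^ k) ^ m\<close>, the second makes all of them together at most
    \<open>\<delta> / 2\<close> of the total.\<close>
  define L where "L = (K + 1) * (1 + 4 / \<delta>)"
  have L: "0 < L" unfolding L_def using K Suc.prems by (intro mult_pos_pos) (auto intro: add_pos_pos)
  have KL: "K / L \<le> 1" "K / L \<le> \<delta> / 4"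
  proof -
    have "K * 1 \<le> (K + 1) * (1 + 4 / \<delta>)" using K Suc.prems by (intro mult_mono) auto
    then show "K / L \<le> 1" using L by (simp add: L_def)
    have "K * (4 / \<delta>) \<le> (K + 1) * (1 + 4 / \<delta>)" using K Suc.prems by (intro mult_mono) auto
    then have "K * (4 / \<delta>) \<le> L" by (simp add: L_def)
    then show "K / L \<le> \<delta> / 4" using L Suc.prems by (simp add: field_simps)
  qed
  \<comment> \<open>\<open>L\<close> comes from the penalty, \<open>2 * C\<close> from the mass of
    \<open>A\<close>, and \<open>2 * C * 2 ^ m\<close> from the mass of the maximizer, where
    \<open>2 ^ m\<close> is lost by rounding the optimal scale to a power of two.\<close>
  define K' where "K' = L + 2 * C + 2 * C * 2 ^ m"
  have K': "0 \<le> K'" using L C by (simp add: K'_def)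
  show ?case
  proof (intro exI[of _ K'] conjI K' allI impI)
    fix w :: "nat \<Rightarrow> real" and B :: "nat set"
    assume w: "\<forall>n. 0 \<le> w n" and B: "finite B"
    define D where "D A = (\<Sum>n\<in>A. w n * norm (F (cut w A) n - F (cut w B) n) powr q)" for A
    have w0: "\<And>n. 0 \<le> w n" using w by blast
    have "\<exists>U\<subseteq>B. sum w U \<le> \<delta> / 2 * sum w B \<and>
      (\<forall>A\<subseteq>B - U. D A \<le> K * (sum w B powr (1 / m) * sum w A powr (1 - 1 / m)))"
      using ex[OF w B] unfolding D_def m_def .
    then obtain U0 where U0: "U0 \<subseteq> B" "sum w U0 \<le> \<delta> / 2 * sum w B"
      and D0: "\<And>A. A \<subseteq> B - U0 \<Longrightarrow> D A \<le> K * (sum w B powr (1 / m) * sum w A powr (1 - 1 / m))"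
      by blast
    \<comment> \<open>The best penalty for a set \<open>A\<close> depends on its relative mass, and
      the exceptional set has to serve all \<open>A\<close> at once. Hence one maximizer for every
      dyadic penalty is removed.\<close>
    have "\<forall>k. \<exists>V. V \<subseteq> B - U0 \<and> L * 2 ^ k * sum w V \<le> D V \<and>
       (\<forall>A. A \<subseteq> B - U0 - V \<longrightarrow> D A \<le> L * 2 ^ k * sum w A + 2 * C * (sum w V + sum w A))"
    proof
      fix k
      obtain V where "V \<subseteq> B - U0" "L * 2 ^ k * sum w V \<le> D V"
        "\<And>A. A \<subseteq> B - U0 - V \<Longrightarrow> D A \<le> L * 2 ^ k * sum w A + 2 * C * (sum w V + sum w A)"
        using penalized_maximizer[where w = w and B' = "B - U0" and \<kappa> = "L * 2 ^ k",
            OF coh q C w0 B Diff_subset, folded D_def] by blast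
      then show "\<exists>V. V \<subseteq> B - U0 \<and> L * 2 ^ k * sum w V \<le> D V \<and>
       (\<forall>A. A \<subseteq> B - U0 - V \<longrightarrow> D A \<le> L * 2 ^ k * sum w A + 2 * C * (sum w V + sum w A))" by blast
    qed
    then obtain V where V: "\<And>k. V k \<subseteq> B - U0" "\<And>k. L * 2 ^ k * sum w (V k) \<le> D (V k)"
      and DV: "\<And>k A. A \<subseteq> B - U0 - V k \<Longrightarrow> D A \<le> L * 2 ^ k * sum w A + 2 * C * (sum w (V k) + sum w A)"
      by metis
    have finV: "finite (V k)" for k using V(1)[of k] B finite_subset by blast
    have sV: "sum w (V k) \<le> (K / (L * 2 ^ k)) ^ m * sum w B" for k
    proof (cases "sum w (V k) = 0")
      case True
      then show ?thesis using K L w by (simp add: sum_nonneg)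
    next
      case False
      define a where "a = sum w (V k)"
      define b where "b = sum w B"
      have a: "0 < a" unfolding a_def using False w by (simp add: sum_nonneg order_less_le)
      have ab: "a \<le> b" unfolding a_def b_def using V(1) w B by (intro sum_mono2) auto
      \<comment> \<open>Maximality bounds \<open>D (V k)\<close> from below linearly in the mass
        \<open>a\<close>, while the induction hypothesis bounds it from above by the smaller power
        \<open>1 - 1 / m\<close> of \<open>a\<close>; together they force \<open>a\<close> to be
        small.\<close>
      have "L * 2 ^ k * a \<le> K * (b powr (1 / m) * a powr (1 - 1 / m))"
        using V(2)[of k] D0[OF V(1)] unfolding a_def b_def by (meson order_trans)
      also have "\<dots> = K * b powr (1 / m) * a / a powr (1 / m)"
        using a by (simp add: powr_diff)
      finally have "L * 2 ^ k * a powr (1 / m) * a \<le> K * b powr (1 / m) * a"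
        using a by (simp add: field_simps)
      then have "L * 2 ^ k * a powr (1 / m) \<le> K * b powr (1 / m)" using a by simp
      then have "a powr (1 / m) \<le> K / (L * 2 ^ k) * b powr (1 / m)" using L by (simp add: field_simps)
      then have "(a powr (1 / m)) ^ m \<le> (K / (L * 2 ^ k) * b powr (1 / m)) ^ m"
        by (intro power_mono) auto
      moreover have "(t powr (1 / m)) ^ m = t" if "0 < t" for t :: real
        using that by (simp add: powr_realpow[symmetric] powr_powr m_def del: power_Suc of_nat_Suc)
      ultimately have "a \<le> (K / (L * 2 ^ k)) ^ m * b"
        using a ab by (simp only: power_mult_distrib)
      then show ?thesis by (simp add: a_def b_def)
    qed
    have sV1: "sum w (V k) \<le> (1 / 2 ^ k) ^ m * sum w B" for k
    proof -
      have "(K / (L * 2 ^ k)) ^ m \<le> (1 / 2 ^ k) ^ m"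
        using KL K L by (intro power_mono) (auto simp: field_simps)
      then show ?thesis using sV[of k] w by (meson mult_right_mono order_trans sum_nonneg)
    qed
    have sV2: "sum w (V k) \<le> (1 / 2) ^ k * (\<delta> / 4 * sum w B)" for k
    proof -
      have le1: "K / (L * 2 ^ k) \<le> 1"
      proof -
        have "K / (L * 2 ^ k) = K / L * (1 / 2 ^ k)" by simp
        also have "\<dots> \<le> 1 * 1" using KL K L by (intro mult_mono) auto
        finally show ?thesis by simp
      qed
      have "(K / (L * 2 ^ k)) ^ m \<le> (K / (L * 2 ^ k)) ^ 1"
        using le1 K L by (intro power_decreasing) (auto simp: m_def)
      also have "\<dots> = K / L * (1 / 2) ^ k" by (simp add: power_divide)
      also have "\<dots> \<le> \<delta> / 4 * (1 / 2) ^ k" using KL by (intro mult_right_mono) auto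
      finally have "(K / (L * 2 ^ k)) ^ m * sum w B \<le> \<delta> / 4 * (1 / 2) ^ k * sum w B"
        using w by (intro mult_right_mono) (auto simp: sum_nonneg)
      then show ?thesis using sV[of k] by (simp add: mult_ac)
    qed
    define U where "U = U0 \<union> (\<Union>k. V k)"
    have "(\<Union>k. V k) \<subseteq> B" using V(1) by blast
    then have finUV: "finite (\<Union>k. V k)" using B finite_subset by blast
    \<comment> \<open>\<open>B\<close> is finite, so finitely many of the maximizers already exhaust
      the union and a finite geometric sum suffices.\<close>
    have "\<exists>n. (\<Union>k. V k) \<subseteq> (\<Union>k<n. V k)"
    proof -
      have "\<forall>x\<in>(\<Union>k. V k). \<exists>k. x \<in> V k" by blast
      then obtain f where f: "\<And>x. x \<in> (\<Union>k. V k) \<Longrightarrow> x \<in> V (f x)" by metis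
      obtain n where "\<And>x. x \<in> (\<Union>k. V k) \<Longrightarrow> f x < n"
        using finUV finite_nat_set_iff_bounded[of "f ` (\<Union>k. V k)"] by blast
      then show ?thesis using f by blast
    qed
    then obtain n where n: "(\<Union>k. V k) \<subseteq> (\<Union>k<n. V k)" by blast
    have "sum w (\<Union>k. V k) \<le> sum w (\<Union>k<n. V k)"
      using n w finV by (intro sum_mono2) auto
    also have "\<dots> \<le> (\<Sum>k<n. sum w (V k))" using finV w by (intro sum_UN_le) auto
    also have "\<dots> \<le> (\<Sum>k<n. (1 / 2) ^ k * (\<delta> / 4 * sum w B))" by (intro sum_mono sV2)
    also have "\<dots> = (\<Sum>k<n. (1 / 2) ^ k) * (\<delta> / 4 * sum w B)" by (simp add: sum_distrib_right)
    also have "(\<Sum>k<n. (1 / 2 :: real) ^ k) \<le> 2"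
      by (simp add: geometric_sum)
    finally have UV: "sum w (\<Union>k. V k) \<le> \<delta> / 2 * sum w B"
      using w Suc.prems by (auto simp: sum_nonneg mult_right_mono)
    show "\<exists>U\<subseteq>B. sum w U \<le> \<delta> * sum w B \<and>
      (\<forall>A\<subseteq>B - U. (\<Sum>n\<in>A. w n * norm (F (cut w A) n - F (cut w B) n) powr q)
         \<le> K' * (sum w B powr (1 / Suc (Suc j)) * sum w A powr (1 - 1 / Suc (Suc j))))"
    proof (intro exI[of _ U] conjI allI impI)
      show "U \<subseteq> B" using U0 V(1) by (auto simp: U_def)
      have finU0: "finite U0" using U0 B finite_subset by blast
      have "sum w U \<le> sum w U0 + sum w (\<Union>k. V k)"
        unfolding U_def using finU0 finUV w
        by (subst sum.union_inter[symmetric]) (auto simp: sum_nonneg)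
      then show "sum w U \<le> \<delta> * sum w B" using UV U0 by simp
    next
      fix A assume A: "A \<subseteq> B - U"
      have finA: "finite A" using A B finite_subset by blast
      show "(\<Sum>n\<in>A. w n * norm (F (cut w A) n - F (cut w B) n) powr q)
         \<le> K' * (sum w B powr (1 / Suc (Suc j)) * sum w A powr (1 - 1 / Suc (Suc j)))"
      proof (cases "sum w A = 0")
        case True
        then have "\<forall>n\<in>A. w n = 0" using w finA by (simp add: sum_nonneg_eq_0_iff)
        then show ?thesis using True by simp
      next
        case False
        define a where "a = sum w A"
        define b where "b = sum w B"
        have a: "0 < a" unfolding a_def using False w by (simp add: sum_nonneg order_less_le)
        have ab: "a \<le> b" unfolding a_def b_def using A w B by (intro sum_mono2) auto
        \<comment> \<open>The bound for \<open>D A\<close> contains \<open>2 ^ k * a\<close> and the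
          mass of \<open>V k\<close>, at most \<open>b / 2 ^ (k * m)\<close>. They balance when
          \<open>2 ^ k\<close> is \<open>1 / \<rho>\<close> with
          \<open>\<rho> ^ Suc m = a / b\<close>, and both are then about
          \<open>\<rho> ^ m * b\<close>, the new geometric mean.\<close>
        define \<rho> where "\<rho> = (a / b) powr (1 / Suc m)"
        have \<rho>: "0 < \<rho>" "\<rho> \<le> 1" unfolding \<rho>_def using a ab by (auto intro!: powr_le1)
        have \<rho>m: "\<rho> ^ Suc m = a / b" unfolding \<rho>_def using a ab
          by (simp add: powr_realpow[symmetric] powr_powr del: power_Suc of_nat_Suc)
        obtain k where k: "\<rho> * 2 ^ k \<le> 1" "1 < \<rho> * 2 ^ Suc k" using ex_dyadic_scale[OF \<rho>] .
        have k1: "2 ^ k * a \<le> \<rho> ^ m * b"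
        proof -
          have "a = \<rho> * \<rho> ^ m * b" using \<rho>m a ab by (simp add: field_simps)
          then have "2 ^ k * a = (\<rho> * 2 ^ k) * (\<rho> ^ m * b)" by simp
          also have "\<dots> \<le> 1 * (\<rho> ^ m * b)" using k \<rho> a ab by (intro mult_right_mono) auto
          finally show ?thesis by simp
        qed
        have k2: "(1 / 2 ^ k) ^ m \<le> 2 ^ m * \<rho> ^ m"
        proof -
          have "1 / 2 ^ k \<le> 2 * \<rho>" using k by (simp add: field_simps)
          then have "(1 / 2 ^ k) ^ m \<le> (2 * \<rho>) ^ m" by (intro power_mono) auto
          then show ?thesis by (simp add: power_mult_distrib)
        qed
        have a\<rho>: "a \<le> \<rho> ^ m * b" 
        proof -
          have "a * 1 \<le> a * 2 ^ k" using a by (intro mult_left_mono) auto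
          then show ?thesis using k1 by (simp add: mult_ac)
        qed
        have "D A \<le> L * (2 ^ k * a) + 2 * C * (sum w (V k) + a)"
          using DV[of A k] A by (auto simp: U_def a_def mult_ac)
        also have "\<dots> \<le> L * (\<rho> ^ m * b) + 2 * C * (2 ^ m * \<rho> ^ m * b + \<rho> ^ m * b)"
        proof (intro add_mono mult_left_mono k1 a\<rho>)
          have "(1 / 2 ^ k) ^ m * b \<le> 2 ^ m * \<rho> ^ m * b"
            using k2 a ab by (intro mult_right_mono) auto
          then show "sum w (V k) \<le> 2 ^ m * \<rho> ^ m * b"
            using sV1[of k] unfolding b_def by linarith
        qed (use L C in auto)
        also have "\<dots> = K' * (\<rho> ^ m * b)" by (simp add: K'_def algebra_simps)
        also have "\<rho> ^ m * b = b powr (1 / Suc m) * a powr (1 - 1 / Suc m)"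
        proof -
          have e: "real m / real (Suc m) = 1 - 1 / Suc m" by (simp add: field_simps)
          have "\<rho> ^ m = (a / b) powr (1 - 1 / Suc m)"
            unfolding \<rho>_def using a ab
            by (subst powr_realpow[symmetric]) (auto simp: powr_powr e simp del: of_nat_Suc)
          also have "\<dots> = a powr (1 - 1 / Suc m) / b powr (1 - 1 / Suc m)"
            using a ab by (simp add: powr_divide)
          also have "b powr (1 - 1 / Suc m) = b / b powr (1 / Suc m)"
            using a ab by (simp add: powr_diff)
          finally show ?thesis using a ab by (simp add: field_simps)
        qed
        finally show ?thesis by (simp add: D_def a_def b_def m_def)
      qed
    qed
  qed
qed

section \<open>Sections with improved integrability on subsets\<close>

lemma le_weighted_geometric_mean:
  fixes a b :: real
  assumes "0 \<le> a" "a \<le> b" "0 \<le> \<alpha>"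
  shows "a \<le> b powr \<alpha> * a powr (1 - \<alpha>)"
proof (cases "a = 0")
  case False
  then have "a = a powr \<alpha> * a powr (1 - \<alpha>)" using assms by (simp flip: powr_add)
  also have "\<dots> \<le> b powr \<alpha> * a powr (1 - \<alpha>)"
    using assms by (intro mult_right_mono powr_mono2) auto
  finally show ?thesis .
qed simp

text \<open>Take \<open>g = F w\<close> off the exceptional set and recurse on the exceptional set; \<open>\<delta>\<close> is chosen so
  small that the recursion halves the constant.\<close>

lemma improved_local_section:
  fixes F :: "(nat \<Rightarrow> real) \<Rightarrow> nat \<Rightarrow> 'b::real_normed_vector"
  assumes coh: "coherent q C F" and q: "0 < q" "q \<le> 1" and C: "0 \<le> C"
  shows "\<exists>K\<ge>0. \<forall>w B. (\<forall>n. 0 \<le> w n) \<longrightarrow> finite B \<longrightarrow>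
    (\<exists>g. \<forall>A\<subseteq>B. (\<Sum>n\<in>A. w n * norm (F (cut w A) n - g n) powr q)
         \<le> K * (sum w B powr (1 / Suc j) * sum w A powr (1 - 1 / Suc j)))"
proof -
  define \<alpha> where "\<alpha> = 1 / real (Suc j)"
  have \<alpha>: "0 < \<alpha>" "\<alpha> \<le> 1" by (auto simp: \<alpha>_def)
  define \<delta> where "\<delta> = (1 / 2 :: real) ^ Suc j"
  have \<delta>: "0 < \<delta>" "\<delta> < 1" by (auto simp: \<delta>_def power_less_one_iff simp del: power_Suc)
  have \<delta>\<alpha>: "\<delta> powr \<alpha> = 1 / 2"
    unfolding \<delta>_def \<alpha>_def by (subst powr_realpow[symmetric]) (auto simp: powr_powr simp del: of_nat_Suc)
  obtain K where K: "0 \<le> K" and ex: "\<And>w B. (\<forall>n. 0 \<le> w n) \<Longrightarrow> finite B \<Longrightarrow>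
    (\<exists>U\<subseteq>B. sum w U \<le> \<delta> * sum w B \<and>
      (\<forall>A\<subseteq>B - U. (\<Sum>n\<in>A. w n * norm (F (cut w A) n - F (cut w B) n) powr q)
         \<le> K * (sum w B powr \<alpha> * sum w A powr (1 - \<alpha>))))"
    using exceptional_set[OF coh q C \<delta>(1), of j] unfolding \<alpha>_def by blast
  \<comment> \<open>The solution of \<open>K' = K + 2 * C + K' / 2\<close>: \<open>K\<close> from
    the good part, \<open>C\<close> twice from changing the reference set, and half of the old
    constant from the recursion, as \<open>\<delta> powr \<alpha> = 1 / 2\<close>.\<close>
  define K' where "K' = 2 * (K + 2 * C)"
  have K': "0 \<le> K'" using K C by (simp add: K'_def)
  have main: "\<exists>g. \<forall>A\<subseteq>B. (\<Sum>n\<in>A. w n * norm (F (cut w A) n - g n) powr q)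
         \<le> K' * (sum w B powr \<alpha> * sum w A powr (1 - \<alpha>))"
    if w: "\<forall>n. 0 \<le> w n" and "finite B" for w B
    using \<open>finite B\<close>
  proof (induction B rule: finite_psubset_induct)
    case (psubset B)
    show ?case
    \<comment> \<open>With zero mass the exceptional set could be all of \<open>B\<close> and the
      recursion would not descend; but then every \<open>g\<close> will do.\<close>
    proof (cases "sum w B = 0")
      case True
      then have "\<forall>n\<in>B. w n = 0" using w psubset.hyps by (simp add: sum_nonneg_eq_0_iff)
      then show ?thesis by (intro exI[of _ "\<lambda>_. 0"]) (auto simp: subset_iff K' intro!: mult_nonneg_nonneg)
    next
      case False
      then have b: "0 < sum w B" using w by (simp add: sum_nonneg order_less_le)
      obtain U where U: "U \<subseteq> B" "sum w U \<le> \<delta> * sum w B"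
        and good: "\<And>A. A \<subseteq> B - U \<Longrightarrow> (\<Sum>n\<in>A. w n * norm (F (cut w A) n - F (cut w B) n) powr q)
         \<le> K * (sum w B powr \<alpha> * sum w A powr (1 - \<alpha>))"
        using ex[OF w psubset.hyps] by blast
      have "\<delta> * sum w B < 1 * sum w B" using \<delta> b by (intro mult_strict_right_mono) auto
      then have "U \<noteq> B" using U by auto
      then obtain gU where gU: "\<And>A. A \<subseteq> U \<Longrightarrow> (\<Sum>n\<in>A. w n * norm (F (cut w A) n - gU n) powr q)
         \<le> K' * (sum w U powr \<alpha> * sum w A powr (1 - \<alpha>))"
        using psubset.IH[of U] U by blast
      define g where "g n = (if n \<in> U then gU n else F (cut w B) n)" for n
      show ?thesis
      proof (intro exI[of _ g] allI impI)
        fix A assume A: "A \<subseteq> B"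
        have finA: "finite A" using A psubset.hyps finite_subset by blast
        define T where "T = sum w B powr \<alpha> * sum w A powr (1 - \<alpha>)"
        have Amono: "sum w X powr (1 - \<alpha>) \<le> sum w A powr (1 - \<alpha>)" if "X \<subseteq> A" for X
          using that w finA \<alpha> by (intro powr_mono2 sum_mono2) (auto simp: sum_nonneg)
        \<comment> \<open>Errors from coherence are linear in the mass of \<open>A\<close>. They are
          absorbed because a linear term is below the geometric mean when \<open>A\<close> has no
          more mass than \<open>B\<close>.\<close>
        have AT: "C * sum w A \<le> C * T"
          unfolding T_def using A w \<alpha> psubset.hyps C
          by (intro mult_left_mono le_weighted_geometric_mean sum_mono2) (auto simp: sum_nonneg)
        \<comment> \<open>The bounds on the good and on the exceptional part concern
          \<open>F\<close> of the weight cut to that part, whereas the claim concerns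
          \<open>F (cut w A)\<close>. The exchange is one application of coherence.\<close>
        have tri: "(\<Sum>n\<in>X. w n * norm (F (cut w A) n - h n) powr q)
            \<le> C * T + (\<Sum>n\<in>X. w n * norm (F (cut w X) n - h n) powr q)" if X: "X \<subseteq> A" for X h
        proof -
          have "(\<Sum>n\<in>X. w n * norm (F (cut w A) n - h n) powr q)
             \<le> (\<Sum>n\<in>X. w n * norm (F (cut w X) n - F (cut w A) n) powr q
                  + w n * norm (F (cut w X) n - h n) powr q)"
          proof (rule sum_mono)
            fix n
            show "w n * norm (F (cut w A) n - h n) powr q
              \<le> w n * norm (F (cut w X) n - F (cut w A) n) powr q + w n * norm (F (cut w X) n - h n) powr q"
              using w powr_norm_diff_le[OF q, of "F (cut w A) n" "h n" "F (cut w X) n"]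
              by (simp add: mult_left_mono norm_minus_commute flip: distrib_left)
          qed
          then show ?thesis using coherent_cut[OF coh finA X, of w] w AT by (simp add: sum.distrib)
        qed
        have 1: "(\<Sum>n\<in>A - U. w n * norm (F (cut w A) n - g n) powr q) \<le> C * T + K * T"
        proof -
          have "(\<Sum>n\<in>A - U. w n * norm (F (cut w A) n - g n) powr q)
             = (\<Sum>n\<in>A - U. w n * norm (F (cut w A) n - F (cut w B) n) powr q)"
            by (rule sum.cong) (auto simp: g_def)
          also have "\<dots> \<le> C * T + K * (sum w B powr \<alpha> * sum w (A - U) powr (1 - \<alpha>))"
            using tri[of "A - U" "F (cut w B)"] good[of "A - U"] A by fastforce
          also have "\<dots> \<le> C * T + K * T"
            unfolding T_def using Amono[of "A - U"] K C by (intro add_mono mult_left_mono) auto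
          finally show ?thesis .
        qed
        have 2: "(\<Sum>n\<in>A \<inter> U. w n * norm (F (cut w A) n - g n) powr q) \<le> C * T + K' / 2 * T"
        proof -
          have "(\<Sum>n\<in>A \<inter> U. w n * norm (F (cut w A) n - g n) powr q)
             = (\<Sum>n\<in>A \<inter> U. w n * norm (F (cut w A) n - gU n) powr q)"
            by (rule sum.cong) (auto simp: g_def)
          also have "\<dots> \<le> C * T + K' * (sum w U powr \<alpha> * sum w (A \<inter> U) powr (1 - \<alpha>))"
            using tri[of "A \<inter> U" gU] gU[of "A \<inter> U"] by fastforce
          also have "sum w U powr \<alpha> \<le> (\<delta> * sum w B) powr \<alpha>"
            using U w \<alpha> by (intro powr_mono2) (auto simp: sum_nonneg)
          also have "(\<delta> * sum w B) powr \<alpha> = sum w B powr \<alpha> / 2"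
            using \<delta> b \<delta>\<alpha> by (simp add: powr_mult)
          also have "C * T + K' * (sum w B powr \<alpha> / 2 * sum w (A \<inter> U) powr (1 - \<alpha>))
            \<le> C * T + K' * (sum w B powr \<alpha> / 2 * sum w A powr (1 - \<alpha>))"
            using Amono[of "A \<inter> U"] K' C by (intro add_mono mult_left_mono) auto
          finally show ?thesis using K' by (simp add: T_def mult_left_mono mult_right_mono)
        qed
        have "(\<Sum>n\<in>A. w n * norm (F (cut w A) n - g n) powr q)
           = (\<Sum>n\<in>A - U. w n * norm (F (cut w A) n - g n) powr q)
             + (\<Sum>n\<in>A \<inter> U. w n * norm (F (cut w A) n - g n) powr q)"
          using finA by (subst sum.union_disjoint[symmetric]) (auto intro!: sum.cong)
        also have "\<dots> \<le> K' * T"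
        proof -
          have "K' / 2 * T = K * T + 2 * (C * T)" "K' * T = 2 * (K * T) + 4 * (C * T)"
            by (simp_all add: K'_def algebra_simps)
          then show ?thesis using 1 2 by linarith
        qed
        finally show "(\<Sum>n\<in>A. w n * norm (F (cut w A) n - g n) powr q)
           \<le> K' * (sum w B powr \<alpha> * sum w A powr (1 - \<alpha>))" by (simp add: T_def)
      qed
    qed
  qed
  show ?thesis using K' main unfolding \<alpha>_def by blast
qed

text \<open>A section is chosen only for the representative of total mass 1 on each ray of weights,
  and on its own support, so the family is constant on rays and does not depend on the carrying set
  \<open>S\<close>. The estimate is homogeneous of degree 1 in \<open>w\<close>, because
  \<open>F\<close> is invariant and the two exponents add up to 1, and therefore passes from the
  representative to the whole ray.\<close>

lemma improved_family:
  fixes F :: "(nat \<Rightarrow> real) \<Rightarrow> nat \<Rightarrow> 'b::real_normed_vector"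
  assumes coh: "coherent q C F" and q: "0 < q" "q \<le> 1" and C: "0 \<le> C" and inv: "scale_invariant F"
  shows "\<exists>G K. scale_invariant G \<and> 0 \<le> K \<and>
    (\<forall>S w A. finite S \<longrightarrow> (\<forall>n. 0 \<le> w n) \<longrightarrow> (\<forall>n. n \<notin> S \<longrightarrow> w n = 0) \<longrightarrow> A \<subseteq> S \<longrightarrow>
      (\<Sum>n\<in>A. w n * norm (F (cut w A) n - G w n) powr q)
         \<le> K * (sum w S powr (1 / Suc j) * sum w A powr (1 - 1 / Suc j)))"
proof -
  define \<alpha> where "\<alpha> = 1 / real (Suc j)"
  obtain K where K: "0 \<le> K" and ex: "\<And>w B. (\<forall>n. 0 \<le> w n) \<Longrightarrow> finite B \<Longrightarrow>
    (\<exists>g. \<forall>A\<subseteq>B. (\<Sum>n\<in>A. w n * norm (F (cut w A) n - g n) powr q)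
         \<le> K * (sum w B powr \<alpha> * sum w A powr (1 - \<alpha>)))"
    using improved_local_section[OF coh q C, of j] unfolding \<alpha>_def by blast
  define supp where "supp w = {n. w n \<noteq> 0}" for w :: "nat \<Rightarrow> real"
  define P where "P w g \<longleftrightarrow> (\<forall>A\<subseteq>supp w. (\<Sum>n\<in>A. w n * norm (F (cut w A) n - g n) powr q)
         \<le> K * (sum w (supp w) powr \<alpha> * sum w A powr (1 - \<alpha>)))" for w and g :: "nat \<Rightarrow> 'b"
  \<comment> \<open>Division by zero gives the zero weight when the mass vanishes, in particular for
    infinite support, where the sum is 0 by convention. Thus the invariance of \<open>G\<close>
    holds for all \<open>w\<close>.\<close>
  define nz where "nz w = (\<lambda>n. w n / sum w (supp w))" for w :: "nat \<Rightarrow> real"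
  define G where "G w = (SOME g. P (nz w) g)" for w
  have suppc: "supp (\<lambda>n. c * w n) = supp w" if "0 < c" for c w
    using that by (auto simp: supp_def)
  have "scale_invariant G"
    unfolding scale_invariant_def
  proof (intro allI impI)
    fix c :: real and w :: "nat \<Rightarrow> real" assume c: "0 < c"
    have "nz (\<lambda>n. c * w n) = nz w"
      using c by (simp add: nz_def suppc flip: sum_distrib_left)
    then show "G (\<lambda>n. c * w n) = G w" by (simp add: G_def)
  qed
  moreover have "(\<Sum>n\<in>A. w n * norm (F (cut w A) n - G w n) powr q)
         \<le> K * (sum w S powr \<alpha> * sum w A powr (1 - \<alpha>))"
    if S: "finite S" and w: "\<And>n. 0 \<le> w n" and wS: "\<And>n. n \<notin> S \<Longrightarrow> w n = 0" and A: "A \<subseteq> S" for S w A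
  proof -
    define T where "T = supp w"
    have TS: "T \<subseteq> S" using wS by (auto simp: T_def supp_def)
    then have finT: "finite T" using S finite_subset by blast
    have finA: "finite A" using A S finite_subset by blast
    have sT: "sum w S = sum w T" using TS S by (intro sum.mono_neutral_right) (auto simp: T_def supp_def)
    have sA: "sum w A = sum w (A \<inter> T)" using finA by (intro sum.mono_neutral_right) (auto simp: T_def supp_def)
    have cA: "cut w A = cut w (A \<inter> T)" by (auto simp: cut_def T_def supp_def)
    show ?thesis
    proof (cases "T = {}")
      case True
      then have "\<And>n. w n = 0" by (auto simp: T_def supp_def)
      then show ?thesis by simp
    next
      case False
      define c where "c = sum w T"
      have c: "0 < c" unfolding c_def using False finT w
        by (intro sum_pos) (auto simp: T_def supp_def order_less_le)
      have nzw: "nz w = (\<lambda>n. (1 / c) * w n)" by (simp add: nz_def c_def T_def)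
      have supp_nz: "supp (nz w) = T" using c by (auto simp: nzw T_def supp_def)
      have "\<exists>g. P (nz w) g"
        unfolding P_def supp_nz using ex[of "nz w" T] w c finT by (simp add: nzw)
      then have "P (nz w) (G w)" unfolding G_def by (rule someI_ex)
      then have "(\<Sum>n\<in>A \<inter> T. nz w n * norm (F (cut (nz w) (A \<inter> T)) n - G w n) powr q)
         \<le> K * (sum (nz w) T powr \<alpha> * sum (nz w) (A \<inter> T) powr (1 - \<alpha>))"
        unfolding P_def supp_nz by blast
      moreover have "cut (nz w) (A \<inter> T) = (\<lambda>n. (1 / c) * cut w (A \<inter> T) n)"
        by (auto simp: cut_def nzw)
      then have "F (cut (nz w) (A \<inter> T)) = F (cut w A)"
        using inv[unfolded scale_invariant_def, rule_format, of "1 / c" "cut w (A \<inter> T)"] c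
        unfolding cA by simp
      moreover have "sum (nz w) X = sum w X / c" for X by (simp add: nzw sum_divide_distrib)
      moreover have "(sum w T / c) powr \<alpha> * (sum w (A \<inter> T) / c) powr (1 - \<alpha>)
          = (sum w T powr \<alpha> * sum w (A \<inter> T) powr (1 - \<alpha>)) / c"
        using c w by (simp add: powr_divide sum_nonneg flip: powr_add)
      moreover have "(\<Sum>n\<in>A \<inter> T. nz w n * norm (F (cut w A) n - G w n) powr q)
          = (\<Sum>n\<in>A \<inter> T. w n * norm (F (cut w A) n - G w n) powr q) / c"
        by (simp add: nzw sum_divide_distrib)
      moreover have "(\<Sum>n\<in>A \<inter> T. w n * norm (F (cut w A) n - G w n) powr q)
          = (\<Sum>n\<in>A. w n * norm (F (cut w A) n - G w n) powr q)"
        using finA by (intro sum.mono_neutral_left) (auto simp: T_def supp_def)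
      ultimately show ?thesis using c by (simp add: sT sA field_simps)
    qed
  qed
  ultimately show ?thesis using K unfolding \<alpha>_def by blast
qed

section \<open>Gain of exponent by decomposition into level sets\<close>

lemma sum_geometric_pairs_le:
  fixes x y :: real
  assumes "finite P" "0 \<le> x" "x < 1" "0 \<le> y" "y < 1"
  shows "(\<Sum>(i, j)\<in>P. x ^ i * y ^ j) \<le> 1 / (1 - x) * (1 / (1 - y))"
proof -
  have geo: "(\<Sum>k<n. z ^ k) \<le> 1 / (1 - z)" if "0 \<le> z" "z < 1" for z :: real and n :: nat
  proof -
    have "(\<Sum>k<n. z ^ k) = (1 - z ^ n) / (1 - z)" using that by (simp add: sum_gp_strict)
    also have "\<dots> \<le> 1 / (1 - z)" using that by (intro divide_right_mono) auto
    finally show ?thesis .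
  qed
  obtain I where I: "\<And>i. i \<in> fst ` P \<Longrightarrow> i < I"
    using finite_nat_set_iff_bounded[of "fst ` P"] assms by auto
  obtain J where J: "\<And>j. j \<in> snd ` P \<Longrightarrow> j < J"
    using finite_nat_set_iff_bounded[of "snd ` P"] assms by auto
  have "(\<Sum>(i, j)\<in>P. x ^ i * y ^ j) \<le> (\<Sum>(i, j)\<in>{..<I} \<times> {..<J}. x ^ i * y ^ j)"
    using I J assms by (intro sum_mono2) (auto simp: image_iff split: prod.splits, force+)
  also have "\<dots> = (\<Sum>i<I. x ^ i) * (\<Sum>j<J. y ^ j)"
    by (simp add: sum_product sum.cartesian_product)
  also have "\<dots> \<le> 1 / (1 - x) * (1 / (1 - y))"
    using assms by (intro mult_mono geo) (auto simp: sum_nonneg)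
  finally show ?thesis .
qed

lemma mult_powr_norm_diff_le:
  fixes a b c :: "'b::real_normed_vector"
  assumes "0 < q" "q \<le> 1" "0 \<le> r"
  shows "r * norm (a - c) powr q \<le> r * norm (a - b) powr q + r * norm (b - c) powr q"
  using powr_norm_diff_le[OF assms(1,2), of a c b] assms(3)
  by (simp add: mult_left_mono flip: distrib_left)

text \<open>The set where \<open>G v\<close> and \<open>G w\<close> differ by more than 1 is split
  by the dyadic size \<open>2 ^ i\<close> of the difference and \<open>2 ^ j\<close> of the ratio
  \<open>w / v\<close>. On a piece the chain \<open>G v\<close>, \<open>F (cut v A)\<close>,
  \<open>F (cut w A)\<close>, \<open>G w\<close> is estimated at the exponent \<open>q\<close> only.
  Its bound contains the mass of the piece to a power just below 1, and this is equivalent to a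
  decay of the mass in \<open>i\<close> as fast as desired, in the manner of John and Nirenberg. The
  ratio supplies the decay in \<open>j\<close>.\<close>

lemma coherent_improved:
  fixes F G :: "(nat \<Rightarrow> real) \<Rightarrow> nat \<Rightarrow> 'b::real_normed_vector" and q M :: real
  assumes coh: "coherent q C F" and q: "0 < q" "q \<le> 1" and C: "0 \<le> C" and inv: "scale_invariant F"
    and K: "0 \<le> K" and M: "0 < M" "2 * (M + 1) \<le> q * Suc j"
    and Q: "\<And>S w A. \<lbrakk>finite S; \<And>n. 0 \<le> w n; \<And>n. n \<notin> S \<Longrightarrow> w n = 0; A \<subseteq> S\<rbrakk> \<Longrightarrow>
      (\<Sum>n\<in>A. w n * norm (F (cut w A) n - G w n) powr q)
         \<le> K * (sum w S powr (1 / Suc j) * sum w A powr (1 - 1 / Suc j))"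
  shows "\<exists>C'\<ge>0. coherent M C' G"
proof -
  define m where "m = Suc j"
  define \<alpha> where "\<alpha> = 1 / real m"
  have \<alpha>: "0 < \<alpha>" "\<alpha> \<le> 1" by (auto simp: \<alpha>_def m_def)
  \<comment> \<open>\<open>K\<close> and \<open>2 * K\<close> come from the two comparisons of
    \<open>F\<close> with \<open>G\<close>, \<open>2 * C\<close> from the coherence of
    \<open>F\<close>.\<close>
  define K2 where "K2 = 3 * K + 2 * C"
  have K2: "0 \<le> K2" using K C by (simp add: K2_def)
  define \<beta> where "\<beta> = sqrt (1 / 2)"
  have \<beta>: "0 < \<beta>" "\<beta> < 1" by (auto simp: \<beta>_def)
  define K3 where "K3 = sqrt (K2 ^ m) * 2 powr M"
  \<comment> \<open>The 1 pays for the coordinates where the difference is at most 1. The factors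
    \<open>2\<close> and \<open>1 / (1 - \<beta>)\<close> are the sums of the geometric series in
    \<open>i\<close> and in \<open>j\<close>; \<open>\<beta>\<close> is a square root because a
    geometric mean of two bounds will be taken.\<close>
  define C' where "C' = 1 + K3 * (2 * (1 / (1 - \<beta>)))"
  have K3: "0 \<le> K3" using K2 by (simp add: K3_def)
  have C': "0 \<le> C'" using K3 \<beta> by (simp add: C'_def)
  have "coherent M C' G"
    unfolding coherent_def
  proof (intro allI impI)
    fix S and v w :: "nat \<Rightarrow> real"
    assume S: "finite S" and w: "\<forall>n. n \<notin> S \<longrightarrow> w n = 0" and vw: "\<forall>n. 0 \<le> v n \<and> v n \<le> w n"
    have v0: "\<And>n. 0 \<le> v n" and vlew: "\<And>n. v n \<le> w n" and w0: "\<And>n. 0 \<le> w n"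
      using vw order_trans by blast+
    have vS: "\<And>n. n \<notin> S \<Longrightarrow> v n = 0" using w vw by (metis order_antisym)
    define W where "W = sum w S"
    have W: "0 \<le> W" by (simp add: W_def sum_nonneg w0)
    define d where "d n = norm (G v n - G w n)" for n
    define T where "T = {n \<in> S. 0 < v n \<and> 1 < d n}"
    have finT: "finite T" using S by (simp add: T_def)
    have "\<forall>n. \<exists>i. n \<in> T \<longrightarrow> 2 ^ i \<le> d n \<and> d n < 2 ^ Suc i"
    proof
      fix n show "\<exists>i. n \<in> T \<longrightarrow> 2 ^ i \<le> d n \<and> d n < 2 ^ Suc i"
      proof (cases "n \<in> T")
        case True
        then have d: "1 < d n" by (simp add: T_def)
        obtain k where "1 / d n * 2 ^ k \<le> 1" "1 < 1 / d n * 2 ^ Suc k"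
          using ex_dyadic_scale[of "1 / d n"] d by auto
        then show ?thesis using d by (intro exI[of _ k]) (simp add: field_simps)
      qed simp
    qed
    then obtain ii where ii: "\<And>n. n \<in> T \<Longrightarrow> 2 ^ ii n \<le> d n \<and> d n < 2 ^ Suc (ii n)" by metis
    have "\<forall>n. \<exists>i. n \<in> T \<longrightarrow> 2 ^ i * v n \<le> w n \<and> w n < 2 ^ Suc i * v n"
    proof
      fix n show "\<exists>i. n \<in> T \<longrightarrow> 2 ^ i * v n \<le> w n \<and> w n < 2 ^ Suc i * v n"
      proof (cases "n \<in> T")
        case True
        then have v: "0 < v n" "0 < w n" using vlew[of n] by (auto simp: T_def)
        obtain k where "v n / w n * 2 ^ k \<le> 1" "1 < v n / w n * 2 ^ Suc k"
          using ex_dyadic_scale[of "v n / w n"] v vlew[of n] by auto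
        then show ?thesis using v by (intro exI[of _ k]) (simp add: field_simps)
      qed simp
    qed
    then obtain jj where jj: "\<And>n. n \<in> T \<Longrightarrow> 2 ^ jj n * v n \<le> w n \<and> w n < 2 ^ Suc (jj n) * v n" by metis
    have level: "(\<Sum>n\<in>A. v n * d n powr M) \<le> K3 * ((1 / 2) ^ i * \<beta> ^ j) * W"
      if A: "A \<subseteq> T" "\<And>n. n \<in> A \<Longrightarrow> ii n = i \<and> jj n = j" for A i j
    proof -
      have AS: "A \<subseteq> S" using A by (auto simp: T_def)
      then have finA: "finite A" using S finite_subset by blast
      define a where "a = sum v A"
      have a0: "0 \<le> a" by (simp add: a_def sum_nonneg v0)
      have aW: "a \<le> W" unfolding a_def W_def
        using sum_mono[of A v w] sum_mono2[OF S AS, of w] vlew w0 by force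
      have wA1: "2 ^ j * a \<le> sum w A" unfolding a_def sum_distrib_left
        using A jj by (intro sum_mono) fastforce
      have wA2: "sum w A \<le> 2 ^ Suc j * a" unfolding a_def sum_distrib_left
        using A jj by (intro sum_mono) fastforce
      define \<Theta> where "\<Theta> = W powr \<alpha> * a powr (1 - \<alpha>)"
      have a\<Theta>: "a \<le> \<Theta>" unfolding \<Theta>_def using a0 aW \<alpha> by (intro le_weighted_geometric_mean) auto
      have t1: "(\<Sum>n\<in>A. v n * norm (G v n - F (cut v A) n) powr q) \<le> K * \<Theta>"
      proof -
        have "(\<Sum>n\<in>A. v n * norm (F (cut v A) n - G v n) powr q) \<le> K * (sum v S powr \<alpha> * a powr (1 - \<alpha>))"
          unfolding \<alpha>_def a_def m_def using Q[OF S v0 vS AS] by simp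
        also have "\<dots> \<le> K * \<Theta>"
          unfolding \<Theta>_def W_def using K \<alpha> vlew v0
          by (intro mult_left_mono mult_right_mono powr_mono2 sum_mono) (auto simp: sum_nonneg)
        finally show ?thesis by (simp add: norm_minus_commute)
      qed
      \<comment> \<open>On \<open>A\<close> the weights \<open>v\<close> and
        \<open>w / 2 ^ j\<close> agree up to a factor 2, and \<open>F\<close> does not distinguish
        \<open>cut w A\<close> from its multiple. This is where \<open>j\<close> disappears from the
        constant.\<close>
      have t2: "(\<Sum>n\<in>A. v n * norm (F (cut v A) n - F (cut w A) n) powr q) \<le> 2 * C * \<Theta>"
      proof -
        have "(\<Sum>n\<in>A. cut v A n * norm (F (cut v A) n - F (\<lambda>n. (1 / 2 ^ j) * cut w A n) n) powr q)
            \<le> C * (\<Sum>n\<in>A. (1 / 2 ^ j) * cut w A n)"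
        proof (rule coherentD[OF coh finA])
          show "cut v A n \<le> 1 / 2 ^ j * cut w A n" for n
            using A jj[of n] by (auto simp: cut_def field_simps)
        qed (auto simp: cut_def v0)
        moreover have "F (\<lambda>n. (1 / 2 ^ j) * cut w A n) = F (cut w A)"
          using inv[unfolded scale_invariant_def, rule_format, of "1 / 2 ^ j"] by simp
        moreover have "sum w A \<le> 2 ^ Suc j * \<Theta>"
          by (rule order_trans[OF wA2]) (intro mult_left_mono a\<Theta>, simp)
        then have "(\<Sum>n\<in>A. (1 / 2 ^ j) * cut w A n) \<le> 2 * \<Theta>"
          by (simp add: cut_def field_simps flip: sum_divide_distrib)
        ultimately show ?thesis using mult_left_mono[OF _ C] by (fastforce simp: cut_def)
      qed
      \<comment> \<open>Passing from \<open>v\<close> to \<open>w\<close> gains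
        \<open>1 / 2 ^ j\<close>. The mass of \<open>w\<close> on \<open>A\<close> enters with the
        exponent \<open>1 - \<alpha> \<le> 1\<close>, so replacing it by
        \<open>2 ^ Suc j * a\<close> costs at most \<open>2 ^ Suc j\<close>; a factor 2 is
        left.\<close>
      have t3: "(\<Sum>n\<in>A. v n * norm (F (cut w A) n - G w n) powr q) \<le> 2 * K * \<Theta>"
      proof -
        have "(\<Sum>n\<in>A. v n * norm (F (cut w A) n - G w n) powr q)
            \<le> (\<Sum>n\<in>A. (1 / 2 ^ j) * (w n * norm (F (cut w A) n - G w n) powr q))"
        proof (rule sum_mono)
          fix n assume "n \<in> A"
          then have "v n \<le> (1 / 2 ^ j) * w n" using A jj[of n] by (auto simp: field_simps)
          then have "v n * norm (F (cut w A) n - G w n) powr q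
            \<le> (1 / 2 ^ j) * w n * norm (F (cut w A) n - G w n) powr q" by (intro mult_right_mono) auto
          then show "v n * norm (F (cut w A) n - G w n) powr q
            \<le> (1 / 2 ^ j) * (w n * norm (F (cut w A) n - G w n) powr q)" by (simp add: mult.assoc)
        qed
        also have "\<dots> = (1 / 2 ^ j) * (\<Sum>n\<in>A. w n * norm (F (cut w A) n - G w n) powr q)"
          by (simp add: sum_distrib_left)
        also have "\<dots> \<le> (1 / 2 ^ j) * (K * (W powr \<alpha> * sum w A powr (1 - \<alpha>)))"
          unfolding \<alpha>_def W_def m_def using Q[OF S w0 _ AS] w by (intro mult_left_mono) auto
        also have "sum w A powr (1 - \<alpha>) \<le> (2 ^ Suc j * a) powr (1 - \<alpha>)"
          using wA2 \<alpha> w0 by (intro powr_mono2) (auto simp: sum_nonneg)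
        also have "\<dots> = (2 ^ Suc j) powr (1 - \<alpha>) * a powr (1 - \<alpha>)"
          using a0 by (simp add: powr_mult)
        also have "(2 ^ Suc j :: real) powr (1 - \<alpha>) \<le> (2 ^ Suc j) powr 1"
          using \<alpha> by (intro powr_mono) (auto simp: one_le_power simp del: power_Suc)
        finally have "(\<Sum>n\<in>A. v n * norm (F (cut w A) n - G w n) powr q)
          \<le> (1 / 2 ^ j) * (K * (W powr \<alpha> * (2 ^ Suc j * a powr (1 - \<alpha>))))"
          using K by (simp add: mult_left_mono mult_right_mono divide_right_mono)
        also have "\<dots> = 2 * K * \<Theta>" by (simp add: \<Theta>_def)
        finally show ?thesis .
      qed
      \<comment> \<open>Chebyshev's inequality on the piece, where the difference is at least
        \<open>2 ^ i\<close>.\<close>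
      have "2 powr (i * q) * a = (\<Sum>n\<in>A. v n * (2 ^ i) powr q)"
        by (simp add: a_def sum_distrib_right mult.commute[of _ "sum v A"] powr_powr flip: powr_realpow)
      also have "\<dots> \<le> (\<Sum>n\<in>A. v n * d n powr q)"
        using A ii q v0 by (intro sum_mono mult_left_mono powr_mono2) fastforce+
      also have "\<dots> \<le> (\<Sum>n\<in>A. v n * norm (G v n - F (cut v A) n) powr q
          + (v n * norm (F (cut v A) n - F (cut w A) n) powr q
             + v n * norm (F (cut w A) n - G w n) powr q))"
        unfolding d_def
      proof (rule sum_mono)
        fix n
        show "v n * norm (G v n - G w n) powr q \<le> v n * norm (G v n - F (cut v A) n) powr q
          + (v n * norm (F (cut v A) n - F (cut w A) n) powr q
             + v n * norm (F (cut w A) n - G w n) powr q)"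
          using mult_powr_norm_diff_le[OF q v0[of n], of "G v n" "G w n" "F (cut v A) n"]
            mult_powr_norm_diff_le[OF q v0[of n], of "F (cut v A) n" "G w n" "F (cut w A) n"] by linarith
      qed
      also have "\<dots> \<le> K2 * \<Theta>" using t1 t2 t3 by (simp add: sum.distrib K2_def algebra_simps)
      finally have ia: "2 powr (i * q) * a \<le> K2 * \<Theta>" .
      \<comment> \<open>Cancelling \<open>a powr (1 - \<alpha>)\<close> and raising to the power
        \<open>m = 1 / \<alpha>\<close> turns the bound on the oscillation into a bound on the mass
        of the piece.\<close>
      have am: "a \<le> K2 ^ m * 2 powr (- (i * q * m)) * W"
      proof (cases "a = 0")
        case True then show ?thesis using K2 W by simp
      next
        case False
        then have a: "0 < a" using a0 by simp
        then have W1: "0 < W" using aW by simp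
        have "2 powr (i * q) * a powr \<alpha> * a powr (1 - \<alpha>) \<le> K2 * W powr \<alpha> * a powr (1 - \<alpha>)"
          using ia a by (simp add: \<Theta>_def mult.assoc flip: powr_add)
        then have "2 powr (i * q) * a powr \<alpha> \<le> K2 * W powr \<alpha>" using a by simp
        then have "a powr \<alpha> \<le> K2 * 2 powr (- (i * q)) * W powr \<alpha>" by (simp add: powr_minus field_simps)
        then have "(a powr \<alpha>) ^ m \<le> (K2 * 2 powr (- (i * q)) * W powr \<alpha>) ^ m"
          by (intro power_mono) auto
        moreover have "(t powr \<alpha>) ^ m = t" if "0 < t" for t :: real
          using that by (simp add: powr_realpow[symmetric] powr_powr \<alpha>_def m_def del: power_Suc of_nat_Suc)
        moreover have "(2 powr (- (real i * q))) ^ m = 2 powr (- (i * q * m))"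
          by (simp add: powr_realpow[symmetric] powr_powr)
        ultimately show ?thesis using a W1 by (simp only: power_mult_distrib)
      qed
      have aj: "a \<le> (1 / 2) ^ j * W"
      proof -
        have "sum w A \<le> W" unfolding W_def using AS S w0 by (intro sum_mono2) auto
        then show ?thesis using wA1 by (simp add: field_simps)
      qed
      \<comment> \<open>Neither bound can be summed over both indices: \<open>am\<close> does not
        see \<open>j\<close>, and \<open>aj\<close> does not see \<open>i\<close>. Their geometric
        mean decays in both, at half the rate.\<close>
      have a2: "a \<le> sqrt (K2 ^ m) * 2 powr (- (i * q * m / 2)) * \<beta> ^ j * W"
      proof -
        have "a\<^sup>2 \<le> (K2 ^ m * 2 powr (- (i * q * m)) * W) * ((1 / 2) ^ j * W)"
          unfolding power2_eq_square using am aj a0 K2 W by (intro mult_mono) auto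
        also have "\<dots> = (sqrt (K2 ^ m) * 2 powr (- (i * q * m / 2)) * \<beta> ^ j * W)\<^sup>2"
        proof -
          have "(2 powr (- (i * q * m / 2)))\<^sup>2 = 2 powr (- (i * q * m))"
            by (simp add: power2_eq_square mult_ac flip: powr_add)
          moreover have "(\<beta> ^ j)\<^sup>2 = (1 / 2) ^ j"
          proof -
            have "(\<beta> ^ j)\<^sup>2 = (\<beta>\<^sup>2) ^ j" by (simp flip: power_mult add: mult.commute)
            then show ?thesis by (simp add: \<beta>_def)
          qed
          moreover have "(sqrt (K2 ^ m))\<^sup>2 = K2 ^ m" using K2 by simp
          ultimately have "(sqrt (K2 ^ m) * 2 powr (- (i * q * m / 2)) * \<beta> ^ j * W)\<^sup>2
              = K2 ^ m * 2 powr (- (i * q * m)) * (1 / 2) ^ j * W\<^sup>2"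
            by (simp only: power_mult_distrib)
          then show ?thesis by (simp only: power2_eq_square mult_ac)
        qed
        finally have sq: "a\<^sup>2 \<le> (sqrt (K2 ^ m) * 2 powr (- (i * q * m / 2)) * \<beta> ^ j * W)\<^sup>2" .
        have "0 \<le> sqrt (K2 ^ m) * 2 powr (- (i * q * m / 2)) * \<beta> ^ j * W"
          using K2 W \<beta> by simp
        then show ?thesis by (rule power2_le_imp_le[OF sq])
      qed
      have "(\<Sum>n\<in>A. v n * d n powr M) \<le> (\<Sum>n\<in>A. v n * (2 ^ Suc i) powr M)"
      proof (intro sum_mono mult_left_mono powr_mono2)
        fix n assume "n \<in> A"
        then have "n \<in> T" "ii n = i" using A by auto
        then show "d n \<le> 2 ^ Suc i" using ii[of n] by auto
      qed (use M v0 in \<open>auto simp: d_def\<close>)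
      also have "\<dots> = 2 powr (Suc i * M) * a"
      proof -
        have "(2 ^ Suc i :: real) powr M = 2 powr (Suc i * M)"
          by (subst powr_realpow[symmetric]) (auto simp: powr_powr simp del: of_nat_Suc power_Suc)
        then show ?thesis by (simp only: a_def sum_distrib_right[symmetric] mult.commute)
      qed
      also have "\<dots> \<le> 2 powr (Suc i * M) * (sqrt (K2 ^ m) * 2 powr (- (i * q * m / 2)) * \<beta> ^ j * W)"
        using a2 by (intro mult_left_mono) auto
      also have "\<dots> = sqrt (K2 ^ m) * \<beta> ^ j * W * 2 powr (Suc i * M - i * q * m / 2)"
      proof -
        have "2 powr (Suc i * M - i * q * m / 2) = 2 powr (Suc i * M) * 2 powr (- (i * q * m / 2))"
          by (simp only: powr_add[symmetric] diff_conv_add_uminus)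
        then show ?thesis by (simp only: mult_ac)
      qed
      \<comment> \<open>The hypothesis \<open>2 * (M + 1) \<le> q * m\<close> says that half of the
        decay in \<open>i\<close> beats the growth \<open>2 powr (i * M)\<close> with a factor
        \<open>2 ^ i\<close> to spare.\<close>
      also have "\<dots> \<le> sqrt (K2 ^ m) * \<beta> ^ j * W * 2 powr (M - i)"
      proof -
        have "i * (2 * (M + 1)) \<le> i * (q * m)" using M by (intro mult_left_mono) (auto simp: m_def)
        then have "Suc i * M - i * q * m / 2 \<le> M - i" by (simp add: algebra_simps)
        then show ?thesis using K2 \<beta> W by (intro mult_left_mono powr_mono) auto
      qed
      also have "2 powr (M - i) = 2 powr M * (1 / 2) ^ i"
        by (simp add: powr_diff powr_realpow power_divide)
      finally show ?thesis by (simp add: K3_def mult_ac)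
    qed
    define lev where "lev n = (ii n, jj n)" for n
    have "(\<Sum>n\<in>T. v n * d n powr M) = (\<Sum>y\<in>lev ` T. \<Sum>n\<in>{n \<in> T. lev n = y}. v n * d n powr M)"
      by (rule sum.image_gen[OF finT])
    also have "\<dots> \<le> (\<Sum>y\<in>lev ` T. case y of (i, j) \<Rightarrow> K3 * ((1 / 2) ^ i * \<beta> ^ j) * W)"
    proof (rule sum_mono)
      fix y show "(\<Sum>n\<in>{n \<in> T. lev n = y}. v n * d n powr M)
          \<le> (case y of (i, j) \<Rightarrow> K3 * ((1 / 2) ^ i * \<beta> ^ j) * W)"
        by (cases y) (auto simp: lev_def intro!: level)
    qed
    also have "\<dots> = K3 * W * (\<Sum>(i, j)\<in>lev ` T. (1 / 2) ^ i * \<beta> ^ j)"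
      by (simp add: sum_distrib_left case_prod_unfold mult_ac)
    also have "\<dots> \<le> K3 * W * (1 / (1 - 1 / 2) * (1 / (1 - \<beta>)))"
      using finT \<beta> K3 W by (intro mult_left_mono sum_geometric_pairs_le) auto
    finally have T: "(\<Sum>n\<in>T. v n * d n powr M) \<le> K3 * (2 * (1 / (1 - \<beta>))) * W" by (simp add: mult_ac)
    have "(\<Sum>n\<in>S - T. v n * d n powr M) \<le> (\<Sum>n\<in>S - T. w n)"
    proof (rule sum_mono)
      fix n assume n: "n \<in> S - T"
      show "v n * d n powr M \<le> w n"
      proof (cases "v n = 0")
        case False
        then have "d n \<le> 1" using n v0[of n] by (auto simp: T_def)
        then have "d n powr M \<le> 1" using M by (intro powr_le1) (auto simp: d_def)
        then have "v n * d n powr M \<le> v n * 1" using v0 by (intro mult_left_mono) auto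
        then show ?thesis using vlew[of n] by simp
      qed (use w0 in simp)
    qed
    also have "\<dots> \<le> W" unfolding W_def using S w0 by (intro sum_mono2) auto
    finally have ST: "(\<Sum>n\<in>S - T. v n * d n powr M) \<le> W" .
    have "(\<Sum>n\<in>S. v n * d n powr M) = (\<Sum>n\<in>S - T. v n * d n powr M) + (\<Sum>n\<in>T. v n * d n powr M)"
      using S by (intro sum.subset_diff) (auto simp: T_def)
    also have "\<dots> \<le> C' * W" using T ST by (simp add: C'_def algebra_simps)
    finally show "(\<Sum>n\<in>S. v n * norm (G v n - G w n) powr M) \<le> C' * sum w S"
      by (simp add: d_def W_def)
  qed
  then show ?thesis using C' by blast
qed

text \<open>Comparing \<open>w\<close> with \<open>w (1 + |h\<^sub>w|\<^sup>r)\<close> raises the exponent of integrability from \<open>r\<close> to \<open>r + q\<close>.\<close>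

lemma bootstrap_integrability:
  fixes h :: "(nat \<Rightarrow> real) \<Rightarrow> nat \<Rightarrow> 'b::real_normed_vector"
  assumes coh: "coherent p C h" and q: "0 < q" and p: "0 < p" and C: "0 \<le> C" and K: "0 \<le> K"
    and base: "\<And>S w. \<lbrakk>finite S; \<And>n. 0 \<le> w n; \<And>n. n \<notin> S \<Longrightarrow> w n = 0\<rbrakk> \<Longrightarrow>
      (\<Sum>n\<in>S. w n * norm (h w n) powr q) \<le> K * sum w S"
  shows "\<exists>K'\<ge>0. \<forall>S w. finite S \<longrightarrow> (\<forall>n. 0 \<le> w n) \<longrightarrow> (\<forall>n. n \<notin> S \<longrightarrow> w n = 0) \<longrightarrow>
      (\<Sum>n\<in>S. w n * norm (h w n) powr p) \<le> K' * sum w S"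
proof -
  \<comment> \<open>The exponent grows in steps of \<open>q\<close>; the minimum makes the last step
    stop at \<open>p\<close>, the exponent at which \<open>h\<close> is coherent.\<close>
  have "\<exists>K'\<ge>0. \<forall>S w. finite S \<longrightarrow> (\<forall>n. 0 \<le> w n) \<longrightarrow> (\<forall>n. n \<notin> S \<longrightarrow> w n = 0) \<longrightarrow>
      (\<Sum>n\<in>S. w n * norm (h w n) powr min p (k * q)) \<le> K' * sum w S" for k :: nat
  proof (induction k)
    case 0
    have "w n * norm (h w n) powr 0 \<le> w n" if "0 \<le> w n" for w n
      using that by (cases "h w n = 0") auto
    then show ?case using p by (intro exI[of _ 1]) (auto intro!: sum_mono)
  next
    case (Suc k)
    define r where "r = min p (k * q)"
    define s where "s = min p (Suc k * q)"
    have rs: "0 \<le> r" "0 < s" "s \<le> p" "s \<le> r + q" using p q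
      by (auto simp: r_def s_def min_def algebra_simps intro!: add_pos_nonneg)
    obtain K' where K': "0 \<le> K'" and IH: "\<And>S w. \<lbrakk>finite S; \<forall>n. 0 \<le> w n; \<forall>n. n \<notin> S \<longrightarrow> w n = 0\<rbrakk> \<Longrightarrow>
      (\<Sum>n\<in>S. w n * norm (h w n) powr r) \<le> K' * sum w S"
      using Suc.IH unfolding r_def by blast
    define L where "L = 1 + 2 powr p * (C * (1 + K')) + 2 powr q * (K * (1 + K'))"
    show ?case
    proof (intro exI[of _ L] conjI allI impI)
      show "0 \<le> L" using C K K' by (simp add: L_def)
      fix S and w :: "nat \<Rightarrow> real"
      assume S: "finite S" and w0: "\<forall>n. 0 \<le> w n" and wS: "\<forall>n. n \<notin> S \<longrightarrow> w n = 0"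
      define v where "v n = w n * (1 + norm (h w n) powr r)" for n
      have wv: "w n \<le> v n" for n using w0 by (simp add: v_def algebra_simps)
      have v0: "0 \<le> v n" for n using w0 by (simp add: v_def)
      have vS: "n \<notin> S \<Longrightarrow> v n = 0" for n using wS by (simp add: v_def)
      have sv: "sum v S \<le> (1 + K') * sum w S"
        using IH[OF S w0 wS] by (simp add: v_def algebra_simps sum.distrib)
      have e1: "(\<Sum>n\<in>S. w n * norm (h w n - h v n) powr p) \<le> C * sum v S"
        using w0 wv vS by (intro coherentD[OF coh S]) auto
      have e2: "(\<Sum>n\<in>S. v n * norm (h v n) powr q) \<le> K * sum v S"
        using v0 vS by (intro base[OF S]) auto
      have "(\<Sum>n\<in>S. w n * norm (h w n) powr s)
        \<le> (\<Sum>n\<in>S. w n + 2 powr p * (w n * norm (h w n - h v n) powr p) + 2 powr q * (v n * norm (h v n) powr q))"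
      proof (rule sum_mono)
        fix n
        define x where "x = norm (h w n)"
        define y where "y = norm (h v n)"
        define z where "z = norm (h w n - h v n)"
        have xyz: "0 \<le> x" "0 \<le> y" "0 \<le> z" "x \<le> z + y"
          unfolding x_def y_def z_def using norm_triangle_ineq[of "h w n - h v n" "h v n"] by auto
        have pos: "0 \<le> w n" "0 \<le> w n * z powr p" "0 \<le> v n * y powr q"
          using w0 v0 by auto
        \<comment> \<open>Where \<open>h w\<close> is large it is comparable either to
          \<open>h w - h v\<close>, which coherence controls at the exponent \<open>p\<close>, or to
          \<open>h v\<close>. In the second case the power \<open>q\<close> is traded for one of
          \<open>h v\<close>, and the remaining power \<open>r\<close> is absorbed into the weight
          \<open>v\<close>.\<close>
        consider "x \<le> 1" | "1 < x" "x \<le> 2 * z" | "1 < x" "x \<le> 2 * y" using xyz by linarith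
        then have "w n * x powr s \<le> w n + 2 powr p * (w n * z powr p) + 2 powr q * (v n * y powr q)"
        proof cases
          case 1
          then have "x powr s \<le> 1" using xyz rs by (intro powr_le1) auto
          then have "w n * x powr s \<le> w n * 1" using pos by (intro mult_left_mono) auto
          then show ?thesis using pos
            by (smt (verit, ccfv_SIG) mult_nonneg_nonneg powr_ge_zero mult.right_neutral)
        next
          case 2
          have "x powr s \<le> x powr p" using 2 rs by (intro powr_mono) auto
          also have "\<dots> \<le> (2 * z) powr p" using 2 p by (intro powr_mono2) auto
          also have "\<dots> = 2 powr p * z powr p" using xyz by (simp add: powr_mult)
          finally have "w n * x powr s \<le> w n * (2 powr p * z powr p)" using pos by (intro mult_left_mono) auto
          moreover have "0 \<le> 2 powr q * (v n * y powr q)" using pos by simp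
          ultimately show ?thesis using pos by (simp add: mult_ac)
        next
          case 3
          have "x powr s \<le> x powr (r + q)" using 3 rs by (intro powr_mono) auto
          also have "\<dots> = x powr r * x powr q" by (simp add: powr_add)
          also have "\<dots> \<le> x powr r * (2 * y) powr q" using 3 q by (intro mult_left_mono powr_mono2) auto
          also have "\<dots> = x powr r * (2 powr q * y powr q)" using xyz by (simp add: powr_mult)
          finally have "w n * x powr s \<le> w n * (x powr r * (2 powr q * y powr q))"
            using pos by (intro mult_left_mono) auto
          also have "\<dots> = (w n * x powr r) * (2 powr q * y powr q)" by simp
          also have "\<dots> \<le> v n * (2 powr q * y powr q)"
            using pos by (intro mult_right_mono) (auto simp: v_def x_def algebra_simps)
          finally have "w n * x powr s \<le> 2 powr q * (v n * y powr q)" by (simp add: mult_ac)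
          moreover have "0 \<le> 2 powr p * (w n * z powr p)" using pos by simp
          ultimately show ?thesis using pos(1) by linarith
        qed
        then show "w n * norm (h w n) powr s \<le> w n + 2 powr p * (w n * norm (h w n - h v n) powr p)
            + 2 powr q * (v n * norm (h v n) powr q)" by (simp add: x_def y_def z_def)
      qed
      also have "\<dots> = sum w S + 2 powr p * (\<Sum>n\<in>S. w n * norm (h w n - h v n) powr p)
         + 2 powr q * (\<Sum>n\<in>S. v n * norm (h v n) powr q)"
        by (simp add: sum.distrib sum_distrib_left)
      also have "\<dots> \<le> sum w S + 2 powr p * (C * ((1 + K') * sum w S)) + 2 powr q * (K * ((1 + K') * sum w S))"
        using e1 e2 mult_left_mono[OF sv C] mult_left_mono[OF sv K]
        by (intro add_mono mult_left_mono) auto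
      also have "\<dots> = L * sum w S" by (simp add: L_def algebra_simps)
      finally show "(\<Sum>n\<in>S. w n * norm (h w n) powr min p (Suc k * q)) \<le> L * sum w S"
        by (simp add: s_def)
    qed
  qed
  note * = this
  obtain k :: nat where "p / q \<le> k" using real_arch_simple by blast
  then have "min p (k * q) = p" using q by (simp add: field_simps)
  then show ?thesis using *[of k] by simp
qed

text \<open>The construction of \<open>G\<close> uses \<open>F\<close> at the exponent
  \<open>q = min 1 p\<close>, and the distance from \<open>F\<close> to \<open>G\<close> is at first
  known only there. But \<open>F - G\<close> is coherent at \<open>p\<close>, as both families are,
  and so its integrability can be raised from \<open>q\<close> to \<open>p\<close>.\<close>

theorem higher_integrability:
  fixes F :: "(nat \<Rightarrow> real) \<Rightarrow> nat \<Rightarrow> 'b::real_normed_vector"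
  assumes coh: "coherent p C F" and p: "0 < p" and C: "0 \<le> C" and inv: "scale_invariant F" and M: "0 < M"
  shows "\<exists>G K. scale_invariant G \<and> 0 \<le> K \<and> coherent M K G \<and>
    (\<forall>S w. finite S \<longrightarrow> (\<forall>n. 0 \<le> w n) \<longrightarrow> (\<forall>n. n \<notin> S \<longrightarrow> w n = 0) \<longrightarrow>
      (\<Sum>n\<in>S. w n * norm (F w n - G w n) powr p) \<le> K * sum w S)"
proof -
  define q where "q = min 1 p"
  have q: "0 < q" "q \<le> 1" "q \<le> p" using p by (auto simp: q_def)
  have cohq: "coherent q (1 + C) F" using coherent_exponent_mono[OF coh q(1,3)] .
  have C1: "0 \<le> 1 + C" using C by simp
  \<comment> \<open>\<open>G\<close> has to be coherent at \<open>M\<close> for the conclusion and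
    at \<open>p\<close> for the bootstrap.\<close>
  define M' where "M' = max M p"
  obtain j :: nat where j: "2 * (M' + 1) / q \<le> j" using real_arch_simple by blast
  then have j': "2 * (M' + 1) \<le> q * Suc j" using q by (simp add: field_simps)
  obtain G K where G: "scale_invariant G" "0 \<le> K"
    and Q: "\<forall>S w A. finite S \<longrightarrow> (\<forall>n. 0 \<le> w n) \<longrightarrow> (\<forall>n. n \<notin> S \<longrightarrow> w n = 0) \<longrightarrow> A \<subseteq> S \<longrightarrow>
      (\<Sum>n\<in>A. w n * norm (F (cut w A) n - G w n) powr q)
         \<le> K * (sum w S powr (1 / Suc j) * sum w A powr (1 - 1 / Suc j))"
    using improved_family[OF cohq q(1,2) C1 inv, of j] by blast
  note Q = Q[rule_format]
  have "\<exists>C'\<ge>0. coherent M' C' G"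
    using C M by (intro coherent_improved[OF cohq q(1,2) _ inv G(2) _ j' Q]) (auto simp: M'_def)
  then obtain C' where C': "0 \<le> C'" "coherent M' C' G" by blast
  have GM: "coherent M (1 + C') G" and Gp: "coherent p (1 + C') G"
    using coherent_exponent_mono[OF C'(2)] M p by (auto simp: M'_def)
  define h where "h w n = F w n - G w n" for w n
  define D where "D = 2 powr p * (C + (1 + C'))"
  have "coherent p D h"
    unfolding coherent_def
  proof (intro allI impI)
    fix S and v w :: "nat \<Rightarrow> real"
    assume S: "finite S" and w: "\<forall>n. n \<notin> S \<longrightarrow> w n = 0" and v: "\<forall>n. 0 \<le> v n \<and> v n \<le> w n"
    have "(\<Sum>n\<in>S. v n * norm (h v n - h w n) powr p)
       \<le> (\<Sum>n\<in>S. 2 powr p * (v n * norm (F v n - F w n) powr p + v n * norm (G v n - G w n) powr p))"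
    proof (rule sum_mono)
      fix n
      have "norm (h v n - h w n) = norm ((F v n - F w n) - (G v n - G w n))"
        by (simp add: h_def algebra_simps)
      also have "\<dots> \<le> norm (F v n - F w n) + norm (G v n - G w n)" by (rule norm_triangle_ineq4)
      finally have "norm (h v n - h w n) powr p \<le> (norm (F v n - F w n) + norm (G v n - G w n)) powr p"
        using p by (intro powr_mono2) auto
      also have "\<dots> \<le> 2 powr p * (norm (F v n - F w n) powr p + norm (G v n - G w n) powr p)"
        using p by (intro powr_add_le) auto
      finally have "v n * norm (h v n - h w n) powr p
          \<le> v n * (2 powr p * (norm (F v n - F w n) powr p + norm (G v n - G w n) powr p))"
        using v by (intro mult_left_mono) auto
      then show "v n * norm (h v n - h w n) powr p
         \<le> 2 powr p * (v n * norm (F v n - F w n) powr p + v n * norm (G v n - G w n) powr p)"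
        by (simp add: algebra_simps)
    qed
    also have "\<dots> = 2 powr p * ((\<Sum>n\<in>S. v n * norm (F v n - F w n) powr p)
         + (\<Sum>n\<in>S. v n * norm (G v n - G w n) powr p))"
      by (simp add: sum.distrib flip: sum_distrib_left)
    also have "\<dots> \<le> 2 powr p * (C * sum w S + (1 + C') * sum w S)"
      using coherentD[OF coh S, of w v] coherentD[OF Gp S, of w v] w v
      by (intro mult_left_mono add_mono) auto
    also have "\<dots> = D * sum w S" by (simp add: D_def algebra_simps)
    finally show "(\<Sum>n\<in>S. v n * norm (h v n - h w n) powr p) \<le> D * sum w S" .
  qed
  moreover have "(\<Sum>n\<in>S. w n * norm (h w n) powr q) \<le> K * sum w S"
    if S: "finite S" and w: "\<And>n. 0 \<le> w n" "\<And>n. n \<notin> S \<Longrightarrow> w n = 0" for S w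
  proof -
    have "cut w S = w" using w by (auto simp: cut_def)
    \<comment> \<open>For \<open>A = S\<close> the geometric mean collapses to the mass of
      \<open>w\<close>.\<close>
    moreover have "sum w S powr (1 / Suc j) * sum w S powr (1 - 1 / Suc j) = sum w S"
      using w by (simp add: sum_nonneg flip: powr_add)
    ultimately show ?thesis using Q[of S w S] S w by (simp add: h_def)
  qed
  moreover have "0 \<le> D" using C C' by (simp add: D_def)
  ultimately obtain K' where K': "0 \<le> K'" "\<And>S w. \<lbrakk>finite S; \<forall>n. 0 \<le> w n; \<forall>n. n \<notin> S \<longrightarrow> w n = 0\<rbrakk> \<Longrightarrow>
      (\<Sum>n\<in>S. w n * norm (h w n) powr p) \<le> K' * sum w S"
    using bootstrap_integrability[of p D h q K] q(1) p G(2) by blast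
  define L where "L = 1 + C' + K'"
  show ?thesis
  proof (intro exI[of _ G] exI[of _ L] conjI allI impI)
    show "coherent M L G"
      unfolding coherent_def
    proof (intro allI impI)
      fix S and v w :: "nat \<Rightarrow> real"
      assume S: "finite S" and w: "\<forall>n. n \<notin> S \<longrightarrow> w n = 0" and v: "\<forall>n. 0 \<le> v n \<and> v n \<le> w n"
      have "0 \<le> sum w S" using v by (meson order_trans sum_nonneg)
      then have "0 \<le> K' * sum w S" using K' by simp
      then show "(\<Sum>n\<in>S. v n * norm (G v n - G w n) powr M) \<le> L * sum w S"
        using coherentD[OF GM S, of w v] w v by (simp add: L_def algebra_simps)
    qed
    fix S and w :: "nat \<Rightarrow> real"
    assume S: "finite S" and w: "\<forall>n. 0 \<le> w n" "\<forall>n. n \<notin> S \<longrightarrow> w n = 0"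
    have "0 \<le> (1 + C') * sum w S" using C' w by (simp add: sum_nonneg)
    then show "(\<Sum>n\<in>S. w n * norm (F w n - G w n) powr p) \<le> L * sum w S"
      using K'(2)[OF S w] by (simp add: L_def h_def algebra_simps)
  qed (use G C' K' in \<open>auto simp: L_def\<close>)
qed

section \<open>The quadratic lift of a centralizer\<close>

definition modular :: "real \<Rightarrow> (nat \<Rightarrow> 'k::real_normed_vector) \<Rightarrow> real" where
  "modular p x = (\<Sum>n. norm (x n) powr p)"

lemma powr_add3_le:
  fixes a b c :: real
  assumes "0 \<le> a" "0 \<le> b" "0 \<le> c" "0 < r"
  shows "(a + b + c) powr r \<le> 3 powr r * (a powr r + b powr r + c powr r)"
proof -
  have "(a + b + c) powr r \<le> (3 * max a (max b c)) powr r"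
    using assms by (intro powr_mono2) auto
  also have "\<dots> = 3 powr r * max a (max b c) powr r" using assms by (simp add: powr_mult)
  also have "max a (max b c) powr r \<le> a powr r + b powr r + c powr r" by (auto simp: max_def)
  finally show ?thesis by simp
qed

lemma norm_add_powr_le:
  fixes x y :: "'a::real_normed_vector"
  assumes "0 < p"
  shows "norm (x + y) powr p \<le> 2 powr p * (norm x powr p + norm y powr p)"
  using assms
  by (intro order_trans[OF powr_mono2 powr_add_le]) (auto intro: norm_triangle_ineq)

lemma norm_add3_powr_le:
  fixes x y z :: "'a::real_normed_vector"
  assumes "0 < p"
  shows "norm (x + y + z) powr p \<le> 3 powr p * (norm x powr p + norm y powr p + norm z powr p)"
  using assms
  by (intro order_trans[OF powr_mono2 powr_add3_le]) (auto intro: norm_triangle_le norm_triangle_mono)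

lemma summable_norm_powr_add:
  fixes x y :: "nat \<Rightarrow> 'a::real_normed_vector"
  assumes "summable (\<lambda>n. norm (x n) powr p)" "summable (\<lambda>n. norm (y n) powr p)" "0 < p"
  shows "summable (\<lambda>n. norm (x n + y n) powr p)"
  by (rule summable_comparison_test'[where g = "\<lambda>n. 2 powr p * (norm (x n) powr p + norm (y n) powr p)" and N = 0])
     (use assms norm_add_powr_le in \<open>auto intro!: summable_mult summable_add\<close>)

lemma modular_add_le:
  fixes x y :: "nat \<Rightarrow> 'a::real_normed_vector"
  assumes "summable (\<lambda>n. norm (x n) powr p)" "summable (\<lambda>n. norm (y n) powr p)" "0 < p"
  shows "modular p (\<lambda>n. x n + y n) \<le> 2 powr p * (modular p x + modular p y)"
proof -
  have "modular p (\<lambda>n. x n + y n) \<le> (\<Sum>n. 2 powr p * (norm (x n) powr p + norm (y n) powr p))"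
    unfolding modular_def using assms
    by (intro suminf_le norm_add_powr_le summable_norm_powr_add summable_mult summable_add)
  also have "\<dots> = 2 powr p * (modular p x + modular p y)"
    unfolding modular_def using assms by (simp add: suminf_mult summable_add suminf_add)
  finally show ?thesis .
qed

lemma modular_nonneg: "summable (\<lambda>n. norm (x n) powr p) \<Longrightarrow> 0 \<le> modular p x"
  by (simp add: modular_def suminf_nonneg)

lemma modular_finite:
  assumes "finite S" "\<And>n. n \<notin> S \<Longrightarrow> x n = 0"
  shows "modular p x = (\<Sum>n\<in>S. norm (x n) powr p)"
  unfolding modular_def by (rule suminf_finite) (use assms in auto)

lemma summable_finite_support:
  fixes x :: "nat \<Rightarrow> 'a::real_normed_vector"
  assumes "finite S" "\<And>n. n \<notin> S \<Longrightarrow> x n = 0"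
  shows "summable (\<lambda>n. norm (x n) powr p)"
  by (rule summable_finite[of S]) (use assms in auto)

lemma lp0_support: "x \<in> lp0 \<Longrightarrow> finite {n. x n \<noteq> 0}"
  by (simp add: lp0_def)

lemma lp0I: "finite S \<Longrightarrow> (\<And>n. n \<notin> S \<Longrightarrow> x n = 0) \<Longrightarrow> x \<in> lp0"
  unfolding lp0_def by (simp, erule finite_subset[rotated]) auto

lemma lp0_subset_lp: "x \<in> lp0 \<Longrightarrow> x \<in> carrier (lp p)"
  by (auto simp: lp_def intro: summable_finite_support[OF lp0_support])

lemma carrier_lp_iff: "x \<in> carrier (lp p) \<longleftrightarrow> summable (\<lambda>n. norm (x n) powr p)"
  by (simp add: lp_def)

lemma qnorm_lp: "qnorm (lp p) x = modular p x powr (1 / p)"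
  by (simp add: lp_def modular_def)

section \<open>The centralizer inequality in terms of modulars\<close>

lemma centralizer_carrier: "centralizer p \<Phi> \<Longrightarrow> x \<in> lp0 \<Longrightarrow> \<Phi> x \<in> carrier (lp p)"
  unfolding centralizer_def by (elim conjE, erule bspec)

lemma centralizer_scale: "centralizer p \<Phi> \<Longrightarrow> x \<in> lp0 \<Longrightarrow> \<Phi> (\<lambda>n. c * x n) = (\<lambda>n. c * \<Phi> x n)"
  unfolding centralizer_def by (elim conjE, drule spec, erule bspec)

text \<open>Multipliers in the unit ball suffice for what follows, and for them the supremum is at
  most 1. Summability is carried along because a bound on \<open>modular\<close> says nothing about
  a sequence outside the space.\<close>

lemma centralizer_modular:
  fixes \<Phi> :: "(nat \<Rightarrow> 'k::real_normed_field) \<Rightarrow> (nat \<Rightarrow> 'k)"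
  assumes "centralizer p \<Phi>" "0 < p"
  shows "\<exists>C\<ge>0. \<forall>a x. (\<forall>n. norm (a n) \<le> 1) \<longrightarrow> x \<in> lp0 \<longrightarrow>
       summable (\<lambda>n. norm (\<Phi> (\<lambda>k. a k * x k) n - a n * \<Phi> x n) powr p) \<and>
       modular p (\<lambda>n. \<Phi> (\<lambda>k. a k * x k) n - a n * \<Phi> x n) \<le> C * modular p x"
proof -
  have "\<exists>C. \<forall>a. bdd_above (range (\<lambda>n. norm (a n))) \<longrightarrow> (\<forall>x\<in>lp0.
        qnorm (lp p) (\<lambda>n. \<Phi> (\<lambda>k. a k * x k) n - a n * \<Phi> x n)
          \<le> C * (SUP n. norm (a n)) * qnorm (lp p) x)"
    using assms(1) unfolding centralizer_def by (elim conjE)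
  then obtain C where "\<forall>a. bdd_above (range (\<lambda>n. norm (a n))) \<longrightarrow> (\<forall>x\<in>lp0.
        qnorm (lp p) (\<lambda>n. \<Phi> (\<lambda>k. a k * x k) n - a n * \<Phi> x n)
          \<le> C * (SUP n. norm (a n)) * qnorm (lp p) x)" ..
  note C = this[rule_format]
  have car: "\<And>x. x \<in> lp0 \<Longrightarrow> summable (\<lambda>n. norm (\<Phi> x n) powr p)"
    using centralizer_carrier[OF assms(1)] by (simp add: carrier_lp_iff)
  show ?thesis
  proof (intro exI[of _ "\<bar>C\<bar> powr p"] conjI[OF powr_ge_zero] allI impI)
    fix a x :: "nat \<Rightarrow> 'k" assume "\<forall>n. norm (a n) \<le> 1" and x: "x \<in> lp0"
    then have a: "\<And>n. norm (a n) \<le> 1" by blast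
    have ax: "(\<lambda>k. a k * x k) \<in> lp0" using lp0_support[OF x] by (intro lp0I[of "{n. x n \<noteq> 0}"]) auto
    have "summable (\<lambda>n. norm (- (a n * \<Phi> x n)) powr p)"
    proof (rule summable_comparison_test'[where g = "\<lambda>n. norm (\<Phi> x n) powr p" and N = 0])
      fix n
      have "norm (a n * \<Phi> x n) \<le> 1 * norm (\<Phi> x n)"
        unfolding norm_mult using a by (intro mult_right_mono) auto
      then show "norm (norm (- (a n * \<Phi> x n)) powr p) \<le> norm (\<Phi> x n) powr p"
        using assms(2) by (auto intro!: powr_mono2)
    qed (use car[OF x] in simp)
    then have sm: "summable (\<lambda>n. norm (\<Phi> (\<lambda>k. a k * x k) n - a n * \<Phi> x n) powr p)"
      using summable_norm_powr_add[OF car[OF ax] _ assms(2)] by fastforce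
    have bdd: "bdd_above (range (\<lambda>n. norm (a n)))" using a by (intro bdd_aboveI[of _ 1]) auto
    have sup: "(SUP n. norm (a n)) \<le> 1" using a by (intro cSUP_least) auto
    have "0 \<le> norm (a 0)" by simp
    also have "norm (a 0) \<le> (SUP n. norm (a n))" using bdd by (intro cSUP_upper) auto
    finally have sup0: "0 \<le> (SUP n. norm (a n))" .
    have "C * (SUP n. norm (a n)) \<le> \<bar>C\<bar> * 1"
      using sup sup0 by (intro order_trans[OF mult_right_mono[of C "\<bar>C\<bar>"]] mult_left_mono) auto
    then have "C * (SUP n. norm (a n)) * qnorm (lp p) x \<le> \<bar>C\<bar> * qnorm (lp p) x"
      by (intro mult_right_mono) (auto simp: qnorm_lp)
    with C[OF bdd x] have "modular p (\<lambda>n. \<Phi> (\<lambda>k. a k * x k) n - a n * \<Phi> x n) powr (1 / p)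
        \<le> \<bar>C\<bar> * modular p x powr (1 / p)" unfolding qnorm_lp by linarith
    then have "(modular p (\<lambda>n. \<Phi> (\<lambda>k. a k * x k) n - a n * \<Phi> x n) powr (1 / p)) powr p
        \<le> (\<bar>C\<bar> * modular p x powr (1 / p)) powr p" using assms(2) by (intro powr_mono2) auto
    then have "modular p (\<lambda>n. \<Phi> (\<lambda>k. a k * x k) n - a n * \<Phi> x n) \<le> \<bar>C\<bar> powr p * modular p x"
      using assms(2) modular_nonneg[OF sm] modular_nonneg[of x p] lp0_subset_lp[OF x, of p]
      by (simp add: powr_mult powr_powr carrier_lp_iff)
    with sm show "summable (\<lambda>n. norm (\<Phi> (\<lambda>k. a k * x k) n - a n * \<Phi> x n) powr p) \<and>
       modular p (\<lambda>n. \<Phi> (\<lambda>k. a k * x k) n - a n * \<Phi> x n) \<le> \<bar>C\<bar> powr p * modular p x" by blast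
  qed
qed

lemma powr_double: "r powr (2 * p) = r powr p * r powr p" for r p :: real
  by (simp only: mult_2 powr_add)

lemma power2_powr:
  fixes r :: real
  assumes "0 \<le> r"
  shows "(r\<^sup>2) powr p = r powr (2 * p)"
proof (cases "r = 0")
  case False
  then have "r\<^sup>2 = r powr 2" using assms powr_numeral[of r "num.Bit0 num.One"] by simp
  then show ?thesis by (simp only: powr_powr)
qed simp

section \<open>The slopes of a centralizer as a coherent family\<close>

definition weight_of :: "real \<Rightarrow> (nat \<Rightarrow> 'k::real_normed_vector) \<Rightarrow> nat \<Rightarrow> real" where
  "weight_of p x = (\<lambda>n. norm (x n) powr p)"

definition root_seq :: "real \<Rightarrow> (nat \<Rightarrow> real) \<Rightarrow> nat \<Rightarrow> 'k::real_normed_algebra_1" where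
  "root_seq p w = (\<lambda>n. of_real (max 0 (w n) powr (1 / p)))"

text \<open>The quotient \<open>\<Phi> x / x\<close> for \<open>x = w\<^sup>1\<^sup>/\<^sup>p\<close>, with value \<open>0\<close> off the support. Negative weights are
  cut off only to make the scale invariance unconditional.\<close>

definition slope :: "real \<Rightarrow> ((nat \<Rightarrow> 'k::real_normed_field) \<Rightarrow> (nat \<Rightarrow> 'k)) \<Rightarrow> (nat \<Rightarrow> real) \<Rightarrow> nat \<Rightarrow> 'k" where
  "slope p \<Phi> w n = (if root_seq p w \<in> (lp0 :: (nat \<Rightarrow> 'k) set) then \<Phi> (root_seq p w) n / root_seq p w n else 0)"

lemma root_seq_lp0:
  assumes "finite S" "\<And>n. n \<notin> S \<Longrightarrow> w n = 0"
  shows "root_seq p w \<in> (lp0 :: (nat \<Rightarrow> 'k::real_normed_field) set)"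
  using assms by (intro lp0I[of S]) (auto simp: root_seq_def)

lemma norm_root_seq_powr:
  assumes "0 < p" "0 \<le> w n"
  shows "norm (root_seq p w n :: 'k::real_normed_field) powr p = w n"
  using assms by (simp add: root_seq_def powr_powr max_def)

lemma scale_invariant_slope:
  fixes \<Phi> :: "(nat \<Rightarrow> 'k::real_normed_field) \<Rightarrow> (nat \<Rightarrow> 'k)"
  assumes "centralizer p \<Phi>" "0 < p"
  shows "scale_invariant (slope p \<Phi>)"
  unfolding scale_invariant_def
proof (intro allI impI ext)
  fix c :: real and w n assume c: "0 < c"
  define d :: 'k where "d = of_real (c powr (1 / p))"
  have d: "d \<noteq> 0" using c by (simp add: d_def)
  have r: "root_seq p (\<lambda>n. c * w n) = (\<lambda>n. d * root_seq p w n)"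
  proof
    fix n
    have "max 0 (c * w n) = c * max 0 (w n)"
      using c by (simp add: max_def zero_le_mult_iff)
    then show "root_seq p (\<lambda>n. c * w n) n = d * root_seq p w n"
      using c by (simp add: root_seq_def d_def powr_mult)
  qed
  have "((\<lambda>n. d * root_seq p w n) \<in> lp0) = (root_seq p w \<in> (lp0 :: (nat \<Rightarrow> 'k) set))"
    using d by (simp add: lp0_def)
  moreover have "\<Phi> (\<lambda>n. d * root_seq p w n) = (\<lambda>n. d * \<Phi> (root_seq p w) n)" if "root_seq p w \<in> (lp0 :: (nat \<Rightarrow> 'k) set)"
    by (rule centralizer_scale[OF assms(1) that])
  ultimately show "slope p \<Phi> (\<lambda>n. c * w n) n = slope p \<Phi> w n"
    using d by (simp add: slope_def r)
qed

text \<open>For \<open>v \<le> w\<close> the root of \<open>v\<close> is \<open>a\<close> times the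
  root \<open>t\<close> of \<open>w\<close> with \<open>a\<close> in the unit ball. The root of
  \<open>v\<close> times the difference of the slopes is then
  \<open>\<Phi> (a t) - a \<Phi> t\<close>, and the claim is the centralizer inequality raised to
  the power \<open>p\<close>.\<close>

lemma coherent_slope:
  fixes \<Phi> :: "(nat \<Rightarrow> 'k::real_normed_field) \<Rightarrow> (nat \<Rightarrow> 'k)"
  assumes p: "0 < p"
    and C: "\<And>a x. \<lbrakk>\<And>n. norm (a n) \<le> 1; x \<in> lp0\<rbrakk> \<Longrightarrow>
       summable (\<lambda>n. norm (\<Phi> (\<lambda>k. a k * x k) n - a n * \<Phi> x n) powr p) \<and>
       modular p (\<lambda>n. \<Phi> (\<lambda>k. a k * x k) n - a n * \<Phi> x n) \<le> C * modular p x"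
  shows "coherent p C (slope p \<Phi>)"
  unfolding coherent_def
proof (intro allI impI)
  fix S and v w :: "nat \<Rightarrow> real"
  assume S: "finite S" and w: "\<forall>n. n \<notin> S \<longrightarrow> w n = 0" and vw: "\<forall>n. 0 \<le> v n \<and> v n \<le> w n"
  have v: "\<forall>n. n \<notin> S \<longrightarrow> v n = 0" using w vw by (metis order_antisym)
  define s where "s = (root_seq p v :: nat \<Rightarrow> 'k)"
  define t where "t = (root_seq p w :: nat \<Rightarrow> 'k)"
  have s0: "s \<in> lp0" and t0: "t \<in> lp0" unfolding s_def t_def using S v w by (auto intro: root_seq_lp0)
  have st: "norm (s n) \<le> norm (t n)" for n
    using vw p order_trans[OF conjunct1[OF spec[OF vw]] conjunct2[OF spec[OF vw]], of n]
    by (auto simp: s_def t_def root_seq_def intro!: powr_mono2)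
  \<comment> \<open>Off the support of \<open>t\<close> also \<open>s\<close> vanishes, and division
    by zero gives the multiplier 0 there.\<close>
  define a where "a n = s n / t n" for n
  have a1: "norm (a n) \<le> 1" for n using st[of n]
    by (cases "t n = 0") (auto simp: a_def norm_divide divide_le_eq)
  have sat: "s = (\<lambda>k. a k * t k)"
  proof
    fix k show "s k = a k * t k" using st[of k] by (cases "t k = 0") (auto simp: a_def)
  qed
  have main: "summable (\<lambda>n. norm (\<Phi> s n - a n * \<Phi> t n) powr p)"
     "modular p (\<lambda>n. \<Phi> s n - a n * \<Phi> t n) \<le> C * modular p t"
    using C[of a t, OF a1 t0] unfolding sat[symmetric] by auto
  have "(\<Sum>n\<in>S. v n * norm (slope p \<Phi> v n - slope p \<Phi> w n) powr p)
     \<le> (\<Sum>n\<in>S. norm (\<Phi> s n - a n * \<Phi> t n) powr p)"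
  proof (rule sum_mono)
    fix n
    show "v n * norm (slope p \<Phi> v n - slope p \<Phi> w n) powr p \<le> norm (\<Phi> s n - a n * \<Phi> t n) powr p"
    proof (cases "v n = 0")
      case False
      then have "0 < v n" "0 < w n" using vw[rule_format, of n] by linarith+
      then have nz: "s n \<noteq> 0" "t n \<noteq> 0" by (auto simp: s_def t_def root_seq_def)
      have "v n = norm (s n) powr p" using norm_root_seq_powr[where 'k = 'k, OF p, of v n] vw by (simp add: s_def)
      then have "v n * norm (slope p \<Phi> v n - slope p \<Phi> w n) powr p
          = norm (s n * (slope p \<Phi> v n - slope p \<Phi> w n)) powr p"
        by (simp add: norm_mult powr_mult)
      also have "s n * (slope p \<Phi> v n - slope p \<Phi> w n) = \<Phi> s n - a n * \<Phi> t n"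
        using nz s0 t0 by (simp add: slope_def a_def flip: s_def t_def) (simp add: field_simps)
      finally show ?thesis by simp
    qed simp
  qed
  also have "\<dots> \<le> modular p (\<lambda>n. \<Phi> s n - a n * \<Phi> t n)"
    unfolding modular_def using main(1) S by (intro sum_le_suminf) auto
  also have "\<dots> \<le> C * modular p t" by (rule main)
  also have "modular p t = sum w S"
  proof -
    have "modular p t = (\<Sum>n\<in>S. norm (t n) powr p)"
      using S w by (intro modular_finite) (auto simp: t_def root_seq_def)
    also have "\<dots> = sum w S"
      unfolding t_def using p vw by (intro sum.cong refl norm_root_seq_powr) (auto intro: order_trans)
    finally show ?thesis .
  qed
  finally show "(\<Sum>n\<in>S. v n * norm (slope p \<Phi> v n - slope p \<Phi> w n) powr p) \<le> C * sum w S" .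
qed

text \<open>\<open>x\<close> is the sequence of its absolute values times a multiplier with
  unimodular or zero entries. The centralizer inequality moves the multiplier out of
  \<open>\<Phi>\<close>, and what remains depends on the weight alone.\<close>

lemma centralizer_approx_slope:
  fixes \<Phi> :: "(nat \<Rightarrow> 'k::real_normed_field) \<Rightarrow> (nat \<Rightarrow> 'k)"
  assumes p: "0 < p" and x: "x \<in> lp0"
    and C: "\<And>a x. \<lbrakk>\<And>n. norm (a n) \<le> 1; x \<in> lp0\<rbrakk> \<Longrightarrow>
       summable (\<lambda>n. norm (\<Phi> (\<lambda>k. a k * x k) n - a n * \<Phi> x n) powr p) \<and>
       modular p (\<lambda>n. \<Phi> (\<lambda>k. a k * x k) n - a n * \<Phi> x n) \<le> C * modular p x"
  shows "summable (\<lambda>n. norm (\<Phi> x n - x n * slope p \<Phi> (weight_of p x) n) powr p) \<and>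
    modular p (\<lambda>n. \<Phi> x n - x n * slope p \<Phi> (weight_of p x) n) \<le> C * modular p x"
proof -
  define t where "t = (root_seq p (weight_of p x) :: nat \<Rightarrow> 'k)"
  have t: "t n = of_real (norm (x n))" for n
    using p by (simp add: t_def root_seq_def weight_of_def powr_powr max_def)
  have t0: "t \<in> lp0" using lp0_support[OF x] by (intro lp0I[of "{n. x n \<noteq> 0}"]) (auto simp: t)
  define a where "a n = x n / t n" for n
  have a1: "norm (a n) \<le> 1" for n by (cases "x n = 0") (auto simp: a_def t norm_divide)
  have xat: "(\<lambda>k. a k * t k) = x" by (auto simp: a_def t)
  have "modular p t = modular p x" by (simp add: modular_def t)
  moreover have "a n * \<Phi> t n = x n * slope p \<Phi> (weight_of p x) n" for n
    using t0 by (simp add: slope_def a_def flip: t_def)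
  ultimately show ?thesis using C[of a t, OF a1 t0] unfolding xat by simp
qed

text \<open>Let \<open>\<sigma>\<close> be the section of a common weight and
  \<open>e a = \<gamma> a - \<sigma>\<close>. As \<open>z = x + y\<close>, the terms with
  \<open>\<sigma>\<^sup>2\<close> cancel and the defect of \<open>H\<close> is exactly
  \<open>\<sigma> * \<Delta> + E\<close>, with \<open>E\<close> quadratic in the errors and so
  bounded by coherence at \<open>2 * p\<close>. The delicate point is to exchange
  \<open>\<sigma>\<close> for the section of \<open>\<Delta>\<close>, since the weight of
  \<open>\<Delta>\<close> need not lie below the common one.\<close>

lemma centralizer_lift_modular:
  fixes \<Phi> :: "(nat \<Rightarrow> 'k::real_normed_field) \<Rightarrow> (nat \<Rightarrow> 'k)"
  assumes cen: "centralizer p \<Phi>" and p: "0 < p"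
  shows "\<exists>\<Omega> H K. 0 \<le> K \<and> (\<forall>x\<in>lp0. \<Omega> x \<in> lp0 \<and> H x \<in> lp0) \<and>
    (\<forall>c x. \<Omega> (\<lambda>n. c * x n) = (\<lambda>n. c * \<Omega> x n) \<and> H (\<lambda>n. c * x n) = (\<lambda>n. c * H x n)) \<and>
    (\<forall>x\<in>lp0. modular p (\<lambda>n. \<Omega> x n - \<Phi> x n) \<le> K * modular p x) \<and>
    (\<forall>x\<in>lp0. \<forall>y\<in>lp0. let \<Delta> = (\<lambda>n. \<Omega> (\<lambda>k. x k + y k) n - \<Omega> x n - \<Omega> y n) in
       modular p \<Delta> \<le> K * (modular p x + modular p y) \<and>
       modular p (\<lambda>n. H (\<lambda>k. x k + y k) n - H x n - H y n - \<Phi> \<Delta> n) \<le> K * (modular p x + modular p y))"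
proof -
  obtain C where C: "0 \<le> C" and "\<forall>a x. (\<forall>n. norm (a n) \<le> 1) \<longrightarrow> x \<in> lp0 \<longrightarrow>
       summable (\<lambda>n. norm (\<Phi> (\<lambda>k. a k * x k) n - a n * \<Phi> x n) powr p) \<and>
       modular p (\<lambda>n. \<Phi> (\<lambda>k. a k * x k) n - a n * \<Phi> x n) \<le> C * modular p x"
    using centralizer_modular[OF cen p] by (elim exE conjE)
  note cm = this(2)[rule_format]
  define F where "F = slope p \<Phi>"
  have "coherent p C F" unfolding F_def by (rule coherent_slope[OF p cm])
  moreover have "scale_invariant F" unfolding F_def by (rule scale_invariant_slope[OF cen p])
  moreover have p2: "0 < 2 * p" using p by simp
  ultimately obtain G K where G: "scale_invariant G" and K: "0 \<le> K" and coh: "coherent (2 * p) K G"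
    and FG: "\<forall>S w. finite S \<longrightarrow> (\<forall>n. 0 \<le> w n) \<longrightarrow> (\<forall>n. n \<notin> S \<longrightarrow> w n = 0) \<longrightarrow>
      (\<Sum>n\<in>S. w n * norm (F w n - G w n) powr p) \<le> K * sum w S"
    using higher_integrability[of p C F "2 * p"] p C by blast
  note FG = FG[rule_format]
  define \<gamma> where "\<gamma> x = G (weight_of p x)" for x :: "nat \<Rightarrow> 'k"
  define \<Omega> where "\<Omega> x = (\<lambda>n. x n * \<gamma> x n)" for x
  define H where "H x = (\<lambda>n. x n * (\<gamma> x n)\<^sup>2 / 2)" for x
  have \<gamma>c: "\<gamma> (\<lambda>n. c * x n) = \<gamma> x" if "c \<noteq> 0" for c x
  proof -
    have "weight_of p (\<lambda>n. c * x n) = (\<lambda>n. norm c powr p * weight_of p x n)"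
      by (simp add: weight_of_def norm_mult powr_mult)
    then show ?thesis using G that unfolding \<gamma>_def scale_invariant_def by simp
  qed
  have hom: "\<Omega> (\<lambda>n. c * x n) = (\<lambda>n. c * \<Omega> x n)" "H (\<lambda>n. c * x n) = (\<lambda>n. c * H x n)" for c x
    by (cases "c = 0"; simp add: \<Omega>_def H_def \<gamma>c mult.assoc)+
  have lp0: "\<Omega> x \<in> lp0" "H x \<in> lp0" if "x \<in> lp0" for x
    using lp0_support[OF that] by (auto intro!: lp0I[of "{n. x n \<noteq> 0}"] simp: \<Omega>_def H_def)
  have wt0: "0 \<le> weight_of p x n" for x :: "nat \<Rightarrow> 'k" and n by (simp add: weight_of_def)
  define K1 where "K1 = 2 powr p * (K + C)"
  have K1: "0 \<le> K1" using K C by (simp add: K1_def)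
  have near: "summable (\<lambda>n. norm (\<Omega> x n - \<Phi> x n) powr p) \<and> modular p (\<lambda>n. \<Omega> x n - \<Phi> x n) \<le> K1 * modular p x"
    if x: "x \<in> lp0" for x
  proof -
    define S where "S = {n. x n \<noteq> 0}"
    have S: "finite S" using lp0_support[OF x] by (simp add: S_def)
    define u where "u n = \<Omega> x n - x n * F (weight_of p x) n" for n
    define v where "v n = x n * F (weight_of p x) n - \<Phi> x n" for n
    have u0: "n \<notin> S \<Longrightarrow> u n = 0" for n by (simp add: u_def \<Omega>_def S_def)
    have su: "summable (\<lambda>n. norm (u n) powr p)" by (rule summable_finite_support[OF S u0])
    have "modular p u = (\<Sum>n\<in>S. norm (u n) powr p)" by (rule modular_finite[OF S u0])
    also have "\<dots> = (\<Sum>n\<in>S. weight_of p x n * norm (F (weight_of p x) n - G (weight_of p x) n) powr p)"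
      by (intro sum.cong refl)
         (simp add: u_def \<Omega>_def \<gamma>_def weight_of_def norm_mult powr_mult norm_minus_commute
           flip: right_diff_distrib)
    also have "\<dots> \<le> K * sum (weight_of p x) S"
      by (rule FG[OF S wt0]) (simp add: weight_of_def S_def)
    also have "sum (weight_of p x) S = modular p x"
      unfolding weight_of_def by (rule modular_finite[OF S, symmetric]) (simp add: S_def)
    finally have mu: "modular p u \<le> K * modular p x" .
    have v: "summable (\<lambda>n. norm (v n) powr p)" "modular p v \<le> C * modular p x"
      using centralizer_approx_slope[OF p x cm]
      by (simp_all add: v_def F_def modular_def norm_minus_commute)
    have uv: "\<Omega> x n - \<Phi> x n = u n + v n" for n by (simp add: u_def v_def)
    have "2 powr p * (modular p u + modular p v) \<le> K1 * modular p x"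
      using mult_left_mono[OF add_mono[OF mu v(2)], of "2 powr p"] by (simp add: K1_def algebra_simps)
    then show ?thesis
      unfolding uv using modular_add_le[OF su v(1) p] summable_norm_powr_add[OF su v(1) p] by linarith
  qed
  define B where "B = 2 powr p"
  define T where "T = 3 powr p"
  have BT: "1 \<le> B" "1 \<le> T" using p by (auto simp: B_def T_def ge_one_powr_ge_zero)
  define K\<Delta> where "K\<Delta> = T * (3 * (1 + K))"
  define KE where "KE = T * (3 * K)"
  define KR where "KR = T * T * (3 * K)"
  define KD where "KD = 1 + B * B * (2 * K * (K\<Delta> + 1)) + KR"
  have est: "modular p (\<lambda>n. \<Omega> (\<lambda>k. x k + y k) n - \<Omega> x n - \<Omega> y n) \<le> K\<Delta> * W \<and>
     modular p (\<lambda>n. H (\<lambda>k. x k + y k) n - H x n - H y n - \<Phi> (\<lambda>n. \<Omega> (\<lambda>k. x k + y k) n - \<Omega> x n - \<Omega> y n) n)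
       \<le> B * (KE * W + B * (KD * W + K1 * (K\<Delta> * W)))"
    if x: "x \<in> lp0" and y: "y \<in> lp0" and W: "W = B * (modular p x + modular p y)" for x y W
  proof -
    define S where "S = {n. x n \<noteq> 0} \<union> {n. y n \<noteq> 0}"
    have S: "finite S" using lp0_support[OF x] lp0_support[OF y] by (simp add: S_def)
    have xS: "n \<notin> S \<Longrightarrow> x n = 0" and yS: "n \<notin> S \<Longrightarrow> y n = 0" for n by (auto simp: S_def)
    define t where "t n = norm (x n) + norm (y n)" for n
    have t0: "0 \<le> t n" for n by (simp add: t_def)
    \<comment> \<open>One weight that dominates those of \<open>x\<close>, \<open>y\<close> and
      \<open>x + y\<close> and has mass at most \<open>W\<close>, so that a single section is
      comparable to all three.\<close>
    define u where "u n = t n powr p" for n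
    have u0: "0 \<le> u n" for n by (simp add: u_def)
    have uS: "n \<notin> S \<Longrightarrow> u n = 0" for n by (simp add: u_def t_def xS yS)
    have sumu: "sum u S \<le> W"
    proof -
      have "sum u S \<le> (\<Sum>n\<in>S. B * (norm (x n) powr p + norm (y n) powr p))"
        unfolding u_def t_def B_def using p by (intro sum_mono powr_add_le) auto
      also have "\<dots> = W"
        unfolding W using S xS yS by (simp add: modular_finite[of S] sum.distrib flip: sum_distrib_left)
      finally show ?thesis .
    qed
    have W0: "0 \<le> W" using sumu by (rule order_trans[rotated]) (simp add: sum_nonneg u0)
    define \<sigma> where "\<sigma> = G u"
    define z where "z = (\<lambda>n. x n + y n)"
    define e where "e a n = \<gamma> a n - \<sigma> n" for a n
    \<comment> \<open>The p-th power of the norm of \<open>a * (e a)\<^sup>2\<close>; its sum is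
      what coherence at the exponent \<open>2 * p\<close> controls.\<close>
    define Q where "Q a n = norm (a n) powr p * norm (e a n) powr (2 * p)" for a :: "nat \<Rightarrow> 'k" and n
    have Q0: "0 \<le> Q a n" for a n by (simp add: Q_def)
    have dom: "norm (x n) \<le> t n" "norm (y n) \<le> t n" "norm (z n) \<le> t n" for n
      by (auto simp: t_def z_def norm_triangle_ineq)
    have wu: "norm (a n) powr p \<le> u n" if "norm (a n) \<le> t n" for a :: "nat \<Rightarrow> 'k" and n
      unfolding u_def using that p by (intro powr_mono2) auto
    have sumQ: "sum (Q a) S \<le> K * W" if a: "\<And>n. norm (a n) \<le> t n" for a
    proof -
      have "(\<Sum>n\<in>S. weight_of p a n * norm (G (weight_of p a) n - G u n) powr (2 * p)) \<le> K * sum u S"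
        using wu[of a] a by (intro coherentD[OF coh S uS wt0]) (auto simp: weight_of_def)
      also have "\<dots> \<le> K * W" using sumu K by (rule mult_left_mono)
      finally show ?thesis by (simp add: Q_def[abs_def] e_def \<gamma>_def \<sigma>_def weight_of_def)
    qed
    define \<Delta> where "\<Delta> = (\<lambda>n. \<Omega> z n - \<Omega> x n - \<Omega> y n)"
    have \<Delta>: "\<Delta> n = z n * e z n + - (x n * e x n) + - (y n * e y n)" for n
      by (simp add: \<Delta>_def \<Omega>_def e_def z_def algebra_simps)
    have \<Delta>S: "n \<notin> S \<Longrightarrow> \<Delta> n = 0" for n by (simp add: \<Delta> z_def xS yS)
    have \<Delta>lp0: "\<Delta> \<in> lp0" using \<Delta>S by (rule lp0I[OF S])
    have mid: "norm (a n * e a n) powr p \<le> u n + Q a n" if "norm (a n) \<le> t n" for a n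
    proof -
      have "norm (a n * e a n) powr p = norm (a n) powr p * norm (e a n) powr p"
        by (simp add: norm_mult powr_mult)
      also have "\<dots> \<le> norm (a n) powr p * (1 + norm (e a n) powr (2 * p))"
        using p by (intro mult_left_mono powr_le_one_plus) auto
      also have "\<dots> \<le> u n + Q a n" using wu[of a n] that by (simp add: Q_def algebra_simps)
      finally show ?thesis .
    qed
    have m\<Delta>: "modular p \<Delta> \<le> K\<Delta> * W"
    proof -
      have "modular p \<Delta> = (\<Sum>n\<in>S. norm (\<Delta> n) powr p)" by (rule modular_finite[OF S \<Delta>S])
      also have "\<dots> \<le> (\<Sum>n\<in>S. T * ((u n + Q z n) + (u n + Q x n) + (u n + Q y n)))"
      proof (rule sum_mono)
        fix n
        have "norm (\<Delta> n) powr p \<le> T * (norm (z n * e z n) powr p + norm (- (x n * e x n)) powr p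
             + norm (- (y n * e y n)) powr p)"
          unfolding \<Delta> T_def using p by (rule norm_add3_powr_le)
        also have "\<dots> \<le> T * ((u n + Q z n) + (u n + Q x n) + (u n + Q y n))"
          using mid[of z n] mid[of x n] mid[of y n] dom BT by (intro mult_left_mono add_mono) auto
        finally show "norm (\<Delta> n) powr p \<le> T * ((u n + Q z n) + (u n + Q x n) + (u n + Q y n))" .
      qed
      also have "\<dots> = T * (3 * sum u S + (sum (Q z) S + sum (Q x) S + sum (Q y) S))"
        by (simp add: sum.distrib flip: sum_distrib_left)
      also have "\<dots> \<le> T * (3 * W + (K * W + K * W + K * W))"
        using sumQ[of z] sumQ[of x] sumQ[of y] sumu dom BT by (intro mult_left_mono add_mono) auto
      also have "\<dots> = K\<Delta> * W" by (simp add: K\<Delta>_def algebra_simps)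
      finally show ?thesis .
    qed
    define E where "E n = z n * (e z n)\<^sup>2 / 2 + - (x n * (e x n)\<^sup>2 / 2) + - (y n * (e y n)\<^sup>2 / 2)" for n
    have ES: "n \<notin> S \<Longrightarrow> E n = 0" for n by (simp add: E_def z_def xS yS)
    have half: "norm (a n * (e a n)\<^sup>2 / 2) powr p \<le> Q a n" for a n
    proof -
      have "norm (a n * (e a n)\<^sup>2 / 2) \<le> norm (a n) * (norm (e a n))\<^sup>2"
        by (simp add: norm_divide norm_mult norm_power)
      then have "norm (a n * (e a n)\<^sup>2 / 2) powr p \<le> (norm (a n) * (norm (e a n))\<^sup>2) powr p"
        using p by (intro powr_mono2) auto
      also have "\<dots> = Q a n" 
        unfolding Q_def by (subst powr_mult) (simp_all add: power2_powr)
      finally show ?thesis .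
    qed
    have mE: "modular p E \<le> KE * W"
    proof -
      have "modular p E = (\<Sum>n\<in>S. norm (E n) powr p)" by (rule modular_finite[OF S ES])
      also have "\<dots> \<le> (\<Sum>n\<in>S. T * (Q z n + Q x n + Q y n))"
      proof (rule sum_mono)
        fix n
        have "norm (E n) powr p \<le> T * (norm (z n * (e z n)\<^sup>2 / 2) powr p + norm (- (x n * (e x n)\<^sup>2 / 2)) powr p
             + norm (- (y n * (e y n)\<^sup>2 / 2)) powr p)"
          unfolding E_def T_def using p by (rule norm_add3_powr_le)
        also have "\<dots> \<le> T * (Q z n + Q x n + Q y n)"
          using half[of z n] half[of x n] half[of y n] BT unfolding norm_minus_cancel
          by (intro mult_left_mono add_mono) auto
        finally show "norm (E n) powr p \<le> T * (Q z n + Q x n + Q y n)" .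
      qed
      also have "\<dots> = T * (sum (Q z) S + sum (Q x) S + sum (Q y) S)"
        by (simp add: sum.distrib flip: sum_distrib_left)
      also have "\<dots> \<le> T * (K * W + K * W + K * W)"
        using sumQ[of z] sumQ[of x] sumQ[of y] dom BT by (intro mult_left_mono add_mono) auto
      also have "\<dots> = KE * W" by (simp add: KE_def algebra_simps)
      finally show ?thesis .
    qed
    \<comment> \<open>The weight of \<open>\<Delta>\<close> squared, over \<open>u\<close>: a
      measure of its excess over \<open>u\<close>. It is summable because each of the three terms of
      \<open>\<Delta>\<close>, raised to \<open>2 * p\<close>, is at most
      \<open>u n * Q a n\<close>, so that one factor \<open>u\<close> cancels.\<close>
    define R where "R n = norm (\<Delta> n) powr (2 * p) / u n" for n
    have upos: "0 < u n" if "\<Delta> n \<noteq> 0" for n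
    proof (rule ccontr)
      assume "\<not> 0 < u n"
      then have "t n = 0" using t0[of n] by (simp add: u_def)
      then have "x n = 0" "y n = 0" using add_nonneg_eq_0_iff[of "norm (x n)" "norm (y n)"] by (auto simp: t_def)
      then show False using that by (simp add: \<Delta> z_def)
    qed
    have sumR: "sum R S \<le> KR * W"
    proof -
      have "sum R S \<le> (\<Sum>n\<in>S. T * T * (Q z n + Q x n + Q y n))"
      proof (rule sum_mono)
        fix n
        show "R n \<le> T * T * (Q z n + Q x n + Q y n)"
        proof (cases "\<Delta> n = 0")
          case True
          then show ?thesis using Q0 BT by (simp add: R_def)
        next
          case False
          have sq: "norm (a n * e a n) powr (2 * p) \<le> u n * Q a n" if "norm (a n) \<le> t n" for a
          proof -
            have "norm (a n * e a n) powr (2 * p)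
                = norm (a n) powr p * (norm (a n) powr p * norm (e a n) powr (2 * p))"
              by (simp add: norm_mult powr_mult powr_double)
            also have "\<dots> \<le> u n * Q a n"
              unfolding Q_def using wu[of a n] that by (intro mult_right_mono) auto
            finally show ?thesis .
          qed
          have "norm (\<Delta> n) powr (2 * p) \<le> 3 powr (2 * p) * (norm (z n * e z n) powr (2 * p)
             + norm (- (x n * e x n)) powr (2 * p) + norm (- (y n * e y n)) powr (2 * p))"
            unfolding \<Delta> using p2 by (rule norm_add3_powr_le)
          also have "\<dots> \<le> 3 powr (2 * p) * (u n * Q z n + u n * Q x n + u n * Q y n)"
            using sq[of z] sq[of x] sq[of y] dom unfolding norm_minus_cancel
            by (intro mult_left_mono add_mono) auto
          also have "\<dots> = T * T * (Q z n + Q x n + Q y n) * u n"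
            unfolding T_def powr_double by (simp add: algebra_simps)
          finally show ?thesis using upos[OF False] by (simp add: R_def divide_le_eq)
        qed
      qed
      also have "\<dots> = T * T * (sum (Q z) S + sum (Q x) S + sum (Q y) S)"
        by (simp add: sum.distrib flip: sum_distrib_left)
      also have "\<dots> \<le> T * T * (K * W + K * W + K * W)"
        using sumQ[of z] sumQ[of x] sumQ[of y] dom BT by (intro mult_left_mono add_mono) auto
      also have "\<dots> = KR * W" by (simp add: KR_def algebra_simps)
      finally show ?thesis .
    qed
    define w where "w = weight_of p \<Delta>"
    \<comment> \<open>Neither \<open>w\<close> nor \<open>u\<close> need dominate the other. Their
      sections are compared through that of the sum, which dominates both and still has mass at most
      a multiple of \<open>W\<close>.\<close>
    define u' where "u' n = w n + u n" for n
    have w0: "0 \<le> w n" for n by (simp add: w_def wt0)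
    have wS: "n \<notin> S \<Longrightarrow> w n = 0" for n by (simp add: w_def weight_of_def \<Delta>S)
    have u'S: "n \<notin> S \<Longrightarrow> u' n = 0" for n by (simp add: u'_def wS uS)
    have sumw: "sum w S = modular p \<Delta>"
      unfolding w_def weight_of_def by (rule modular_finite[OF S \<Delta>S, symmetric])
    have sumu': "sum u' S \<le> (K\<Delta> + 1) * W"
      using m\<Delta> sumu by (simp add: u'_def sum.distrib sumw algebra_simps)
    define P where "P n = w n * norm (\<gamma> \<Delta> n - G u' n) powr (2 * p)" for n
    define P' where "P' n = u n * norm (\<sigma> n - G u' n) powr (2 * p)" for n
    have sumP: "sum P S \<le> K * ((K\<Delta> + 1) * W)"
    proof -
      have "(\<Sum>n\<in>S. w n * norm (G w n - G u' n) powr (2 * p)) \<le> K * sum u' S"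
        using u0 w0 by (intro coherentD[OF coh S u'S]) (auto simp: u'_def)
      then show ?thesis using mult_left_mono[OF sumu' K] by (simp add: P_def \<gamma>_def w_def)
    qed
    have sumP': "sum P' S \<le> K * ((K\<Delta> + 1) * W)"
    proof -
      have "(\<Sum>n\<in>S. u n * norm (G u n - G u' n) powr (2 * p)) \<le> K * sum u' S"
        using u0 w0 by (intro coherentD[OF coh S u'S]) (auto simp: u'_def)
      then show ?thesis using mult_left_mono[OF sumu' K] by (simp add: P'_def \<sigma>_def)
    qed
    define D where "D n = \<Delta> n * (\<sigma> n - \<gamma> \<Delta> n)" for n
    have DS: "n \<notin> S \<Longrightarrow> D n = 0" for n by (simp add: D_def \<Delta>S)
    have Dn: "norm (D n) powr p \<le> u n + B * B * (P n + P' n) + R n" for n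
    proof (cases "\<Delta> n = 0")
      case True
      then show ?thesis using u0[of n] w0[of n] BT by (simp add: D_def R_def P_def P'_def)
    next
      case False
      define \<epsilon> where "\<epsilon> = norm (\<sigma> n - \<gamma> \<Delta> n)"
      have un: "0 < u n" by (rule upos[OF False])
      have wn: "w n = norm (\<Delta> n) powr p" by (simp add: w_def weight_of_def)
      have Dw: "norm (D n) powr p = w n * \<epsilon> powr p" by (simp add: D_def wn \<epsilon>_def norm_mult powr_mult)
      have R0: "0 \<le> R n" using un by (simp add: R_def)
      have "\<epsilon> \<le> norm (\<gamma> \<Delta> n - G u' n) + norm (\<sigma> n - G u' n)"
        unfolding \<epsilon>_def using norm_triangle_ineq4[of "\<sigma> n - G u' n" "\<gamma> \<Delta> n - G u' n"] by simp
      then have "\<epsilon> powr (2 * p) \<le> (norm (\<gamma> \<Delta> n - G u' n) + norm (\<sigma> n - G u' n)) powr (2 * p)"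
        using p by (intro powr_mono2) (auto simp: \<epsilon>_def)
      also have "\<dots> \<le> 2 powr (2 * p) * (norm (\<gamma> \<Delta> n - G u' n) powr (2 * p) + norm (\<sigma> n - G u' n) powr (2 * p))"
        using p by (intro powr_add_le) auto
      finally have \<epsilon>2: "\<epsilon> powr (2 * p) \<le> B * B * (norm (\<gamma> \<Delta> n - G u' n) powr (2 * p) + norm (\<sigma> n - G u' n) powr (2 * p))"
        by (simp add: B_def powr_double)
      \<comment> \<open>Each leg of the comparison is controlled only against its own weight, so the
        whole of it only against a weight below both.\<close>
      have min: "m * \<epsilon> powr (2 * p) \<le> B * B * (P n + P' n)" if m: "0 \<le> m" "m \<le> w n" "m \<le> u n" for m
      proof -
        have "m * \<epsilon> powr (2 * p) \<le> m * (B * B * (norm (\<gamma> \<Delta> n - G u' n) powr (2 * p) + norm (\<sigma> n - G u' n) powr (2 * p)))"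
          using \<epsilon>2 m by (intro mult_left_mono)
        also have "\<dots> = B * B * (m * norm (\<gamma> \<Delta> n - G u' n) powr (2 * p) + m * norm (\<sigma> n - G u' n) powr (2 * p))"
          by (simp add: algebra_simps)
        also have "\<dots> \<le> B * B * (P n + P' n)"
          unfolding P_def P'_def using m BT by (intro mult_left_mono add_mono mult_right_mono) auto
        finally show ?thesis .
      qed
      show ?thesis
      proof (cases "w n \<le> u n")
        case True
        have "w n * \<epsilon> powr p \<le> w n * (1 + \<epsilon> powr (2 * p))"
          using w0 p by (intro mult_left_mono powr_le_one_plus) (auto simp: \<epsilon>_def)
        also have "\<dots> \<le> u n + B * B * (P n + P' n)"
          using True min[of "w n"] w0[of n] by (simp add: algebra_simps)
        finally show ?thesis using R0 Dw by simp
      next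
        case False
        define r where "r = w n / u n"
        have wr: "w n = u n * r" using un by (simp add: r_def)
        \<comment> \<open>The excess ratio \<open>r = w / u\<close> is separated from the
          oscillation by the arithmetic-geometric mean inequality: \<open>u * r\<^sup>2\<close> is
          \<open>R\<close>, and the other square carries the smaller weight
          \<open>u\<close>.\<close>
        have "2 * (r * \<epsilon> powr p) \<le> r\<^sup>2 + (\<epsilon> powr p)\<^sup>2"
          using sum_squares_bound[of r "\<epsilon> powr p"] by simp
        moreover have "0 \<le> r * \<epsilon> powr p" using w0[of n] un by (simp add: r_def)
        moreover have "(\<epsilon> powr p)\<^sup>2 = \<epsilon> powr (2 * p)" by (simp add: power2_eq_square powr_double)
        ultimately have "r * \<epsilon> powr p \<le> r\<^sup>2 + \<epsilon> powr (2 * p)" by linarith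
        then have "w n * \<epsilon> powr p \<le> u n * (r\<^sup>2 + \<epsilon> powr (2 * p))"
          unfolding wr mult.assoc using un by (intro mult_left_mono) auto
        also have "\<dots> = R n + u n * \<epsilon> powr (2 * p)"
          using un unfolding r_def R_def wn powr_double[of "norm (\<Delta> n)"] by (simp add: power2_eq_square field_simps)
        also have "\<dots> \<le> R n + B * B * (P n + P' n)" using min[of "u n"] False un by simp
        finally show ?thesis using un Dw by simp
      qed
    qed
    have mD: "modular p D \<le> KD * W"
    proof -
      have "modular p D = (\<Sum>n\<in>S. norm (D n) powr p)" by (rule modular_finite[OF S DS])
      also have "\<dots> \<le> (\<Sum>n\<in>S. u n + B * B * (P n + P' n) + R n)" by (intro sum_mono Dn)
      also have "\<dots> = sum u S + B * B * (sum P S + sum P' S) + sum R S"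
        by (simp add: sum.distrib flip: sum_distrib_left)
      also have "\<dots> \<le> W + B * B * (K * ((K\<Delta> + 1) * W) + K * ((K\<Delta> + 1) * W)) + KR * W"
        using sumu sumP sumP' sumR BT by (intro add_mono mult_left_mono) auto
      also have "\<dots> = KD * W" by (simp add: KD_def algebra_simps)
      finally show ?thesis .
    qed
    define N where "N n = \<Omega> \<Delta> n - \<Phi> \<Delta> n" for n
    have N: "summable (\<lambda>n. norm (N n) powr p)" "modular p N \<le> K1 * (K\<Delta> * W)"
      using near[OF \<Delta>lp0] mult_left_mono[OF m\<Delta> K1] by (auto simp: N_def[abs_def])
    have sE: "summable (\<lambda>n. norm (E n) powr p)" by (rule summable_finite_support[OF S ES])
    have sD: "summable (\<lambda>n. norm (D n) powr p)" by (rule summable_finite_support[OF S DS])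
    have split: "(\<lambda>n. H z n - H x n - H y n - \<Phi> \<Delta> n) = (\<lambda>n. E n + (D n + N n))"
    proof
      fix n
      have "H z n - H x n - H y n = E n + \<Delta> n * \<sigma> n"
        by (simp add: H_def E_def \<Delta> e_def z_def power2_eq_square field_simps)
      then show "H z n - H x n - H y n - \<Phi> \<Delta> n = E n + (D n + N n)"
        by (simp add: D_def N_def \<Omega>_def algebra_simps)
    qed
    have "modular p (\<lambda>n. D n + N n) \<le> B * (KD * W + K1 * (K\<Delta> * W))"
    proof -
      have "B * (modular p D + modular p N) \<le> B * (KD * W + K1 * (K\<Delta> * W))"
        using mD N(2) BT by (intro mult_left_mono add_mono) auto
      then show ?thesis using modular_add_le[OF sD N(1) p] unfolding B_def by linarith
    qed
    then have "B * (modular p E + modular p (\<lambda>n. D n + N n)) \<le> B * (KE * W + B * (KD * W + K1 * (K\<Delta> * W)))"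
      using mE BT by (intro mult_left_mono add_mono) auto
    then have "modular p (\<lambda>n. E n + (D n + N n)) \<le> B * (KE * W + B * (KD * W + K1 * (K\<Delta> * W)))"
      using modular_add_le[OF sE summable_norm_powr_add[OF sD N(1) p] p] unfolding B_def by linarith
    then show ?thesis using m\<Delta> split unfolding \<Delta>_def z_def by simp
  qed
  have pos: "0 \<le> K\<Delta>" "0 \<le> KE" "0 \<le> KD" 
    using K BT by (auto simp: K\<Delta>_def KE_def KD_def KR_def intro!: add_nonneg_nonneg mult_nonneg_nonneg)
  define L where "L = K1 + K\<Delta> * B + B * (KE * B + B * (KD * B + K1 * (K\<Delta> * B)))"
  show ?thesis
  proof (rule exI[of _ \<Omega>], rule exI[of _ H], rule exI[of _ L], intro conjI ballI allI)
    have L1: "K1 \<le> L" "K\<Delta> * B \<le> L" "B * (KE * B + B * (KD * B + K1 * (K\<Delta> * B))) \<le> L" "0 \<le> L"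
      unfolding L_def using pos BT K1 by (auto intro!: add_nonneg_nonneg mult_nonneg_nonneg)
    then show "0 \<le> L" by simp
    fix x :: "nat \<Rightarrow> 'k" assume x: "x \<in> lp0"
    have mx: "0 \<le> modular p x" using lp0_subset_lp[OF x, of p] by (simp add: carrier_lp_iff modular_nonneg)
    show "modular p (\<lambda>n. \<Omega> x n - \<Phi> x n) \<le> L * modular p x"
      using near[OF x] mult_right_mono[OF L1(1) mx] by linarith
    fix y :: "nat \<Rightarrow> 'k" assume y: "y \<in> lp0"
    have my: "0 \<le> modular p y" using lp0_subset_lp[OF y, of p] by (simp add: carrier_lp_iff modular_nonneg)
    define m where "m = modular p x + modular p y"
    have m: "0 \<le> m" using mx my by (simp add: m_def)
    have "K\<Delta> * (B * m) \<le> L * m" using mult_right_mono[OF L1(2) m] by (simp add: mult.assoc)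
    moreover have "B * (KE * (B * m) + B * (KD * (B * m) + K1 * (K\<Delta> * (B * m)))) \<le> L * m"
      using mult_right_mono[OF L1(3) m] by (simp add: algebra_simps)
    ultimately show "let \<Delta> = (\<lambda>n. \<Omega> (\<lambda>k. x k + y k) n - \<Omega> x n - \<Omega> y n) in
       modular p \<Delta> \<le> L * (modular p x + modular p y) \<and>
       modular p (\<lambda>n. H (\<lambda>k. x k + y k) n - H x n - H y n - \<Phi> \<Delta> n) \<le> L * (modular p x + modular p y)"
      using est[OF x y refl] unfolding Let_def m_def by linarith
  qed (use hom lp0 in auto)
qed

section \<open>Quasinormed spaces and their completions\<close>

lemma cring_scalars: "cring (scalars :: 'k::real_normed_field ring)"
proof (rule cringI)
  show "abelian_group (scalars :: 'k ring)"
  proof (rule abelian_groupI)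
    fix x :: 'k
    show "\<exists>y\<in>carrier scalars. y \<oplus>\<^bsub>scalars\<^esub> x = \<zero>\<^bsub>scalars\<^esub>"
      by (rule bexI[of _ "- x"]) (auto simp: scalars_def)
  qed (auto simp: scalars_def)
  show "comm_monoid (scalars :: 'k ring)"
    by (rule comm_monoidI) (auto simp: scalars_def)
qed (auto simp: scalars_def algebra_simps)

text \<open>Negatives are not part of the data. Since \<open>(- 1) \<odot> x\<close> serves as the
  inverse, the group axioms reduce to closure and one identity.\<close>

lemma quasinormedI:
  fixes V (structure)
  assumes add: "\<And>x y. \<lbrakk>x \<in> carrier V; y \<in> carrier V\<rbrakk> \<Longrightarrow> x \<oplus> y \<in> carrier V"
    and zero: "\<zero> \<in> carrier V"
    and smult: "\<And>c x. x \<in> carrier V \<Longrightarrow> c \<odot> x \<in> carrier V"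
    and assoc: "\<And>x y z. \<lbrakk>x \<in> carrier V; y \<in> carrier V; z \<in> carrier V\<rbrakk> \<Longrightarrow> (x \<oplus> y) \<oplus> z = x \<oplus> (y \<oplus> z)"
    and comm: "\<And>x y. \<lbrakk>x \<in> carrier V; y \<in> carrier V\<rbrakk> \<Longrightarrow> x \<oplus> y = y \<oplus> x"
    and lzero: "\<And>x. x \<in> carrier V \<Longrightarrow> \<zero> \<oplus> x = x"
    and inverse: "\<And>x. x \<in> carrier V \<Longrightarrow> (- 1) \<odot> x \<oplus> x = \<zero>"
    and ldistr: "\<And>a b x. x \<in> carrier V \<Longrightarrow> (a + b) \<odot> x = a \<odot> x \<oplus> b \<odot> x"
    and rdistr: "\<And>a x y. \<lbrakk>x \<in> carrier V; y \<in> carrier V\<rbrakk> \<Longrightarrow> a \<odot> (x \<oplus> y) = a \<odot> x \<oplus> a \<odot> y"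
    and massoc: "\<And>a b x. x \<in> carrier V \<Longrightarrow> (a * b) \<odot> x = a \<odot> (b \<odot> x)"
    and one: "\<And>x. x \<in> carrier V \<Longrightarrow> 1 \<odot> x = x"
    and norm: "\<And>x. x \<in> carrier V \<Longrightarrow> 0 \<le> qnorm V x"
      "\<And>c x. x \<in> carrier V \<Longrightarrow> qnorm V (c \<odot> x) = norm c * qnorm V x"
      "\<And>x. x \<in> carrier V \<Longrightarrow> qnorm V x = 0 \<Longrightarrow> x = \<zero>"
      "qnorm V \<zero> = 0"
      "\<And>x y. \<lbrakk>x \<in> carrier V; y \<in> carrier V\<rbrakk> \<Longrightarrow> qnorm V (x \<oplus> y) \<le> C * (qnorm V x + qnorm V y)"
  shows "quasinormed (V :: ('k::real_normed_field, 'a) qspace)"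
proof -
  have "abelian_group V"
  proof (rule abelian_groupI)
    fix x assume "x \<in> carrier V"
    then show "\<exists>y\<in>carrier V. y \<oplus> x = \<zero>" using smult inverse by blast
  qed (fact add zero assoc comm lzero)+
  then have "Module.module scalars V"
    by (intro moduleI cring_scalars) (simp_all add: scalars_def smult ldistr rdistr massoc one)
  then show ?thesis unfolding quasinormed_def using norm by blast
qed

lemma null_sequence_le:
  fixes f g :: "nat \<Rightarrow> real"
  assumes "f \<longlonglongrightarrow> 0" "\<And>n. 0 \<le> g n" "\<And>n. g n \<le> C * f n"
  shows "g \<longlonglongrightarrow> 0"
proof (rule tendsto_sandwich[where f = "\<lambda>_. 0" and h = "\<lambda>n. C * f n"])
  show "(\<lambda>n. C * f n) \<longlonglongrightarrow> 0" using tendsto_mult_right_zero[OF assms(1)] .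
  show "\<forall>\<^sub>F n in sequentially. 0 \<le> g n" "\<forall>\<^sub>F n in sequentially. g n \<le> C * f n"
    by (rule always_eventually, rule allI, rule assms)+
qed (rule tendsto_const)

section \<open>Arithmetic in quasinormed spaces and the modulus of concavity\<close>

definition qmodulus :: "('k, 'a) qspace \<Rightarrow> real" where
  "qmodulus V = (SOME C. 1 \<le> C \<and>
     (\<forall>x\<in>carrier V. \<forall>y\<in>carrier V. qnorm V (x \<oplus>\<^bsub>V\<^esub> y) \<le> C * (qnorm V x + qnorm V y)))"

locale qnormed = fixes V :: "('k::real_normed_field, 'a) qspace" (structure)
  assumes quasinormed: "quasinormed V"

sublocale qnormed \<subseteq> abelian_group V
  using quasinormed unfolding quasinormed_def by (blast dest: module.axioms(2))

context qnormed
begin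

lemma module_scalars: "Module.module scalars V"
  using quasinormed by (simp add: quasinormed_def)

lemma smult_closed [simp, intro]: "x \<in> carrier V \<Longrightarrow> c \<odot> x \<in> carrier V"
  using module.smult_closed[OF module_scalars] by (simp add: scalars_def)

lemma smult_ldistr: "x \<in> carrier V \<Longrightarrow> (a + b) \<odot> x = a \<odot> x \<oplus> b \<odot> x"
  using module.smult_l_distr[OF module_scalars, of a b x] by (simp add: scalars_def)

lemma smult_rdistr: "x \<in> carrier V \<Longrightarrow> y \<in> carrier V \<Longrightarrow> c \<odot> (x \<oplus> y) = c \<odot> x \<oplus> c \<odot> y"
  using module.smult_r_distr[OF module_scalars, of c x y] by (simp add: scalars_def)

lemma smult_assoc: "x \<in> carrier V \<Longrightarrow> (a * b) \<odot> x = a \<odot> (b \<odot> x)"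
  using module.smult_assoc1[OF module_scalars, of a b x] by (simp add: scalars_def)

lemma smult_one [simp]: "x \<in> carrier V \<Longrightarrow> 1 \<odot> x = x"
  using module.smult_one[OF module_scalars, of x] by (simp add: scalars_def)

lemma smult_lnull [simp]: "x \<in> carrier V \<Longrightarrow> 0 \<odot> x = \<zero>"
  using module.smult_l_null[OF module_scalars, of x] by (simp add: scalars_def)

lemma uminus_alt: "x \<in> carrier V \<Longrightarrow> \<ominus> x = (- 1) \<odot> x"
  using smult_ldistr[of x "- 1" 1] by (intro minus_equality) auto

lemma minus_alt: "x \<in> carrier V \<Longrightarrow> y \<in> carrier V \<Longrightarrow> x \<ominus> y = x \<oplus> (- 1) \<odot> y"
  by (simp add: minus_eq uminus_alt)

lemma qnorm_nonneg [simp]: "x \<in> carrier V \<Longrightarrow> 0 \<le> qnorm V x"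
  using quasinormed by (simp add: quasinormed_def)

lemma qnorm_smult: "x \<in> carrier V \<Longrightarrow> qnorm V (c \<odot> x) = norm c * qnorm V x"
  using quasinormed by (simp add: quasinormed_def)

lemma qnorm_eq_0: "x \<in> carrier V \<Longrightarrow> qnorm V x = 0 \<longleftrightarrow> x = \<zero>"
  using quasinormed by (simp add: quasinormed_def)

lemma qnorm_zero [simp]: "qnorm V \<zero> = 0"
  by (simp add: qnorm_eq_0)

abbreviation "K \<equiv> qmodulus V"

lemma qmodulus: "1 \<le> K \<and> (\<forall>x\<in>carrier V. \<forall>y\<in>carrier V. qnorm V (x \<oplus> y) \<le> K * (qnorm V x + qnorm V y))"
proof -
  obtain C where C: "\<And>x y. x \<in> carrier V \<Longrightarrow> y \<in> carrier V \<Longrightarrow> qnorm V (x \<oplus> y) \<le> C * (qnorm V x + qnorm V y)"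
    using quasinormed unfolding quasinormed_def by blast
  have "qnorm V (x \<oplus> y) \<le> max 1 C * (qnorm V x + qnorm V y)" if "x \<in> carrier V" "y \<in> carrier V" for x y
    using that by (intro order_trans[OF C mult_right_mono]) auto
  then have "\<exists>C. 1 \<le> C \<and> (\<forall>x\<in>carrier V. \<forall>y\<in>carrier V. qnorm V (x \<oplus> y) \<le> C * (qnorm V x + qnorm V y))"
    by (intro exI[of _ "max 1 C"]) auto
  then show ?thesis unfolding qmodulus_def by (rule someI_ex)
qed

lemma K_ge_1: "1 \<le> K" and K_pos: "0 < K" and K_nonneg: "0 \<le> K"
  using qmodulus by auto

lemma qnorm_add: "x \<in> carrier V \<Longrightarrow> y \<in> carrier V \<Longrightarrow> qnorm V (x \<oplus> y) \<le> K * (qnorm V x + qnorm V y)"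
  using qmodulus by blast

lemma minus_self [simp]: "x \<in> carrier V \<Longrightarrow> x \<ominus> x = \<zero>"
  by (simp add: minus_eq r_neg)

lemma minus_zero_right [simp]: "x \<in> carrier V \<Longrightarrow> x \<ominus> \<zero> = x"
  by (simp add: minus_eq)

lemma qnorm_uminus: "x \<in> carrier V \<Longrightarrow> qnorm V (\<ominus> x) = qnorm V x"
  by (simp add: uminus_alt qnorm_smult)

lemma qnorm_minus_commute: "x \<in> carrier V \<Longrightarrow> y \<in> carrier V \<Longrightarrow> qnorm V (x \<ominus> y) = qnorm V (y \<ominus> x)"
  using qnorm_uminus[of "x \<ominus> y"] by (simp add: minus_eq minus_add minus_minus a_comm)

lemma minus_add_minus:
  assumes "x \<in> carrier V" "y \<in> carrier V" "z \<in> carrier V"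
  shows "x \<ominus> z = (x \<ominus> y) \<oplus> (y \<ominus> z)"
  using assms by (simp add: minus_eq a_assoc r_neg1)

lemma add_minus_add:
  assumes "x \<in> carrier V" "y \<in> carrier V" "x' \<in> carrier V" "y' \<in> carrier V"
  shows "(x \<oplus> y) \<ominus> (x' \<oplus> y') = (x \<ominus> x') \<oplus> (y \<ominus> y')"
  using assms by (simp add: minus_eq minus_add a_ac)

lemma smult_minus: "x \<in> carrier V \<Longrightarrow> y \<in> carrier V \<Longrightarrow> c \<odot> (x \<ominus> y) = c \<odot> x \<ominus> c \<odot> y"
  by (simp add: minus_alt smult_rdistr flip: smult_assoc)

lemma add_minus_cancel: "x \<in> carrier V \<Longrightarrow> y \<in> carrier V \<Longrightarrow> y \<oplus> (x \<ominus> y) = x"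
  by (simp add: minus_eq a_lcomm r_neg)

lemma eq_if_minus_zero: "x \<in> carrier V \<Longrightarrow> y \<in> carrier V \<Longrightarrow> x \<ominus> y = \<zero> \<Longrightarrow> x = y"
  using add_minus_cancel[of x y] by simp

lemma qdist_triangle:
  assumes "x \<in> carrier V" "y \<in> carrier V" "z \<in> carrier V"
  shows "qnorm V (x \<ominus> z) \<le> K * (qnorm V (x \<ominus> y) + qnorm V (y \<ominus> z))"
  using assms minus_add_minus[OF assms] qnorm_add[of "x \<ominus> y" "y \<ominus> z"] by simp

lemma qdist_add:
  assumes "x \<in> carrier V" "y \<in> carrier V" "x' \<in> carrier V" "y' \<in> carrier V"
  shows "qnorm V ((x \<oplus> y) \<ominus> (x' \<oplus> y')) \<le> K * (qnorm V (x \<ominus> x') + qnorm V (y \<ominus> y'))"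
  using assms add_minus_add[OF assms] qnorm_add[of "x \<ominus> x'" "y \<ominus> y'"] by simp

lemma qdist_smult: "x \<in> carrier V \<Longrightarrow> y \<in> carrier V \<Longrightarrow> qnorm V (c \<odot> x \<ominus> c \<odot> y) = norm c * qnorm V (x \<ominus> y)"
  by (simp add: qnorm_smult flip: smult_minus)

lemma qnorm_le_qdist: "x \<in> carrier V \<Longrightarrow> y \<in> carrier V \<Longrightarrow> qnorm V x \<le> K * (qnorm V (x \<ominus> y) + qnorm V y)"
  using qdist_triangle[of x y \<zero>] by simp

section \<open>Cauchy sequences and their classes\<close>

lemma qcauchyD: "qcauchy V s \<Longrightarrow> s n \<in> carrier V"
  by (simp add: qcauchy_def)

lemma qconverges_unique:
  assumes "\<And>n. s n \<in> carrier V" "qconverges V s x" "qconverges V s y"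
  shows "x = y"
proof -
  have x: "x \<in> carrier V" and y: "y \<in> carrier V" using assms by (auto simp: qconverges_def)
  have "(\<lambda>n. qnorm V (s n \<ominus> x) + qnorm V (s n \<ominus> y)) \<longlonglongrightarrow> 0"
    using assms tendsto_add[of _ 0 _ _ 0] by (fastforce simp: qconverges_def)
  then have "(\<lambda>n. qnorm V (x \<ominus> y)) \<longlonglongrightarrow> 0"
  proof (rule null_sequence_le)
    show "qnorm V (x \<ominus> y) \<le> K * (qnorm V (s n \<ominus> x) + qnorm V (s n \<ominus> y))" for n
      using qdist_triangle[of x "s n" y] qnorm_minus_commute[of x "s n"] x y assms by simp
  qed (use x y in auto)
  then have "qnorm V (x \<ominus> y) = 0" by (simp add: LIMSEQ_const_iff)
  then have "x \<ominus> y = \<zero>" using x y by (simp add: qnorm_eq_0)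
  with x y show ?thesis by (rule eq_if_minus_zero)
qed

lemma same_limit_refl: "(\<And>n. s n \<in> carrier V) \<Longrightarrow> same_limit V s s"
  by (simp add: same_limit_def)

lemma same_limit_sym:
  "(\<And>n. s n \<in> carrier V) \<Longrightarrow> (\<And>n. t n \<in> carrier V) \<Longrightarrow> same_limit V s t \<Longrightarrow> same_limit V t s"
  by (simp add: same_limit_def qnorm_minus_commute[of "s _"])

lemma same_limit_trans:
  assumes "\<And>n. s n \<in> carrier V" "\<And>n. t n \<in> carrier V" "\<And>n. u n \<in> carrier V"
    "same_limit V s t" "same_limit V t u"
  shows "same_limit V s u"
proof -
  have "(\<lambda>n. qnorm V (s n \<ominus> t n) + qnorm V (t n \<ominus> u n)) \<longlonglongrightarrow> 0"
    using assms tendsto_add[of _ 0 _ _ 0] by (fastforce simp: same_limit_def)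
  then show ?thesis unfolding same_limit_def
    by (rule null_sequence_le[where C = K]) (use assms qdist_triangle in auto)
qed

lemma same_limit_add:
  assumes "\<And>n. s n \<in> carrier V" "\<And>n. t n \<in> carrier V" "\<And>n. s' n \<in> carrier V" "\<And>n. t' n \<in> carrier V"
    "same_limit V s s'" "same_limit V t t'"
  shows "same_limit V (\<lambda>n. s n \<oplus> t n) (\<lambda>n. s' n \<oplus> t' n)"
proof -
  have "(\<lambda>n. qnorm V (s n \<ominus> s' n) + qnorm V (t n \<ominus> t' n)) \<longlonglongrightarrow> 0"
    using assms tendsto_add[of _ 0 _ _ 0] by (fastforce simp: same_limit_def)
  then show ?thesis unfolding same_limit_def
    by (rule null_sequence_le[where C = K]) (use assms qdist_add in auto)
qed

lemma same_limit_smult: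
  assumes "\<And>n. s n \<in> carrier V" "\<And>n. s' n \<in> carrier V" "same_limit V s s'"
  shows "same_limit V (\<lambda>n. c \<odot> s n) (\<lambda>n. c \<odot> s' n)"
  using assms(3) unfolding same_limit_def
  by (rule null_sequence_le[where C = "norm c"]) (use assms in \<open>auto simp: qdist_smult\<close>)

lemma qcauchy_le:
  assumes "qcauchy V s" "qcauchy V t" "\<And>n. u n \<in> carrier V" "0 \<le> C"
    "\<And>m n. qnorm V (u m \<ominus> u n) \<le> C * (qnorm V (s m \<ominus> s n) + qnorm V (t m \<ominus> t n))"
  shows "qcauchy V u"
  unfolding qcauchy_def
proof (intro conjI allI impI)
  fix e :: real assume e: "0 < e"
  define d where "d = e / (2 * (C + 1))"
  have d: "0 < d" using e assms(4) by (simp add: d_def)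
  obtain N1 where N1: "\<And>m n. m \<ge> N1 \<Longrightarrow> n \<ge> N1 \<Longrightarrow> qnorm V (s m \<ominus> s n) < d"
    using assms(1) d unfolding qcauchy_def by blast
  obtain N2 where N2: "\<And>m n. m \<ge> N2 \<Longrightarrow> n \<ge> N2 \<Longrightarrow> qnorm V (t m \<ominus> t n) < d"
    using assms(2) d unfolding qcauchy_def by blast
  have "qnorm V (u m \<ominus> u n) < e" if "m \<ge> max N1 N2" "n \<ge> max N1 N2" for m n
  proof -
    have "qnorm V (u m \<ominus> u n) \<le> C * (qnorm V (s m \<ominus> s n) + qnorm V (t m \<ominus> t n))" by (rule assms)
    also have "\<dots> \<le> C * (d + d)" using N1[of m n] N2[of m n] that assms(4) by (intro mult_left_mono) auto
    also have "\<dots> < (C + 1) * (d + d)" using d by (intro mult_strict_right_mono) auto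
    also have "\<dots> = d * (2 * (C + 1))" by (simp add: algebra_simps)
    also have "\<dots> = e" using assms(4) by (simp add: d_def)
    finally show ?thesis .
  qed
  then show "\<exists>N. \<forall>m\<ge>N. \<forall>n\<ge>N. qnorm V (u m \<ominus> u n) < e" by blast
qed (rule assms)

lemma qcauchy_add: "qcauchy V s \<Longrightarrow> qcauchy V t \<Longrightarrow> qcauchy V (\<lambda>n. s n \<oplus> t n)"
  by (rule qcauchy_le[where C = K and s = s and t = t]) (auto simp: qcauchyD K_nonneg intro: qdist_add)

lemma qcauchy_smult: "qcauchy V s \<Longrightarrow> qcauchy V (\<lambda>n. c \<odot> s n)"
  by (rule qcauchy_le[where C = "norm c" and s = s and t = s])
     (auto simp: qcauchyD qdist_smult intro!: mult_left_mono)

lemma qcauchy_const: "x \<in> carrier V \<Longrightarrow> qcauchy V (\<lambda>_. x)"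
  by (auto simp: qcauchy_def)

lemma same_limit_shift: "qcauchy V s \<Longrightarrow> same_limit V s (\<lambda>n. s (n + N))"
  unfolding same_limit_def
proof (rule LIMSEQ_I)
  fix e :: real assume s: "qcauchy V s" and e: "0 < e"
  then obtain M where M: "\<And>m n. m \<ge> M \<Longrightarrow> n \<ge> M \<Longrightarrow> qnorm V (s m \<ominus> s n) < e" unfolding qcauchy_def by blast
  then show "\<exists>no. \<forall>n\<ge>no. norm (qnorm V (s n \<ominus> s (n + N)) - 0) < e"
    using s by (intro exI[of _ M]) (auto simp: qcauchyD)
qed

lemma qcauchy_shift: "qcauchy V s \<Longrightarrow> qcauchy V (\<lambda>n. s (n + N))"
  unfolding qcauchy_def by (meson trans_le_add1)

lemma class_rep: 
  assumes "qcauchy V s"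
  shows "qcauchy V (class_rep V s)" "same_limit V s (class_rep V s)"
proof -
  have "qcauchy V (class_rep V s) \<and> same_limit V s (class_rep V s)"
    unfolding class_rep_def by (rule someI[of _ s]) (use assms in \<open>auto simp: same_limit_refl qcauchyD\<close>)
  then show "qcauchy V (class_rep V s)" "same_limit V s (class_rep V s)" by auto
qed

lemma class_rep_same: "qcauchy V s \<Longrightarrow> same_limit V (class_rep V s) s"
  using class_rep[of s] by (intro same_limit_sym[of s]) (auto simp: qcauchyD)

lemma class_rep_eq_iff:
  assumes "qcauchy V s" "qcauchy V t"
  shows "class_rep V s = class_rep V t \<longleftrightarrow> same_limit V s t"
proof
  assume "class_rep V s = class_rep V t"
  then show "same_limit V s t"
    using class_rep[OF assms(1)] class_rep[OF assms(2)] same_limit_trans same_limit_sym qcauchyD assms by metis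
next
  assume st: "same_limit V s t"
  \<comment> \<open>The two choices are made from the same set, hence are the same sequence and not
    only equivalent ones.\<close>
  have "(qcauchy V u \<and> same_limit V s u) = (qcauchy V u \<and> same_limit V t u)" for u
    using st same_limit_trans same_limit_sym qcauchyD assms by metis
  then show "class_rep V s = class_rep V t" unfolding class_rep_def by simp
qed

lemma class_rep_class_rep [simp]: "qcauchy V s \<Longrightarrow> class_rep V (class_rep V s) = class_rep V s"
  using class_rep[of s] class_rep_eq_iff[of s "class_rep V s"] by simp

lemma carrier_completion: "S \<in> carrier (completion V) \<longleftrightarrow> qcauchy V S \<and> class_rep V S = S"
proof
  assume "qcauchy V S \<and> class_rep V S = S"
  then have "S \<in> class_rep V ` {s. qcauchy V s}" by (metis imageI mem_Collect_eq)
  then show "S \<in> carrier (completion V)" by (simp add: completion_def)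
qed (auto simp: completion_def class_rep)

lemma class_rep_closed [simp, intro]: "qcauchy V s \<Longrightarrow> class_rep V s \<in> carrier (completion V)"
  by (simp add: completion_def)

lemma completion_add:
  assumes "qcauchy V s" "qcauchy V t"
  shows "class_rep V s \<oplus>\<^bsub>completion V\<^esub> class_rep V t = class_rep V (\<lambda>n. s n \<oplus> t n)"
proof -
  have "class_rep V (\<lambda>n. class_rep V s n \<oplus> class_rep V t n) = class_rep V (\<lambda>n. s n \<oplus> t n)"
    using assms class_rep[OF assms(1)] class_rep[OF assms(2)] class_rep_same[OF assms(1)] class_rep_same[OF assms(2)]
    by (subst class_rep_eq_iff) (auto intro!: qcauchy_add same_limit_add simp: qcauchyD)
  then show ?thesis by (simp add: completion_def)
qed

lemma completion_smult:
  assumes "qcauchy V s"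
  shows "c \<odot>\<^bsub>completion V\<^esub> class_rep V s = class_rep V (\<lambda>n. c \<odot> s n)"
proof -
  have "class_rep V (\<lambda>n. c \<odot> class_rep V s n) = class_rep V (\<lambda>n. c \<odot> s n)"
    using assms class_rep[OF assms(1)] class_rep_same[OF assms(1)]
    by (subst class_rep_eq_iff) (auto intro!: qcauchy_smult same_limit_smult simp: qcauchyD)
  then show ?thesis by (simp add: completion_def)
qed

lemma completion_zero: "\<zero>\<^bsub>completion V\<^esub> = class_rep V (\<lambda>_. \<zero>)"
  by (simp add: completion_def)

lemma completion_cases:
  assumes "S \<in> carrier (completion V)"
  obtains s where "qcauchy V s" "S = class_rep V s"
  using assms carrier_completion by metis

section \<open>The quasinorm of the completion\<close>

abbreviation "cnorm s \<equiv> qnorm (completion V) (class_rep V s)"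

lemma cnorm_eq:
  assumes "qcauchy V s"
  shows "cnorm s = Inf {r. \<exists>t. qcauchy V t \<and> same_limit V s t \<and> (\<forall>n. qnorm V (t n) \<le> r)}"
proof -
  have "(qcauchy V t \<and> same_limit V (class_rep V s) t \<and> (\<forall>n. qnorm V (t n) \<le> r))
    = (qcauchy V t \<and> same_limit V s t \<and> (\<forall>n. qnorm V (t n) \<le> r))" for t r
    using assms class_rep[OF assms] same_limit_trans same_limit_sym qcauchyD by metis
  then show ?thesis by (simp add: completion_def)
qed

lemma ball_bounds:
  "qcauchy V t \<and> same_limit V s t \<and> (\<forall>n. qnorm V (t n) \<le> r) \<Longrightarrow> 0 \<le> r"
  using qnorm_nonneg qcauchyD order_trans by metis

text \<open>Dropping an initial segment stays in the class and leaves a sequence within distance 1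
  of a fixed term. So the infimum defining the quasinorm is taken over a nonempty set.\<close>

lemma ball_nonempty:
  assumes "qcauchy V s"
  shows "\<exists>r t. qcauchy V t \<and> same_limit V s t \<and> (\<forall>n. qnorm V (t n) \<le> r)"
proof -
  obtain N where N: "\<And>m n. m \<ge> N \<Longrightarrow> n \<ge> N \<Longrightarrow> qnorm V (s m \<ominus> s n) < 1"
    using assms unfolding qcauchy_def using zero_less_one by blast
  have "qnorm V (s (n + N)) \<le> K * (1 + qnorm V (s N))" for n
  proof -
    have "qnorm V (s (n + N)) \<le> K * (qnorm V (s (n + N) \<ominus> s N) + qnorm V (s N))"
      using assms by (intro qnorm_le_qdist) (auto simp: qcauchyD)
    also have "\<dots> \<le> K * (1 + qnorm V (s N))"
      using N[of "n + N" N] K_nonneg by (intro mult_left_mono) auto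
    finally show ?thesis .
  qed
  then show ?thesis using qcauchy_shift[OF assms, of N] same_limit_shift[OF assms, of N] by blast
qed

lemma cnorm_nonneg: "qcauchy V s \<Longrightarrow> 0 \<le> cnorm s"
  unfolding cnorm_eq using ball_nonempty ball_bounds by (intro cInf_greatest) blast+

lemma cnorm_le:
  assumes "qcauchy V s" "qcauchy V t" "same_limit V s t" "\<And>n. qnorm V (t n) \<le> r"
  shows "cnorm s \<le> r"
  unfolding cnorm_eq[OF assms(1)]
  by (rule cInf_lower) (use assms ball_bounds in \<open>auto intro!: bdd_belowI[of _ 0]\<close>)

lemma cnorm_less:
  assumes "qcauchy V s" "cnorm s < r"
  obtains t where "qcauchy V t" "same_limit V s t" "\<And>n. qnorm V (t n) \<le> r"
proof -
  define A where "A = {r. \<exists>t. qcauchy V t \<and> same_limit V s t \<and> (\<forall>n. qnorm V (t n) \<le> r)}"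
  have "A \<noteq> {}" using ball_nonempty[OF assms(1)] by (auto simp: A_def)
  moreover have "bdd_below A" using ball_bounds by (auto simp: A_def intro!: bdd_belowI[of _ 0])
  moreover have "Inf A < r" using assms cnorm_eq by (simp add: A_def)
  ultimately obtain x where "x \<in> A" "x < r" using cInf_less_iff by blast
  then show ?thesis using that unfolding A_def by (smt (verit) mem_Collect_eq)
qed

lemma cnorm_const_le: "x \<in> carrier V \<Longrightarrow> cnorm (\<lambda>_. x) \<le> qnorm V x"
  by (rule cnorm_le[where t = "\<lambda>_. x"]) (auto simp: qcauchy_const same_limit_refl)

lemma cnorm_le_eventually:
  assumes "qcauchy V s" "\<And>n. n \<ge> N \<Longrightarrow> qnorm V (s n) \<le> r"
  shows "cnorm s \<le> r"
  using assms by (intro cnorm_le[OF _ qcauchy_shift[where N = N] same_limit_shift]) auto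

lemma cnorm_smult_le:
  assumes "qcauchy V s"
  shows "cnorm (\<lambda>n. c \<odot> s n) \<le> norm c * cnorm s"
proof (rule field_le_epsilon)
  fix e :: real assume e: "0 < e"
  define d where "d = e / (norm c + 1)"
  have d: "0 < d" using e by (simp add: d_def add_nonneg_pos)
  obtain t where t: "qcauchy V t" "same_limit V s t" "\<And>n. qnorm V (t n) \<le> cnorm s + d"
    using cnorm_less[OF assms, of "cnorm s + d"] d by auto
  have "cnorm (\<lambda>n. c \<odot> s n) \<le> norm c * (cnorm s + d)"
    using assms t
    by (intro cnorm_le[where t = "\<lambda>n. c \<odot> t n"])
       (auto intro!: qcauchy_smult same_limit_smult mult_left_mono simp: qcauchyD qnorm_smult)
  also have "\<dots> \<le> norm c * cnorm s + e"
  proof -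
    have "norm c * d \<le> (norm c + 1) * d" using d by (intro mult_right_mono) auto
    also have "\<dots> = e"
    proof -
      have "norm c + 1 \<noteq> 0" using norm_ge_zero[of c] by linarith
      then show ?thesis by (simp add: d_def)
    qed
    finally show ?thesis by (simp add: distrib_left)
  qed
  finally show "cnorm (\<lambda>n. c \<odot> s n) \<le> norm c * cnorm s + e" .
qed

lemma cnorm_smult:
  assumes "qcauchy V s"
  shows "cnorm (\<lambda>n. c \<odot> s n) = norm c * cnorm s"
proof (cases "c = 0")
  case True
  then show ?thesis
    using cnorm_smult_le[OF assms, of c] cnorm_nonneg[OF qcauchy_smult[OF assms, of c]] by simp
next
  case False
  have "(\<lambda>n. inverse c \<odot> (c \<odot> s n)) = s"
    using False assms by (auto simp: qcauchyD simp flip: smult_assoc)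
  then have "cnorm s \<le> norm (inverse c) * cnorm (\<lambda>n. c \<odot> s n)"
    using cnorm_smult_le[OF qcauchy_smult[OF assms, of c], of "inverse c"] by simp
  then have "norm c * cnorm s \<le> norm c * (norm (inverse c) * cnorm (\<lambda>n. c \<odot> s n))"
    by (intro mult_left_mono) auto
  also have "\<dots> = norm (c * inverse c) * cnorm (\<lambda>n. c \<odot> s n)" by (simp only: norm_mult mult.assoc)
  finally have "norm c * cnorm s \<le> cnorm (\<lambda>n. c \<odot> s n)" using False by simp
  then show ?thesis using cnorm_smult_le[OF assms, of c] by simp
qed

lemma cnorm_add:
  assumes "qcauchy V s" "qcauchy V t"
  shows "cnorm (\<lambda>n. s n \<oplus> t n) \<le> K * (cnorm s + cnorm t)"
proof (rule field_le_epsilon)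
  fix e :: real assume e: "0 < e"
  define d where "d = e / (2 * K)"
  have d: "0 < d" using e K_pos by (simp add: d_def)
  obtain s' where s': "qcauchy V s'" "same_limit V s s'" "\<And>n. qnorm V (s' n) \<le> cnorm s + d"
    using cnorm_less[OF assms(1), of "cnorm s + d"] d by auto
  obtain t' where t': "qcauchy V t'" "same_limit V t t'" "\<And>n. qnorm V (t' n) \<le> cnorm t + d"
    using cnorm_less[OF assms(2), of "cnorm t + d"] d by auto
  have "cnorm (\<lambda>n. s n \<oplus> t n) \<le> K * ((cnorm s + d) + (cnorm t + d))"
  proof (rule cnorm_le[where t = "\<lambda>n. s' n \<oplus> t' n"])
    fix n
    have "qnorm V (s' n \<oplus> t' n) \<le> K * (qnorm V (s' n) + qnorm V (t' n))"
      using s' t' by (intro qnorm_add) (auto simp: qcauchyD)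
    also have "\<dots> \<le> K * ((cnorm s + d) + (cnorm t + d))"
      using s' t' K_nonneg by (intro mult_left_mono add_mono) auto
    finally show "qnorm V (s' n \<oplus> t' n) \<le> K * ((cnorm s + d) + (cnorm t + d))" .
  qed (use assms s' t' in \<open>auto intro!: qcauchy_add same_limit_add simp: qcauchyD\<close>)
  also have "\<dots> = K * (cnorm s + cnorm t) + e"
    using K_pos by (simp add: d_def field_simps)
  finally show "cnorm (\<lambda>n. s n \<oplus> t n) \<le> K * (cnorm s + cnorm t) + e" .
qed

lemma cnorm_eq_0:
  assumes "qcauchy V s" "cnorm s = 0"
  shows "same_limit V s (\<lambda>_. \<zero>)"
  unfolding same_limit_def
proof (rule LIMSEQ_I)
  fix e :: real assume e: "0 < e"
  define d where "d = e / (4 * K)"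
  have d: "0 < d" using e K_pos by (simp add: d_def)
  obtain t where t: "qcauchy V t" "same_limit V s t" "\<And>n. qnorm V (t n) \<le> d"
    using cnorm_less[OF assms(1), of d] assms(2) d by auto
  obtain N where N: "\<And>n. n \<ge> N \<Longrightarrow> qnorm V (s n \<ominus> t n) < d"
    using LIMSEQ_D[OF t(2)[unfolded same_limit_def] d] assms t by (auto simp: qcauchyD)
  have "qnorm V (s n) < e" if "n \<ge> N" for n
  proof -
    have "qnorm V (s n) \<le> K * (qnorm V (s n \<ominus> t n) + qnorm V (t n))"
      using assms t by (intro qnorm_le_qdist) (auto simp: qcauchyD)
    also have "\<dots> \<le> K * (d + d)" using N[OF that] t(3)[of n] K_nonneg by (intro mult_left_mono) auto
    also have "\<dots> = e / 2" using K_pos by (simp add: d_def)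
    finally show ?thesis using e by simp
  qed
  then show "\<exists>no. \<forall>n\<ge>no. norm (qnorm V (s n \<ominus> \<zero>) - 0) < e"
    using assms by (auto simp: qcauchyD)
qed

lemma quasinormed_completion: "quasinormed (completion V)"
proof (rule quasinormedI[where C = K])
  fix x assume x: "x \<in> carrier (completion V)"
  then obtain s where s: "qcauchy V s" "x = class_rep V s" by (rule completion_cases)
  note s0 = qcauchyD[OF s(1)]
  show "0 \<le> qnorm (completion V) x" using s cnorm_nonneg by simp
  show "c \<odot>\<^bsub>completion V\<^esub> x \<in> carrier (completion V)" for c
    using s by (simp add: completion_smult qcauchy_smult)
  show "qnorm (completion V) (c \<odot>\<^bsub>completion V\<^esub> x) = norm c * qnorm (completion V) x" for c
    using s by (simp add: completion_smult cnorm_smult)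
  show "\<zero>\<^bsub>completion V\<^esub> \<oplus>\<^bsub>completion V\<^esub> x = x"
    using s s0 by (simp add: completion_zero completion_add qcauchy_const)
  show "(- 1) \<odot>\<^bsub>completion V\<^esub> x \<oplus>\<^bsub>completion V\<^esub> x = \<zero>\<^bsub>completion V\<^esub>"
  proof -
    have "(- 1) \<odot> s n \<oplus> s n = \<zero>" for n using s0[of n] l_neg[of "s n"] by (simp add: uminus_alt)
    then show ?thesis using s by (simp add: completion_zero completion_add completion_smult qcauchy_smult)
  qed
  show "(a + b) \<odot>\<^bsub>completion V\<^esub> x = a \<odot>\<^bsub>completion V\<^esub> x \<oplus>\<^bsub>completion V\<^esub> b \<odot>\<^bsub>completion V\<^esub> x" for a b
    using s s0 by (simp add: completion_add completion_smult qcauchy_smult smult_ldistr)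
  show "(a * b) \<odot>\<^bsub>completion V\<^esub> x = a \<odot>\<^bsub>completion V\<^esub> (b \<odot>\<^bsub>completion V\<^esub> x)" for a b
    using s s0 by (simp add: completion_smult qcauchy_smult smult_assoc)
  show "1 \<odot>\<^bsub>completion V\<^esub> x = x"
    using s s0 by (simp add: completion_smult)
  show "x = \<zero>\<^bsub>completion V\<^esub>" if "qnorm (completion V) x = 0"
    using that s cnorm_eq_0[of s] by (simp add: completion_zero class_rep_eq_iff qcauchy_const)
  fix y assume y: "y \<in> carrier (completion V)"
  then obtain t where t: "qcauchy V t" "y = class_rep V t" by (rule completion_cases)
  note t0 = qcauchyD[OF t(1)]
  show "x \<oplus>\<^bsub>completion V\<^esub> y \<in> carrier (completion V)"
    using s t by (simp add: completion_add qcauchy_add)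
  show "x \<oplus>\<^bsub>completion V\<^esub> y = y \<oplus>\<^bsub>completion V\<^esub> x"
    using s t s0 t0 by (simp add: completion_add a_comm)
  show "a \<odot>\<^bsub>completion V\<^esub> (x \<oplus>\<^bsub>completion V\<^esub> y) = a \<odot>\<^bsub>completion V\<^esub> x \<oplus>\<^bsub>completion V\<^esub> a \<odot>\<^bsub>completion V\<^esub> y" for a
    using s t s0 t0 by (simp add: completion_add completion_smult qcauchy_smult qcauchy_add smult_rdistr)
  show "qnorm (completion V) (x \<oplus>\<^bsub>completion V\<^esub> y) \<le> K * (qnorm (completion V) x + qnorm (completion V) y)"
    using s t by (simp add: completion_add cnorm_add)
  fix z assume z: "z \<in> carrier (completion V)"
  then obtain u where u: "qcauchy V u" "z = class_rep V u" by (rule completion_cases)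
  note u0 = qcauchyD[OF u(1)]
  show "x \<oplus>\<^bsub>completion V\<^esub> y \<oplus>\<^bsub>completion V\<^esub> z = x \<oplus>\<^bsub>completion V\<^esub> (y \<oplus>\<^bsub>completion V\<^esub> z)"
    using s t u s0 t0 u0 by (simp add: completion_add qcauchy_add a_assoc)
next
  show "\<zero>\<^bsub>completion V\<^esub> \<in> carrier (completion V)" by (simp add: completion_zero qcauchy_const)
  show "qnorm (completion V) \<zero>\<^bsub>completion V\<^esub> = 0"
    using cnorm_const_le[of \<zero>] cnorm_nonneg[of "\<lambda>_. \<zero>"] by (simp add: completion_zero qcauchy_const)
qed

lemma completion_minus:
  assumes "qcauchy V s" "qcauchy V t"
  shows "class_rep V s \<ominus>\<^bsub>completion V\<^esub> class_rep V t = class_rep V (\<lambda>n. s n \<ominus> t n)"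
proof -
  interpret C: qnormed "completion V" by (rule qnormed.intro[OF quasinormed_completion])
  show ?thesis
    using assms by (simp add: C.minus_alt minus_alt completion_add completion_smult qcauchy_smult qcauchyD)
qed

text \<open>A diagonal argument: from each \<open>S k\<close> a term \<open>x k\<close> is taken so
  late that its constant class is within \<open>1 / Suc k\<close> of \<open>S k\<close>. The
  sequence \<open>x\<close> is Cauchy in \<open>V\<close>, and its class is the limit.\<close>

lemma quasi_banach_completion: "quasi_banach (completion V)"
  unfolding quasi_banach_def
proof (intro conjI allI impI quasinormed_completion)
  interpret C: qnormed "completion V" by (rule qnormed.intro[OF quasinormed_completion])
  fix S assume S: "qcauchy (completion V) S"
  have Sk: "qcauchy V (S k)" "class_rep V (S k) = S k" for k
    using C.qcauchyD[OF S, of k] by (auto simp: carrier_completion)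
  have "\<forall>k. \<exists>N. \<forall>m\<ge>N. \<forall>n\<ge>N. qnorm V (S k m \<ominus> S k n) < 1 / Suc k"
    using Sk(1) unfolding qcauchy_def by simp
  then obtain N where N: "\<And>k m n. m \<ge> N k \<Longrightarrow> n \<ge> N k \<Longrightarrow> qnorm V (S k m \<ominus> S k n) < 1 / Suc k" by metis
  define x where "x k = S k (N k)" for k
  have x: "x k \<in> carrier V" for k using Sk(1) by (simp add: x_def qcauchyD)
  have near: "qnorm (completion V) (S k \<ominus>\<^bsub>completion V\<^esub> class_rep V (\<lambda>_. x k)) \<le> 1 / Suc k" for k
  proof -
    have "qnorm (completion V) (class_rep V (S k) \<ominus>\<^bsub>completion V\<^esub> class_rep V (\<lambda>_. x k)) \<le> 1 / Suc k"
      using Sk(1)[of k] N[of k _ "N k"] x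
      by (subst completion_minus)
         (auto intro!: cnorm_le_eventually[where N = "N k"] simp: qcauchy_const minus_alt qcauchy_add qcauchy_smult qcauchyD
           less_imp_le x_def simp del: of_nat_Suc)
    then show ?thesis using Sk by simp
  qed
  have inv0: "(\<lambda>k. 1 / real (Suc k)) \<longlonglongrightarrow> 0" using LIMSEQ_inverse_real_of_nat by (simp add: inverse_eq_divide)
  define Kc where "Kc = qmodulus (completion V)"
  \<comment> \<open>The embedding by constant sequences need not be isometric, as a quasinorm may be
    discontinuous, but it is bounded below, which brings the Cauchy property back to
    \<open>V\<close>. The slack \<open>e\<close> is there because the infimum need not be
    attained.\<close>
  have emb_lower: "qnorm V a \<le> 2 * K * (cnorm (\<lambda>_. a) + e)" if a: "a \<in> carrier V" and e: "0 < e" for a e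
  proof -
    obtain t where t: "qcauchy V t" "same_limit V (\<lambda>_. a) t" "\<And>n. qnorm V (t n) \<le> cnorm (\<lambda>_. a) + e"
      using cnorm_less[OF qcauchy_const[OF a], of "cnorm (\<lambda>_. a) + e"] e by auto
    obtain M where "\<And>n. n \<ge> M \<Longrightarrow> qnorm V (a \<ominus> t n) < e"
      using LIMSEQ_D[OF t(2)[unfolded same_limit_def] e] a t by (auto simp: qcauchyD)
    then have "qnorm V (a \<ominus> t M) < e" by simp
    moreover have "qnorm V a \<le> K * (qnorm V (a \<ominus> t M) + qnorm V (t M))"
      using a t by (intro qnorm_le_qdist) (auto simp: qcauchyD)
    moreover have "qnorm V (a \<ominus> t M) + qnorm V (t M) \<le> 2 * (cnorm (\<lambda>_. a) + e)"
      using t(3)[of M] calculation(1) cnorm_nonneg[OF qcauchy_const[OF a]] by simp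
    then have "K * (qnorm V (a \<ominus> t M) + qnorm V (t M)) \<le> K * (2 * (cnorm (\<lambda>_. a) + e))"
      using K_nonneg by (rule mult_left_mono)
    ultimately show ?thesis by (simp add: mult_ac)
  qed
  have xc: "qcauchy V x"
    unfolding qcauchy_def
  proof (intro conjI allI impI x)
    fix e :: real assume e: "0 < e"
    \<comment> \<open>Two triangle inequalities in the completion keep the constant classes within
      \<open>2 * Kc * Kc * d\<close>. With the slack \<open>Kc * Kc * d\<close>,
      \<open>emb_lower\<close> turns this into \<open>6 * K * Kc * Kc * d\<close>, which is below
      \<open>e\<close>.\<close>
    define d where "d = e / (8 * K * Kc * Kc)"
    have Kc: "0 < Kc" "1 \<le> Kc" using C.K_pos C.K_ge_1 by (auto simp: Kc_def)
    have d: "0 < d" using e K_pos Kc by (simp add: d_def)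
    obtain N1 where N1: "\<And>m n. m \<ge> N1 \<Longrightarrow> n \<ge> N1 \<Longrightarrow> qnorm (completion V) (S m \<ominus>\<^bsub>completion V\<^esub> S n) < d / 2"
      using S d unfolding qcauchy_def by (metis half_gt_zero)
    obtain N2 where N2: "\<And>k. k \<ge> N2 \<Longrightarrow> 1 / real (Suc k) < d / 2"
      using LIMSEQ_D[OF inv0, of "d / 2"] d by auto
    have "qnorm V (x m \<ominus> x n) < e" if m: "m \<ge> max N1 N2" and n: "n \<ge> max N1 N2" for m n
    proof -
      let ?a = "class_rep V (\<lambda>_. x m)" and ?b = "class_rep V (\<lambda>_. x n)"
      have car: "?a \<in> carrier (completion V)" "?b \<in> carrier (completion V)"
        "S m \<in> carrier (completion V)" "S n \<in> carrier (completion V)"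
        using x C.qcauchyD[OF S] by (auto simp: qcauchy_const)
      have 1: "qnorm (completion V) (?a \<ominus>\<^bsub>completion V\<^esub> S m) < d / 2"
        using near[of m] N2[of m] m C.qnorm_minus_commute[OF car(1,3)] by simp
      have 2: "qnorm (completion V) (S n \<ominus>\<^bsub>completion V\<^esub> ?b) < d / 2" using near[of n] N2[of n] n by simp
      have 3: "qnorm (completion V) (S m \<ominus>\<^bsub>completion V\<^esub> S n) < d / 2" using N1 m n by simp
      have "qnorm (completion V) (?a \<ominus>\<^bsub>completion V\<^esub> S n) \<le> Kc * (d / 2 + d / 2)"
        using C.qdist_triangle[OF car(1,3,4)] 1 3 Kc unfolding Kc_def
        by (intro order_trans[OF C.qdist_triangle[OF car(1,3,4)] mult_left_mono]) auto
      then have "qnorm (completion V) (?a \<ominus>\<^bsub>completion V\<^esub> ?b) \<le> Kc * (Kc * d + d)"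
        using 2 Kc d unfolding Kc_def
        by (intro order_trans[OF C.qdist_triangle[OF car(1,4,2)] mult_left_mono]) auto
      also have "\<dots> \<le> Kc * (Kc * d + Kc * d)" using Kc d by (intro mult_left_mono add_mono) auto
      finally have ab: "cnorm (\<lambda>_. x m \<ominus> x n) \<le> 2 * Kc * Kc * d"
        using x by (simp add: completion_minus qcauchy_const mult_ac)
      have "qnorm V (x m \<ominus> x n) \<le> 2 * K * (cnorm (\<lambda>_. x m \<ominus> x n) + Kc * Kc * d)"
        using x d Kc by (intro emb_lower) auto
      also have "\<dots> \<le> 2 * K * (2 * Kc * Kc * d + Kc * Kc * d)"
        using ab K_nonneg by (intro mult_left_mono) auto
      also have "\<dots> < e" using K_pos Kc e by (simp add: d_def field_simps)
      finally show ?thesis .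
    qed
    then show "\<exists>N. \<forall>m\<ge>N. \<forall>n\<ge>N. qnorm V (x m \<ominus> x n) < e" by blast
  qed
  have limx: "(\<lambda>k. cnorm (\<lambda>n. x k \<ominus> x n)) \<longlonglongrightarrow> 0"
  proof (rule LIMSEQ_I)
    fix e :: real assume e: "0 < e"
    then obtain M where M: "\<And>m n. m \<ge> M \<Longrightarrow> n \<ge> M \<Longrightarrow> qnorm V (x m \<ominus> x n) < e / 2"
      using xc unfolding qcauchy_def by (metis half_gt_zero)
    have "norm (cnorm (\<lambda>n. x k \<ominus> x n) - 0) < e" if "k \<ge> M" for k
    proof -
      have qc: "qcauchy V (\<lambda>n. x k \<ominus> x n)" using x xc by (simp add: minus_alt qcauchy_add qcauchy_smult qcauchy_const)
      then have "cnorm (\<lambda>n. x k \<ominus> x n) \<le> e / 2"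
        using M[OF that] by (intro cnorm_le_eventually[where N = M]) (auto simp: less_imp_le)
      then show ?thesis using e cnorm_nonneg[OF qc] by simp
    qed
    then show "\<exists>no. \<forall>n\<ge>no. norm (cnorm (\<lambda>na. x n \<ominus> x na) - 0) < e" by blast
  qed
  have "qconverges (completion V) S (class_rep V x)"
    unfolding qconverges_def
  proof
    show "class_rep V x \<in> carrier (completion V)" using xc by simp
    have "(\<lambda>k. 1 / real (Suc k) + cnorm (\<lambda>n. x k \<ominus> x n)) \<longlonglongrightarrow> 0"
      using tendsto_add[OF inv0 limx] by simp
    then show "(\<lambda>n. qnorm (completion V) (S n \<ominus>\<^bsub>completion V\<^esub> class_rep V x)) \<longlonglongrightarrow> 0"
    proof (rule null_sequence_le[where C = Kc])
      fix k
      have car: "S k \<in> carrier (completion V)" "class_rep V (\<lambda>_. x k) \<in> carrier (completion V)" "class_rep V x \<in> carrier (completion V)"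
        using x xc C.qcauchyD[OF S] by (auto simp: qcauchy_const)
      show "0 \<le> qnorm (completion V) (S k \<ominus>\<^bsub>completion V\<^esub> class_rep V x)" using car by simp
      have "cnorm (\<lambda>n. x k \<ominus> x n) = qnorm (completion V) (class_rep V (\<lambda>_. x k) \<ominus>\<^bsub>completion V\<^esub> class_rep V x)"
        using x xc by (simp add: completion_minus qcauchy_const)
      then show "qnorm (completion V) (S k \<ominus>\<^bsub>completion V\<^esub> class_rep V x) \<le> Kc * (1 / Suc k + cnorm (\<lambda>n. x k \<ominus> x n))"
        using near[of k] C.K_nonneg unfolding Kc_def
        by (intro order_trans[OF C.qdist_triangle[OF car] mult_left_mono]) auto
    qed
  qed
  then show "\<exists>x. qconverges (completion V) S x" by blast
qed

end

section \<open>Operators and their extensions to completions\<close>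

lemma operatorsI:
  assumes "\<And>x. x \<in> carrier V \<Longrightarrow> T x \<in> carrier W"
    "\<And>x y. x \<in> carrier V \<Longrightarrow> y \<in> carrier V \<Longrightarrow> T (x \<oplus>\<^bsub>V\<^esub> y) = T x \<oplus>\<^bsub>W\<^esub> T y"
    "\<And>c x. x \<in> carrier V \<Longrightarrow> T (c \<odot>\<^bsub>V\<^esub> x) = c \<odot>\<^bsub>W\<^esub> T x"
    "\<And>x. x \<in> carrier V \<Longrightarrow> qnorm W (T x) \<le> C * qnorm V x"
  shows "T \<in> operators V W"
  using assms unfolding operators_def by blast

lemma operators_closed: "T \<in> operators V W \<Longrightarrow> x \<in> carrier V \<Longrightarrow> T x \<in> carrier W"
  and operators_add: "T \<in> operators V W \<Longrightarrow> x \<in> carrier V \<Longrightarrow> y \<in> carrier V \<Longrightarrow> T (x \<oplus>\<^bsub>V\<^esub> y) = T x \<oplus>\<^bsub>W\<^esub> T y"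
  and operators_smult: "T \<in> operators V W \<Longrightarrow> x \<in> carrier V \<Longrightarrow> T (c \<odot>\<^bsub>V\<^esub> x) = c \<odot>\<^bsub>W\<^esub> T x"
  unfolding operators_def by auto

lemma operators_bound:
  assumes "T \<in> operators V W" "quasinormed V"
  obtains C where "0 \<le> C" "\<And>x. x \<in> carrier V \<Longrightarrow> qnorm W (T x) \<le> C * qnorm V x"
proof -
  interpret V: qnormed V by (rule qnormed.intro) fact
  obtain C where "\<And>x. x \<in> carrier V \<Longrightarrow> qnorm W (T x) \<le> C * qnorm V x"
    using assms unfolding operators_def by blast
  then have "qnorm W (T x) \<le> max 0 C * qnorm V x" if "x \<in> carrier V" for x
    using that by (intro order_trans[OF _ mult_right_mono[of C "max 0 C"]]) auto
  then show ?thesis using that[of "max 0 C"] by auto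
qed

lemma operators_minus:
  assumes "T \<in> operators V W" "quasinormed V" "quasinormed W" "x \<in> carrier V" "y \<in> carrier V"
  shows "T (x \<ominus>\<^bsub>V\<^esub> y) = T x \<ominus>\<^bsub>W\<^esub> T y"
proof -
  interpret V: qnormed V by (rule qnormed.intro) fact
  interpret W: qnormed W by (rule qnormed.intro) fact
  show ?thesis using assms
    by (simp add: V.minus_alt W.minus_alt operators_closed operators_add operators_smult)
qed

lemma operators_zero:
  assumes "T \<in> operators V W" "quasinormed V" "quasinormed W"
  shows "T \<zero>\<^bsub>V\<^esub> = \<zero>\<^bsub>W\<^esub>"
proof -
  interpret V: qnormed V by (rule qnormed.intro) fact
  interpret W: qnormed W by (rule qnormed.intro) fact
  show ?thesis using operators_smult[OF assms(1) V.zero_closed, of 0] operators_closed[OF assms(1) V.zero_closed]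
    by simp
qed

lemma operators_compose:
  assumes "S \<in> operators U V" "T \<in> operators V W" "quasinormed V"
  shows "(\<lambda>x. T (S x)) \<in> operators U W"
proof -
  obtain C where C: "\<And>x. x \<in> carrier U \<Longrightarrow> qnorm V (S x) \<le> C * qnorm U x"
    using assms unfolding operators_def by blast
  obtain D where D: "0 \<le> D" "\<And>x. x \<in> carrier V \<Longrightarrow> qnorm W (T x) \<le> D * qnorm V x"
    using operators_bound[OF assms(2,3)] by blast
  show ?thesis
  proof (rule operatorsI[where C = "D * C"])
    fix x assume x: "x \<in> carrier U"
    have "qnorm W (T (S x)) \<le> D * qnorm V (S x)" using D(2) operators_closed[OF assms(1) x] by blast
    also have "\<dots> \<le> D * (C * qnorm U x)" using C[OF x] D(1) by (rule mult_left_mono)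
    finally show "qnorm W (T (S x)) \<le> D * C * qnorm U x" by (simp add: mult.assoc)
  qed (use assms in \<open>auto simp: operators_closed operators_add operators_smult\<close>)
qed

lemma quasi_banach_quasinormed: "quasi_banach V \<Longrightarrow> quasinormed V"
  by (simp add: quasi_banach_def)

lemma qcauchy_image:
  assumes "T \<in> operators V W" "quasinormed V" "quasinormed W" "qcauchy V s"
  shows "qcauchy W (\<lambda>n. T (s n))"
proof -
  interpret V: qnormed V by (rule qnormed.intro) fact
  obtain C where C: "0 \<le> C" "\<And>x. x \<in> carrier V \<Longrightarrow> qnorm W (T x) \<le> C * qnorm V x"
    using operators_bound[OF assms(1,2)] by blast
  show ?thesis unfolding qcauchy_def
  proof (intro conjI allI impI)
    show "T (s n) \<in> carrier W" for n by (rule operators_closed[OF assms(1) V.qcauchyD[OF assms(4)]])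
    fix e :: real assume e: "0 < e"
    then have "0 < e / (C + 1)" using C by simp
    then obtain N where N: "\<And>m n. m \<ge> N \<Longrightarrow> n \<ge> N \<Longrightarrow> qnorm V (s m \<ominus>\<^bsub>V\<^esub> s n) < e / (C + 1)"
      using assms(4) unfolding qcauchy_def by blast
    have "qnorm W (T (s m) \<ominus>\<^bsub>W\<^esub> T (s n)) < e" if "m \<ge> N" "n \<ge> N" for m n
    proof -
      have "qnorm W (T (s m) \<ominus>\<^bsub>W\<^esub> T (s n)) \<le> C * qnorm V (s m \<ominus>\<^bsub>V\<^esub> s n)"
        using C(2)[of "s m \<ominus>\<^bsub>V\<^esub> s n"] V.qcauchyD[OF assms(4)] operators_minus[OF assms(1-3)] by simp
      also have "\<dots> \<le> C * (e / (C + 1))" using N[OF that] C by (intro mult_left_mono) auto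
      also have "\<dots> < e" using C e by (simp add: field_simps)
      finally show ?thesis .
    qed
    then show "\<exists>N. \<forall>m\<ge>N. \<forall>n\<ge>N. qnorm W (T (s m) \<ominus>\<^bsub>W\<^esub> T (s n)) < e" by blast
  qed
qed

lemma same_limit_image:
  assumes "T \<in> operators V W" "quasinormed V" "quasinormed W" "qcauchy V s" "qcauchy V t" "same_limit V s t"
  shows "same_limit W (\<lambda>n. T (s n)) (\<lambda>n. T (t n))"
proof -
  interpret V: qnormed V by (rule qnormed.intro) fact
  interpret W: qnormed W by (rule qnormed.intro) fact
  obtain C where C: "0 \<le> C" "\<And>x. x \<in> carrier V \<Longrightarrow> qnorm W (T x) \<le> C * qnorm V x"
    using operators_bound[OF assms(1,2)] by blast
  note st = V.qcauchyD[OF assms(4)] V.qcauchyD[OF assms(5)]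
  show ?thesis
    using assms(6) unfolding same_limit_def
    by (rule null_sequence_le[where C = C])
       (use st operators_closed[OF assms(1)] C(2) in \<open>auto simp flip: operators_minus[OF assms(1-3)]\<close>)
qed

definition completion_map ::
    "('k, 'b) qspace \<Rightarrow> ('a \<Rightarrow> 'b) \<Rightarrow> (nat \<Rightarrow> 'a) \<Rightarrow> (nat \<Rightarrow> 'b)" where
  "completion_map W T s = class_rep W (\<lambda>n. T (s n))"

lemma completion_map_class_rep:
  assumes "T \<in> operators V W" "quasinormed V" "quasinormed W" "qcauchy V s"
  shows "completion_map W T (class_rep V s) = class_rep W (\<lambda>n. T (s n))"
proof -
  interpret V: qnormed V by (rule qnormed.intro) fact
  interpret W: qnormed W by (rule qnormed.intro) fact
  have "same_limit W (\<lambda>n. T (class_rep V s n)) (\<lambda>n. T (s n))"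
    by (rule same_limit_image[OF assms(1-3) V.class_rep(1)[OF assms(4)] assms(4) V.class_rep_same[OF assms(4)]])
  then show ?thesis
    unfolding completion_map_def
    using W.class_rep_eq_iff qcauchy_image[OF assms(1-3)] V.class_rep(1)[OF assms(4)] assms(4) by blast
qed

lemma completion_map_operator:
  assumes "T \<in> operators V W" "quasinormed V" "quasinormed W"
  shows "completion_map W T \<in> operators (completion V) (completion W)"
proof -
  interpret V: qnormed V by (rule qnormed.intro) fact
  interpret W: qnormed W by (rule qnormed.intro) fact
  note cm = completion_map_class_rep[OF assms]
  note qi = qcauchy_image[OF assms]
  obtain C where C: "0 \<le> C" "\<And>x. x \<in> carrier V \<Longrightarrow> qnorm W (T x) \<le> C * qnorm V x"
    using operators_bound[OF assms(1,2)] by blast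
  show ?thesis
  proof (rule operatorsI[where C = C])
    fix x assume "x \<in> carrier (completion V)"
    then obtain s where s: "qcauchy V s" "x = class_rep V s" by (rule V.completion_cases)
    show "completion_map W T x \<in> carrier (completion W)" using s cm qi by simp
    show "completion_map W T (c \<odot>\<^bsub>completion V\<^esub> x) = c \<odot>\<^bsub>completion W\<^esub> completion_map W T x" for c
      using s V.qcauchyD[OF s(1)]
      by (simp add: V.completion_smult W.completion_smult cm qi V.qcauchy_smult operators_smult[OF assms(1)])
    show "qnorm (completion W) (completion_map W T x) \<le> C * qnorm (completion V) x"
    proof (rule field_le_epsilon)
      fix e :: real assume e: "0 < e"
      define d where "d = e / (C + 1)"
      have d: "0 < d" "C * d \<le> e" using e C by (auto simp: d_def field_simps)
      obtain t where t: "qcauchy V t" "same_limit V s t" "\<And>n. qnorm V (t n) \<le> V.cnorm s + d"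
        using V.cnorm_less[OF s(1), of "V.cnorm s + d"] d by auto
      have "W.cnorm (\<lambda>n. T (s n)) \<le> C * (V.cnorm s + d)"
      proof (rule W.cnorm_le)
        show "qcauchy W (\<lambda>n. T (s n))" "qcauchy W (\<lambda>n. T (t n))" using qi s t by auto
        show "same_limit W (\<lambda>n. T (s n)) (\<lambda>n. T (t n))" using same_limit_image[OF assms] s t by blast
        fix n
        have "qnorm W (T (t n)) \<le> C * qnorm V (t n)" using C V.qcauchyD[OF t(1)] by blast
        also have "\<dots> \<le> C * (V.cnorm s + d)" using t(3) C by (intro mult_left_mono) auto
        finally show "qnorm W (T (t n)) \<le> C * (V.cnorm s + d)" .
      qed
      then show "qnorm (completion W) (completion_map W T x) \<le> C * qnorm (completion V) x + e"
        using s d by (simp add: cm distrib_left)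
    qed
    fix y assume "y \<in> carrier (completion V)"
    then obtain t where t: "qcauchy V t" "y = class_rep V t" by (rule V.completion_cases)
    show "completion_map W T (x \<oplus>\<^bsub>completion V\<^esub> y) = completion_map W T x \<oplus>\<^bsub>completion W\<^esub> completion_map W T y"
      using s t V.qcauchyD[OF s(1)] V.qcauchyD[OF t(1)]
      by (simp add: V.completion_add W.completion_add cm qi V.qcauchy_add operators_add[OF assms(1)])
  qed
qed

lemma const_class_operator:
  assumes "quasinormed V"
  shows "(\<lambda>x. class_rep V (\<lambda>_. x)) \<in> operators V (completion V)"
proof -
  interpret V: qnormed V by (rule qnormed.intro) fact
  show ?thesis
    by (rule operatorsI[where C = 1])
       (auto simp: V.qcauchy_const V.completion_add V.completion_smult V.cnorm_const_le)
qed

text \<open>The continuous extension of an operator into a complete space; for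
  \<open>T = snd\<close> it is \<open>Z_proj\<close> before coding.\<close>

definition limit_map :: "('k, 'b) qspace \<Rightarrow> ('a \<Rightarrow> 'b) \<Rightarrow> (nat \<Rightarrow> 'a) \<Rightarrow> 'b" where
  "limit_map X T s = (THE x. qconverges X (\<lambda>n. T (s n)) x)"

lemma limit_map_eqI:
  assumes "quasinormed X" "\<And>n. T (s n) \<in> carrier X" "qconverges X (\<lambda>n. T (s n)) x"
  shows "limit_map X T s = x"
proof -
  interpret X: qnormed X by (rule qnormed.intro) fact
  show ?thesis unfolding limit_map_def
    by (rule the_equality) (use assms X.qconverges_unique[of "\<lambda>n. T (s n)"] in blast)+
qed

lemma qconverges_same_limit:
  assumes "quasinormed X" "\<And>n. s n \<in> carrier X" "\<And>n. t n \<in> carrier X" "same_limit X s t" "qconverges X s x"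
  shows "qconverges X t x"
proof -
  interpret X: qnormed X by (rule qnormed.intro) fact
  have x: "x \<in> carrier X" using assms by (simp add: qconverges_def)
  have "same_limit X t (\<lambda>_. x)"
    by (rule X.same_limit_trans[of t s])
       (use assms x X.same_limit_sym[of s t] in \<open>auto simp: qconverges_def same_limit_def\<close>)
  then show ?thesis using x by (simp add: qconverges_def same_limit_def)
qed

lemma limit_map_class_rep:
  assumes "T \<in> operators V X" "quasinormed V" "quasi_banach X" "qcauchy V s"
  shows "qconverges X (\<lambda>n. T (s n)) (limit_map X T (class_rep V s))"
proof -
  interpret V: qnormed V by (rule qnormed.intro) fact
  note X = quasi_banach_quasinormed[OF assms(3)]
  interpret X: qnormed X by (rule qnormed.intro[OF X])
  have c: "qcauchy X (\<lambda>n. T (s n))" "qcauchy X (\<lambda>n. T (class_rep V s n))"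
    using qcauchy_image[OF assms(1,2) X] assms(4) V.class_rep by blast+
  have sl: "same_limit X (\<lambda>n. T (s n)) (\<lambda>n. T (class_rep V s n))"
    by (rule same_limit_image[OF assms(1,2) X assms(4) V.class_rep[OF assms(4)]])
  obtain x where x: "qconverges X (\<lambda>n. T (s n)) x" using assms(3) c(1) unfolding quasi_banach_def by blast
  have "qconverges X (\<lambda>n. T (class_rep V s n)) x"
    by (rule qconverges_same_limit[OF X _ _ sl x]) (use c X.qcauchyD in auto)
  then have "limit_map X T (class_rep V s) = x"
    using c X.qcauchyD by (intro limit_map_eqI[OF X]) auto
  then show ?thesis using x by simp
qed

lemma qconverges_add:
  assumes "quasinormed X" "\<And>n. s n \<in> carrier X" "\<And>n. t n \<in> carrier X" "qconverges X s x" "qconverges X t y"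
  shows "qconverges X (\<lambda>n. s n \<oplus>\<^bsub>X\<^esub> t n) (x \<oplus>\<^bsub>X\<^esub> y)"
proof -
  interpret X: qnormed X by (rule qnormed.intro) fact
  have "same_limit X (\<lambda>n. s n \<oplus>\<^bsub>X\<^esub> t n) (\<lambda>_. x \<oplus>\<^bsub>X\<^esub> y)"
    by (rule X.same_limit_add) (use assms in \<open>auto simp: qconverges_def same_limit_def\<close>)
  then show ?thesis using assms by (simp add: qconverges_def same_limit_def)
qed

lemma qconverges_smult:
  assumes "quasinormed X" "\<And>n. s n \<in> carrier X" "qconverges X s x"
  shows "qconverges X (\<lambda>n. c \<odot>\<^bsub>X\<^esub> s n) (c \<odot>\<^bsub>X\<^esub> x)"
proof -
  interpret X: qnormed X by (rule qnormed.intro) fact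
  have "same_limit X (\<lambda>n. c \<odot>\<^bsub>X\<^esub> s n) (\<lambda>_. c \<odot>\<^bsub>X\<^esub> x)"
    by (rule X.same_limit_smult) (use assms in \<open>auto simp: qconverges_def same_limit_def\<close>)
  then show ?thesis using assms by (simp add: qconverges_def same_limit_def)
qed

text \<open>The quasinorm of a limit is not the limit of the quasinorms. Passing from
  \<open>T (t n)\<close> to the limit costs one triangle inequality, whence the factor
  \<open>X.K\<close> in the bound.\<close>

lemma limit_map_operator:
  assumes "T \<in> operators V X" "quasinormed V" "quasi_banach X"
  shows "limit_map X T \<in> operators (completion V) X"
proof -
  interpret V: qnormed V by (rule qnormed.intro) fact
  note X = quasi_banach_quasinormed[OF assms(3)]
  interpret X: qnormed X by (rule qnormed.intro[OF X])
  note lm = limit_map_class_rep[OF assms]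
  obtain C where C: "0 \<le> C" "\<And>x. x \<in> carrier V \<Longrightarrow> qnorm X (T x) \<le> C * qnorm V x"
    using operators_bound[OF assms(1,2)] by blast
  have Tc: "\<And>n. T (s n) \<in> carrier X" if "qcauchy V s" for s
    using V.qcauchyD[OF that] operators_closed[OF assms(1)] by blast
  have uniq: "limit_map X T (class_rep V s) = x" if "qcauchy V s" "qconverges X (\<lambda>n. T (s n)) x" for s x
    using X.qconverges_unique[OF Tc[OF that(1)] lm[OF that(1)] that(2)] .
  have car: "limit_map X T (class_rep V s) \<in> carrier X" if "qcauchy V s" for s
    using lm[OF that] by (simp add: qconverges_def)
  show ?thesis
  proof (rule operatorsI[where C = "X.K * C"])
    fix x assume "x \<in> carrier (completion V)"
    then obtain s where s: "qcauchy V s" "x = class_rep V s" by (rule V.completion_cases)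
    show "limit_map X T x \<in> carrier X" using s car by simp
    show "limit_map X T (c \<odot>\<^bsub>completion V\<^esub> x) = c \<odot>\<^bsub>X\<^esub> limit_map X T x" for c
      using s V.qcauchyD[OF s(1)] qconverges_smult[OF X Tc[OF s(1)] lm[OF s(1)], of c]
      by (simp add: V.completion_smult uniq V.qcauchy_smult operators_smult[OF assms(1)])
    show "qnorm X (limit_map X T x) \<le> X.K * C * qnorm (completion V) x"
    proof (rule field_le_epsilon)
      fix e :: real assume e: "0 < e"
      define d where "d = e / (X.K * (C + 1))"
      have d: "0 < d" using e C X.K_pos by (simp add: d_def)
      obtain t where t: "qcauchy V t" "same_limit V s t" "\<And>n. qnorm V (t n) \<le> V.cnorm s + d"
        using V.cnorm_less[OF s(1), of "V.cnorm s + d"] d by auto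
      have xt: "limit_map X T x = limit_map X T (class_rep V t)"
        unfolding s(2) using V.class_rep_eq_iff[OF s(1) t(1)] t(2) by simp
      define y where "y = limit_map X T (class_rep V t)"
      have y: "y \<in> carrier X" and lim: "(\<lambda>n. qnorm X (T (t n) \<ominus>\<^bsub>X\<^esub> y)) \<longlonglongrightarrow> 0"
        using lm[OF t(1)] by (auto simp: qconverges_def y_def)
      obtain n where n: "qnorm X (T (t n) \<ominus>\<^bsub>X\<^esub> y) < d"
        using LIMSEQ_D[OF lim d] y Tc[OF t(1)] by auto
      have "qnorm X y \<le> X.K * (qnorm X (T (t n) \<ominus>\<^bsub>X\<^esub> y) + qnorm X (T (t n)))"
        using X.qnorm_le_qdist[of y "T (t n)"] X.qnorm_minus_commute[of y "T (t n)"] y Tc[OF t(1)] by simp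
      also have "\<dots> \<le> X.K * (d + C * (V.cnorm s + d))"
      proof (intro mult_left_mono add_mono X.K_nonneg)
        have "qnorm X (T (t n)) \<le> C * qnorm V (t n)" using C V.qcauchyD[OF t(1)] by blast
        also have "\<dots> \<le> C * (V.cnorm s + d)" using t(3) C by (intro mult_left_mono) auto
        finally show "qnorm X (T (t n)) \<le> C * (V.cnorm s + d)" .
      qed (use n in simp)
      also have "\<dots> = X.K * C * V.cnorm s + d * (X.K * (C + 1))" by (simp add: algebra_simps)
      also have "d * (X.K * (C + 1)) = e" using X.K_pos C by (simp add: d_def)
      finally have "qnorm X y \<le> X.K * C * V.cnorm s + e" .
      then show "qnorm X (limit_map X T x) \<le> X.K * C * qnorm (completion V) x + e"
        unfolding xt y_def[symmetric] using s(2) by simp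
    qed
    fix y assume "y \<in> carrier (completion V)"
    then obtain t where t: "qcauchy V t" "y = class_rep V t" by (rule V.completion_cases)
    show "limit_map X T (x \<oplus>\<^bsub>completion V\<^esub> y) = limit_map X T x \<oplus>\<^bsub>X\<^esub> limit_map X T y"
      using s t V.qcauchyD[OF s(1)] V.qcauchyD[OF t(1)]
        qconverges_add[OF X Tc[OF s(1)] Tc[OF t(1)] lm[OF s(1)] lm[OF t(1)]]
      by (simp add: V.completion_add uniq V.qcauchy_add operators_add[OF assms(1)])
  qed
qed

section \<open>Transport of structure along injections\<close>

lemma transport_simps:
  assumes "inj f"
  shows "carrier (transport f V) = f ` carrier V" "\<zero>\<^bsub>transport f V\<^esub> = f \<zero>\<^bsub>V\<^esub>"
    "f x \<oplus>\<^bsub>transport f V\<^esub> f y = f (x \<oplus>\<^bsub>V\<^esub> y)" "c \<odot>\<^bsub>transport f V\<^esub> f x = f (c \<odot>\<^bsub>V\<^esub> x)"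
    "qnorm (transport f V) (f x) = qnorm V x"
  using assms by (simp_all add: transport_def)

lemma quasinormed_transport:
  assumes "inj f" "quasinormed V"
  shows "quasinormed (transport f V)"
proof -
  interpret V: qnormed V by (rule qnormed.intro) fact
  note ts = transport_simps[OF assms(1)]
  have inv1: "(- 1) \<odot>\<^bsub>V\<^esub> x \<oplus>\<^bsub>V\<^esub> x = \<zero>\<^bsub>V\<^esub>" if "x \<in> carrier V" for x
    using that V.l_neg[of x] by (simp add: V.uminus_alt)
  have inv2: "x \<oplus>\<^bsub>V\<^esub> (- 1) \<odot>\<^bsub>V\<^esub> x = \<zero>\<^bsub>V\<^esub>" if "x \<in> carrier V" for x
    using that V.r_neg[of x] by (simp add: V.uminus_alt)
  show ?thesis
    by (rule quasinormedI[where C = V.K])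
       (auto simp: ts V.a_ac V.smult_ldistr V.smult_rdistr V.smult_assoc V.qnorm_smult
          V.qnorm_eq_0 V.qnorm_add inv1 inv2)
qed

lemma transport_minus:
  assumes "inj f" "quasinormed V" "x \<in> carrier V" "y \<in> carrier V"
  shows "f x \<ominus>\<^bsub>transport f V\<^esub> f y = f (x \<ominus>\<^bsub>V\<^esub> y)"
proof -
  interpret V: qnormed V by (rule qnormed.intro) fact
  interpret W: qnormed "transport f V" by (rule qnormed.intro, rule quasinormed_transport) fact+
  show ?thesis using assms by (simp add: V.minus_alt W.minus_alt transport_simps[OF assms(1)])
qed

lemma quasi_banach_transport:
  assumes f: "inj f" and V: "quasi_banach V"
  shows "quasi_banach (transport f V)"
  unfolding quasi_banach_def
proof (intro conjI allI impI)
  note qV = quasi_banach_quasinormed[OF V]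
  interpret V: qnormed V by (rule qnormed.intro[OF qV])
  show "quasinormed (transport f V)" using f qV by (rule quasinormed_transport)
  fix s assume s: "qcauchy (transport f V) s"
  have "s n \<in> f ` carrier V" for n
    using s by (simp add: qcauchy_def transport_simps(1)[OF f])
  then have "\<forall>n. \<exists>x. x \<in> carrier V \<and> s n = f x" by (meson imageE)
  then obtain t where t: "\<And>n. t n \<in> carrier V" "\<And>n. s n = f (t n)" by metis
  have "qcauchy V t"
    using s t unfolding qcauchy_def by (simp add: transport_minus[OF f qV] transport_simps[OF f])
  then obtain x where "qconverges V t x" using V unfolding quasi_banach_def by blast
  then have "qconverges (transport f V) s (f x)"
    using t unfolding qconverges_def by (simp add: transport_minus[OF f qV] transport_simps[OF f])
  then show "\<exists>x. qconverges (transport f V) s x" by blast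
qed

lemma operators_to_transport:
  assumes "inj f" "T \<in> operators U V"
  shows "(\<lambda>x. f (T x)) \<in> operators U (transport f V)"
  using assms(2) unfolding operators_def by (auto simp: transport_simps[OF assms(1)])

lemma operators_from_transport:
  assumes "inj f" "T \<in> operators V U"
  shows "(\<lambda>z. T (inv_into UNIV f z)) \<in> operators (transport f V) U"
  using assms unfolding operators_def by (auto simp: transport_simps[OF assms(1)])

section \<open>Twisted sums and spliced sequences\<close>

text \<open>The data of an induced sequence. Three kinds of instances occur: a centralizer on
  \<open>lp0\<close>, its lift with values in \<open>Z(\<Phi>)\<close>, and the zero map on a whole
  space, whose twisted sum is the direct sum.\<close>

locale twisted =
  fixes Y :: "('k::real_normed_field, 'a) qspace" and X :: "('k, 'b) qspace"
    and X0 :: "'b set" and \<Phi> :: "'b \<Rightarrow> 'a" and Q :: real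
  assumes Y: "quasi_banach Y" and X: "quasi_banach X"
    and X0_subset: "X0 \<subseteq> carrier X" and X0_zero: "\<zero>\<^bsub>X\<^esub> \<in> X0"
    and X0_add: "\<And>x y. x \<in> X0 \<Longrightarrow> y \<in> X0 \<Longrightarrow> x \<oplus>\<^bsub>X\<^esub> y \<in> X0"
    and X0_smult: "\<And>c x. x \<in> X0 \<Longrightarrow> c \<odot>\<^bsub>X\<^esub> x \<in> X0"
    and dense: "\<And>x e. x \<in> carrier X \<Longrightarrow> 0 < e \<Longrightarrow> \<exists>x0\<in>X0. qnorm X (x0 \<ominus>\<^bsub>X\<^esub> x) < e"
    and Phi_closed: "\<And>x. x \<in> X0 \<Longrightarrow> \<Phi> x \<in> carrier Y"
    and Phi_smult: "\<And>c x. x \<in> X0 \<Longrightarrow> \<Phi> (c \<odot>\<^bsub>X\<^esub> x) = c \<odot>\<^bsub>Y\<^esub> \<Phi> x"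
    and Q_nonneg: "0 \<le> Q"
    and Phi_add: "\<And>x y. x \<in> X0 \<Longrightarrow> y \<in> X0 \<Longrightarrow>
      qnorm Y (\<Phi> (x \<oplus>\<^bsub>X\<^esub> y) \<ominus>\<^bsub>Y\<^esub> (\<Phi> x \<oplus>\<^bsub>Y\<^esub> \<Phi> y)) \<le> Q * (qnorm X x + qnorm X y)"
begin

sublocale Y: qnormed Y by (rule qnormed.intro[OF quasi_banach_quasinormed[OF Y]])
sublocale X: qnormed X by (rule qnormed.intro[OF quasi_banach_quasinormed[OF X]])

abbreviation "T \<equiv> twisted_sum Y X X0 \<Phi>"

lemma X0_carrier [simp]: "x \<in> X0 \<Longrightarrow> x \<in> carrier X"
  using X0_subset by blast

lemma X0_minus: "x \<in> X0 \<Longrightarrow> y \<in> X0 \<Longrightarrow> x \<ominus>\<^bsub>X\<^esub> y \<in> X0"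
  by (simp add: X.minus_alt X0_add X0_smult)

lemma Phi_zero: "\<Phi> \<zero>\<^bsub>X\<^esub> = \<zero>\<^bsub>Y\<^esub>"
  using Phi_smult[OF X0_zero, of 0] by (simp add: Phi_closed X0_zero)

lemma T_simps:
  "carrier T = carrier Y \<times> X0" "\<zero>\<^bsub>T\<^esub> = (\<zero>\<^bsub>Y\<^esub>, \<zero>\<^bsub>X\<^esub>)"
  "(y, x) \<oplus>\<^bsub>T\<^esub> (y', x') = (y \<oplus>\<^bsub>Y\<^esub> y', x \<oplus>\<^bsub>X\<^esub> x')"
  "c \<odot>\<^bsub>T\<^esub> (y, x) = (c \<odot>\<^bsub>Y\<^esub> y, c \<odot>\<^bsub>X\<^esub> x)"
  "qnorm T (y, x) = qnorm Y (y \<ominus>\<^bsub>Y\<^esub> \<Phi> x) + qnorm X x"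
  by (simp_all add: twisted_sum_def)

lemma qnorm_T_add:
  assumes y: "y \<in> carrier Y" "y' \<in> carrier Y" and x: "x \<in> X0" "x' \<in> X0"
  shows "qnorm T (y \<oplus>\<^bsub>Y\<^esub> y', x \<oplus>\<^bsub>X\<^esub> x')
    \<le> (Y.K * (Y.K + Q) + X.K) * (qnorm T (y, x) + qnorm T (y', x'))"
proof -
  define a where "a = qnorm Y (y \<ominus>\<^bsub>Y\<^esub> \<Phi> x) + qnorm Y (y' \<ominus>\<^bsub>Y\<^esub> \<Phi> x')"
  define b where "b = qnorm X x + qnorm X x'"
  note P = Phi_closed[OF x(1)] Phi_closed[OF x(2)] Phi_closed[OF X0_add[OF x]]
  have ab: "0 \<le> a" "0 \<le> b" using y x P by (auto simp: a_def b_def)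
  have "qnorm Y (y \<oplus>\<^bsub>Y\<^esub> y' \<ominus>\<^bsub>Y\<^esub> \<Phi> (x \<oplus>\<^bsub>X\<^esub> x'))
      \<le> Y.K * (qnorm Y (y \<oplus>\<^bsub>Y\<^esub> y' \<ominus>\<^bsub>Y\<^esub> (\<Phi> x \<oplus>\<^bsub>Y\<^esub> \<Phi> x')) + qnorm Y (\<Phi> x \<oplus>\<^bsub>Y\<^esub> \<Phi> x' \<ominus>\<^bsub>Y\<^esub> \<Phi> (x \<oplus>\<^bsub>X\<^esub> x')))"
    using y P by (intro Y.qdist_triangle) auto
  also have "\<dots> \<le> Y.K * (Y.K * a + Q * b)"
  proof (intro mult_left_mono add_mono Y.K_nonneg)
    show "qnorm Y (y \<oplus>\<^bsub>Y\<^esub> y' \<ominus>\<^bsub>Y\<^esub> (\<Phi> x \<oplus>\<^bsub>Y\<^esub> \<Phi> x')) \<le> Y.K * a"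
      unfolding a_def using y P by (intro Y.qdist_add) auto
    show "qnorm Y (\<Phi> x \<oplus>\<^bsub>Y\<^esub> \<Phi> x' \<ominus>\<^bsub>Y\<^esub> \<Phi> (x \<oplus>\<^bsub>X\<^esub> x')) \<le> Q * b"
      using Phi_add[OF x] P Y.qnorm_minus_commute[of "\<Phi> x \<oplus>\<^bsub>Y\<^esub> \<Phi> x'" "\<Phi> (x \<oplus>\<^bsub>X\<^esub> x')"] by (simp add: b_def)
  qed
  also have "\<dots> \<le> Y.K * ((Y.K + Q) * (a + b))"
    using ab Y.K_nonneg Q_nonneg by (intro mult_left_mono) (auto simp: algebra_simps)
  finally have 1: "qnorm Y (y \<oplus>\<^bsub>Y\<^esub> y' \<ominus>\<^bsub>Y\<^esub> \<Phi> (x \<oplus>\<^bsub>X\<^esub> x')) \<le> Y.K * (Y.K + Q) * (a + b)" by simp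
  have "qnorm X (x \<oplus>\<^bsub>X\<^esub> x') \<le> X.K * b" unfolding b_def using x by (intro X.qnorm_add) auto
  also have "\<dots> \<le> X.K * (a + b)" using ab X.K_nonneg by (intro mult_left_mono) auto
  finally have 2: "qnorm X (x \<oplus>\<^bsub>X\<^esub> x') \<le> X.K * (a + b)" .
  have "(Y.K * (Y.K + Q) + X.K) * (a + b) = (Y.K * (Y.K + Q) + X.K) * (qnorm T (y, x) + qnorm T (y', x'))"
    by (simp add: T_simps a_def b_def algebra_simps)
  then show ?thesis using 1 2 by (simp add: T_simps(5) distrib_right)
qed

lemma quasinormed_T: "quasinormed T"
proof (rule quasinormedI[where C = "Y.K * (Y.K + Q) + X.K"])
  fix v assume "v \<in> carrier T"
  then obtain y x where v: "v = (y, x)" "y \<in> carrier Y" "x \<in> X0" by (auto simp: T_simps)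
  note x = v(3) X0_carrier[OF v(3)] Phi_closed[OF v(3)]
  show "c \<odot>\<^bsub>T\<^esub> v \<in> carrier T" for c using v x by (simp add: T_simps X0_smult)
  show "\<zero>\<^bsub>T\<^esub> \<oplus>\<^bsub>T\<^esub> v = v" using v x by (simp add: T_simps)
  show "(- 1) \<odot>\<^bsub>T\<^esub> v \<oplus>\<^bsub>T\<^esub> v = \<zero>\<^bsub>T\<^esub>"
    using v x Y.l_neg[of y] X.l_neg[of x] by (simp add: T_simps Y.uminus_alt X.uminus_alt)
  show "(a + b) \<odot>\<^bsub>T\<^esub> v = a \<odot>\<^bsub>T\<^esub> v \<oplus>\<^bsub>T\<^esub> b \<odot>\<^bsub>T\<^esub> v" for a b
    using v x by (simp add: T_simps Y.smult_ldistr X.smult_ldistr)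
  show "(a * b) \<odot>\<^bsub>T\<^esub> v = a \<odot>\<^bsub>T\<^esub> (b \<odot>\<^bsub>T\<^esub> v)" for a b
    using v x by (simp add: T_simps Y.smult_assoc X.smult_assoc)
  show "1 \<odot>\<^bsub>T\<^esub> v = v" using v x by (simp add: T_simps)
  show "0 \<le> qnorm T v" using v x by (simp add: T_simps)
  show "qnorm T (c \<odot>\<^bsub>T\<^esub> v) = norm c * qnorm T v" for c
    using v x by (simp add: T_simps Phi_smult X.qnorm_smult Y.qdist_smult distrib_left)
  show "v = \<zero>\<^bsub>T\<^esub>" if "qnorm T v = 0"
  proof -
    have "qnorm Y (y \<ominus>\<^bsub>Y\<^esub> \<Phi> x) = 0" "qnorm X x = 0"
      using that v x add_nonneg_eq_0_iff[of "qnorm Y (y \<ominus>\<^bsub>Y\<^esub> \<Phi> x)" "qnorm X x"] by (auto simp: T_simps)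
    then show ?thesis using v x by (simp add: T_simps X.qnorm_eq_0 Phi_zero Y.qnorm_eq_0)
  qed
  fix u assume "u \<in> carrier T"
  then obtain y' x' where u: "u = (y', x')" "y' \<in> carrier Y" "x' \<in> X0" by (auto simp: T_simps)
  note x' = u(3) X0_carrier[OF u(3)] Phi_closed[OF u(3)]
  show "v \<oplus>\<^bsub>T\<^esub> u \<in> carrier T" using v u by (simp add: T_simps X0_add)
  show "v \<oplus>\<^bsub>T\<^esub> u = u \<oplus>\<^bsub>T\<^esub> v" using v u x x' by (simp add: T_simps Y.a_comm X.a_comm)
  show "a \<odot>\<^bsub>T\<^esub> (v \<oplus>\<^bsub>T\<^esub> u) = a \<odot>\<^bsub>T\<^esub> v \<oplus>\<^bsub>T\<^esub> a \<odot>\<^bsub>T\<^esub> u" for a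
    using v u x x' by (simp add: T_simps Y.smult_rdistr X.smult_rdistr)
  show "qnorm T (v \<oplus>\<^bsub>T\<^esub> u) \<le> (Y.K * (Y.K + Q) + X.K) * (qnorm T v + qnorm T u)"
    using v u qnorm_T_add by (simp add: T_simps(3))
  fix w assume "w \<in> carrier T"
  then obtain y'' x'' where w: "w = (y'', x'')" "y'' \<in> carrier Y" "x'' \<in> X0" by (auto simp: T_simps)
  show "v \<oplus>\<^bsub>T\<^esub> u \<oplus>\<^bsub>T\<^esub> w = v \<oplus>\<^bsub>T\<^esub> (u \<oplus>\<^bsub>T\<^esub> w)"
    using v u w by (simp add: T_simps Y.a_assoc X.a_assoc)
qed (simp_all add: T_simps X0_zero Phi_zero)

sublocale T: qnormed T by (rule qnormed.intro[OF quasinormed_T])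

lemma T_minus:
  assumes "y \<in> carrier Y" "y' \<in> carrier Y" "x \<in> X0" "x' \<in> X0"
  shows "(y, x) \<ominus>\<^bsub>T\<^esub> (y', x') = (y \<ominus>\<^bsub>Y\<^esub> y', x \<ominus>\<^bsub>X\<^esub> x')"
  using assms T.minus_alt[of "(y, x)" "(y', x')"] by (simp add: T_simps Y.minus_alt X.minus_alt)

lemma incl_operator: "(\<lambda>y. (y, \<zero>\<^bsub>X\<^esub>)) \<in> operators Y T"
  by (rule operatorsI[where C = 1])
     (auto simp: T_simps X0_zero Phi_zero X.smult_rdistr
       intro: X.eq_if_minus_zero, use X.smult_minus[OF X.zero_closed X.zero_closed] in simp)

lemma snd_operator: "snd \<in> operators T X"
proof (rule operatorsI[where C = 1])
  fix v assume "v \<in> carrier T"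
  then obtain y x where v: "v = (y, x)" "y \<in> carrier Y" "x \<in> X0" by (auto simp: T_simps)
  then show "qnorm X (snd v) \<le> 1 * qnorm T v" by (simp add: T_simps Phi_closed)
qed (auto simp: T_simps)

section \<open>Exactness of the induced sequence\<close>

definition incl :: "'a \<Rightarrow> nat \<Rightarrow> 'a \<times> 'b" where
  "incl y = class_rep T (\<lambda>_. (y, \<zero>\<^bsub>X\<^esub>))"

abbreviation "proj \<equiv> limit_map X snd"

lemma completion_incl_operator: "incl \<in> operators Y (completion T)"
  unfolding incl_def
  by (rule operators_compose[OF incl_operator const_class_operator[OF quasinormed_T] quasinormed_T])

lemma completion_proj_operator: "proj \<in> operators (completion T) X"
  by (rule limit_map_operator[OF snd_operator quasinormed_T X])

lemma qcauchy_incl: "y \<in> carrier Y \<Longrightarrow> qcauchy T (\<lambda>_. (y, \<zero>\<^bsub>X\<^esub>))"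
  by (rule T.qcauchy_const) (simp add: T_simps X0_zero)

lemma incl_inj:
  assumes "y \<in> carrier Y" "incl y = \<zero>\<^bsub>completion T\<^esub>"
  shows "y = \<zero>\<^bsub>Y\<^esub>"
proof -
  have "same_limit T (\<lambda>_. (y, \<zero>\<^bsub>X\<^esub>)) (\<lambda>_. \<zero>\<^bsub>T\<^esub>)"
    using assms T.class_rep_eq_iff[OF qcauchy_incl[OF assms(1)] T.qcauchy_const[OF T.zero_closed]]
    by (simp add: incl_def T.completion_zero)
  then have "qnorm Y y = 0"
    using assms by (simp add: same_limit_def LIMSEQ_const_iff T_simps T_minus X0_zero Phi_zero)
  then show ?thesis using assms by (simp add: Y.qnorm_eq_0)
qed

lemma proj_class_rep: "qcauchy T s \<Longrightarrow> qconverges X (\<lambda>n. snd (s n)) (proj (class_rep T s))"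
  by (rule limit_map_class_rep[OF snd_operator quasinormed_T X])

lemma snd_carrier: "qcauchy T s \<Longrightarrow> snd (s n) \<in> X0" "qcauchy T s \<Longrightarrow> fst (s n) \<in> carrier Y"
  using T.qcauchyD[of s n] by (auto simp: T_simps mem_Times_iff)

lemma proj_eqI: "qcauchy T s \<Longrightarrow> qconverges X (\<lambda>n. snd (s n)) x \<Longrightarrow> proj (class_rep T s) = x"
  using X.qconverges_unique[OF _ proj_class_rep] snd_carrier(1) X0_carrier by blast

lemma proj_const: "y \<in> carrier Y \<Longrightarrow> x \<in> X0 \<Longrightarrow> proj (class_rep T (\<lambda>_. (y, x))) = x"
  by (rule proj_eqI) (auto intro!: T.qcauchy_const simp: T_simps qconverges_def)

lemma proj_incl: "y \<in> carrier Y \<Longrightarrow> proj (incl y) = \<zero>\<^bsub>X\<^esub>"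
  unfolding incl_def by (rule proj_const) (auto simp: X0_zero)

text \<open>Although \<open>x n\<close> tends to zero, \<open>\<Phi> (x n)\<close> need not
  converge. The corrected sequence \<open>y n - \<Phi> (x n)\<close> is nevertheless Cauchy, since
  quasilinearity has an error that vanishes with \<open>x m\<close> and \<open>x n\<close>. If
  \<open>u\<close> is its limit, then \<open>(y n, x n) - (u, 0)\<close> has a quasinorm tending to
  zero.\<close>

lemma kernel_proj:
  assumes "S \<in> carrier (completion T)" "proj S = \<zero>\<^bsub>X\<^esub>"
  obtains y where "y \<in> carrier Y" "S = incl y"
proof -
  obtain s where s: "qcauchy T s" "S = class_rep T s" using T.completion_cases[OF assms(1)] .
  define y where "y n = fst (s n)" for n
  define x where "x n = snd (s n)" for n
  have sn: "s n = (y n, x n)" for n by (simp add: y_def x_def)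
  have y: "y n \<in> carrier Y" and x: "x n \<in> X0" for n using snd_carrier[OF s(1)] by (auto simp: x_def y_def)
  note P = Phi_closed[OF x]
  have x0: "(\<lambda>n. qnorm X (x n)) \<longlonglongrightarrow> 0"
    using proj_class_rep[OF s(1)] assms(2) s(2) x by (simp add: qconverges_def x_def[symmetric])
  define z where "z n = y n \<ominus>\<^bsub>Y\<^esub> \<Phi> (x n)" for n
  have z: "z n \<in> carrier Y" for n using y P by (simp add: z_def)
  \<comment> \<open>The comparison goes through \<open>\<Phi> (x m - x n)\<close>: the quasinorm of
    the twisted sum relates it to \<open>y m - y n\<close>, quasilinearity to
    \<open>\<Phi> (x m) - \<Phi> (x n)\<close>.\<close>
  have zdiff: "qnorm Y (z m \<ominus>\<^bsub>Y\<^esub> z n) \<le> Y.K * (qnorm T (s m \<ominus>\<^bsub>T\<^esub> s n) + Q * (qnorm X (x m) + qnorm X (x n)))" for m n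
  proof -
    define a where "a = y m \<ominus>\<^bsub>Y\<^esub> y n"
    define b where "b = \<Phi> (x m) \<ominus>\<^bsub>Y\<^esub> \<Phi> (x n)"
    define c where "c = \<Phi> (x m \<ominus>\<^bsub>X\<^esub> x n)"
    have abc: "a \<in> carrier Y" "b \<in> carrier Y" "c \<in> carrier Y"
      using y P Phi_closed[OF X0_minus[OF x x]] by (auto simp: a_def b_def c_def)
    have "z m \<ominus>\<^bsub>Y\<^esub> z n = a \<ominus>\<^bsub>Y\<^esub> b"
      using y[of m] y[of n] P[of m] P[of n]
      by (simp add: z_def a_def b_def Y.minus_eq Y.minus_add Y.minus_minus Y.a_ac)
    moreover have "qnorm Y (a \<ominus>\<^bsub>Y\<^esub> b) \<le> Y.K * (qnorm Y (a \<ominus>\<^bsub>Y\<^esub> c) + qnorm Y (c \<ominus>\<^bsub>Y\<^esub> b))"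
      using abc by (intro Y.qdist_triangle)
    moreover have "qnorm Y (a \<ominus>\<^bsub>Y\<^esub> c) \<le> qnorm T (s m \<ominus>\<^bsub>T\<^esub> s n)"
      using x y by (simp add: sn T_minus T_simps a_def c_def)
    moreover have "qnorm Y (c \<ominus>\<^bsub>Y\<^esub> b) \<le> Q * (qnorm X (x m) + qnorm X (x n))"
      using Phi_add[OF x[of m] X0_smult[OF x[of n], of "- 1"]] x P
      by (simp add: c_def b_def X.minus_alt Y.minus_alt Phi_smult X.qnorm_smult)
    ultimately show ?thesis
      using Y.K_nonneg by (smt (verit) mult_left_mono)
  qed
  have "qcauchy Y z"
    unfolding qcauchy_def
  proof (intro conjI allI impI z)
    fix e :: real assume e: "0 < e"
    define c where "c = Y.K * (1 + 2 * Q)"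
    have c: "0 < c" using Y.K_pos Q_nonneg by (simp add: c_def)
    define d where "d = e / c"
    have d: "0 < d" using e c by (simp add: d_def)
    obtain N1 where N1: "\<And>m n. m \<ge> N1 \<Longrightarrow> n \<ge> N1 \<Longrightarrow> qnorm T (s m \<ominus>\<^bsub>T\<^esub> s n) < d"
      using s(1) d unfolding qcauchy_def by blast
    obtain N2 where N2: "\<And>n. n \<ge> N2 \<Longrightarrow> qnorm X (x n) < d"
      using LIMSEQ_D[OF x0 d] x by auto
    have "qnorm Y (z m \<ominus>\<^bsub>Y\<^esub> z n) < e" if "m \<ge> max N1 N2" "n \<ge> max N1 N2" for m n
    proof -
      have "Q * (qnorm X (x m) + qnorm X (x n)) \<le> Q * (d + d)"
        using N2[of m] N2[of n] that Q_nonneg by (intro mult_left_mono) auto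
      then have "qnorm T (s m \<ominus>\<^bsub>T\<^esub> s n) + Q * (qnorm X (x m) + qnorm X (x n)) < d + Q * (d + d)"
        using N1[of m n] that by simp
      then have "Y.K * (qnorm T (s m \<ominus>\<^bsub>T\<^esub> s n) + Q * (qnorm X (x m) + qnorm X (x n))) < Y.K * (d + Q * (d + d))"
        using Y.K_pos by (intro mult_strict_left_mono)
      also have "\<dots> = d * c" by (simp add: c_def algebra_simps)
      also have "\<dots> = e" using c by (simp add: d_def)
      finally show ?thesis using zdiff[of m n] by simp
    qed
    then show "\<exists>N. \<forall>m\<ge>N. \<forall>n\<ge>N. qnorm Y (z m \<ominus>\<^bsub>Y\<^esub> z n) < e" by blast
  qed
  then obtain u where u: "qconverges Y z u" using Y unfolding quasi_banach_def by blast
  then have u0: "u \<in> carrier Y" and zu: "(\<lambda>n. qnorm Y (z n \<ominus>\<^bsub>Y\<^esub> u)) \<longlonglongrightarrow> 0" by (auto simp: qconverges_def)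
  have "qnorm T (s n \<ominus>\<^bsub>T\<^esub> (u, \<zero>\<^bsub>X\<^esub>)) = qnorm Y (z n \<ominus>\<^bsub>Y\<^esub> u) + qnorm X (x n)" for n
  proof -
    have "(y n \<ominus>\<^bsub>Y\<^esub> u) \<ominus>\<^bsub>Y\<^esub> \<Phi> (x n) = z n \<ominus>\<^bsub>Y\<^esub> u"
      using y[of n] u0 P[of n] by (simp add: z_def Y.minus_eq Y.a_ac)
    then show ?thesis using y u0 x by (simp add: sn T_minus T_simps X0_zero)
  qed
  then have "same_limit T s (\<lambda>_. (u, \<zero>\<^bsub>X\<^esub>))"
    unfolding same_limit_def using tendsto_add[OF zu x0] by simp
  then have "S = incl u"
    unfolding s(2) incl_def using T.class_rep_eq_iff[OF s(1) qcauchy_incl[OF u0]] by simp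
  then show ?thesis using that u0 by blast
qed

text \<open>For approximations \<open>a n\<close> of \<open>x\<close> the pairs
  \<open>(\<Phi> (a n), a n)\<close> need not form a Cauchy sequence. Adding up increments repairs
  this: a pair \<open>(\<Phi> \<delta>, \<delta>)\<close> has the quasinorm of
  \<open>\<delta>\<close> alone, so the partial sums converge once the increments of
  \<open>a\<close> decay fast enough.\<close>

lemma proj_surj:
  assumes x: "x \<in> carrier X"
  shows "\<exists>S\<in>carrier (completion T). proj S = x"
proof -
  \<comment> \<open>With \<open>2 * T.K * r = 1\<close> the bound \<open>2 * T.K * r ^ n\<close> for
    the tails reproduces itself under the quasi-triangle inequality:
    \<open>T.K * (2 * T.K * r ^ Suc n + r ^ n) = 2 * T.K * r ^ n\<close>.\<close>
  define r where "r = 1 / (2 * T.K)"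
  have r: "0 < r" "r \<le> 1" "2 * T.K * r = 1" using T.K_ge_1 by (auto simp: r_def)
  have "\<forall>n. \<exists>a. a \<in> X0 \<and> qnorm X (a \<ominus>\<^bsub>X\<^esub> x) < r ^ n / (2 * X.K)"
    using dense[OF x] r X.K_pos by (metis (no_types) divide_pos_pos mult_pos_pos zero_less_numeral zero_less_power)
  then obtain a where a: "\<And>n. a n \<in> X0" "\<And>n. qnorm X (a n \<ominus>\<^bsub>X\<^esub> x) < r ^ n / (2 * X.K)" by metis
  define \<delta> where "\<delta> n = a (Suc n) \<ominus>\<^bsub>X\<^esub> a n" for n
  have \<delta>: "\<delta> n \<in> X0" for n using a by (simp add: \<delta>_def X0_minus)
  have \<delta>n: "qnorm X (\<delta> n) \<le> r ^ n" for n
  proof -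
    have "qnorm X (\<delta> n) \<le> X.K * (qnorm X (a (Suc n) \<ominus>\<^bsub>X\<^esub> x) + qnorm X (a n \<ominus>\<^bsub>X\<^esub> x))"
      unfolding \<delta>_def using X.qdist_triangle[of "a (Suc n)" x "a n"] X.qnorm_minus_commute[of x "a n"] a x by simp
    also have "\<dots> \<le> X.K * (r ^ n / (2 * X.K) + r ^ n / (2 * X.K))"
    proof (intro mult_left_mono add_mono X.K_nonneg)
      have "r ^ Suc n / (2 * X.K) \<le> r ^ n / (2 * X.K)"
        using r X.K_pos by (intro divide_right_mono power_decreasing) auto
      then show "qnorm X (a (Suc n) \<ominus>\<^bsub>X\<^esub> x) \<le> r ^ n / (2 * X.K)" using a(2)[of "Suc n"] by linarith
    qed (use a(2)[of n] in simp)
    also have "\<dots> = r ^ n" using X.K_pos by simp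
    finally show ?thesis .
  qed
  define y where "y = rec_nat \<zero>\<^bsub>Y\<^esub> (\<lambda>n v. v \<oplus>\<^bsub>Y\<^esub> \<Phi> (\<delta> n))"
  have y_Suc: "y (Suc n) = y n \<oplus>\<^bsub>Y\<^esub> \<Phi> (\<delta> n)" for n by (simp add: y_def)
  have y: "y n \<in> carrier Y" for n
  proof (induction n)
    case 0 then show ?case by (simp add: y_def)
  next
    case (Suc n) then show ?case by (simp add: y_Suc Phi_closed \<delta>)
  qed
  define u where "u n = (y n, a n)" for n
  have u: "u n \<in> carrier T" for n by (simp add: u_def T_simps y a)
  have step: "qnorm T (u (Suc n) \<ominus>\<^bsub>T\<^esub> u n) \<le> r ^ n" for n
  proof -
    have "y (Suc n) \<ominus>\<^bsub>Y\<^esub> y n = \<Phi> (\<delta> n)"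
      using y[of n] Phi_closed[OF \<delta>[of n]] by (simp add: y_Suc Y.minus_eq Y.a_comm[of "y n"] Y.a_assoc Y.r_neg)
    then have "u (Suc n) \<ominus>\<^bsub>T\<^esub> u n = (\<Phi> (\<delta> n), \<delta> n)" using y a by (simp add: u_def T_minus \<delta>_def)
    then show ?thesis using \<delta>n[of n] Phi_closed[OF \<delta>] by (simp add: T_simps)
  qed
  have far: "qnorm T (u (n + j) \<ominus>\<^bsub>T\<^esub> u n) \<le> 2 * T.K * r ^ n" for n j
  proof (induction j arbitrary: n)
    case 0 then show ?case using u r T.K_nonneg by simp
  next
    case (Suc j)
    have "qnorm T (u (n + Suc j) \<ominus>\<^bsub>T\<^esub> u n)
       \<le> T.K * (qnorm T (u (Suc n + j) \<ominus>\<^bsub>T\<^esub> u (Suc n)) + qnorm T (u (Suc n) \<ominus>\<^bsub>T\<^esub> u n))"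
      using T.qdist_triangle[OF u u u] by simp
    also have "\<dots> \<le> T.K * (2 * T.K * r ^ Suc n + r ^ n)"
      using Suc.IH[of "Suc n"] step T.K_nonneg by (intro mult_left_mono add_mono)
    also have "2 * T.K * r ^ Suc n = r ^ n" using r by simp
    finally show ?case by simp
  qed
  have "qcauchy T u"
    unfolding qcauchy_def
  proof (intro conjI allI impI u)
    fix e :: real assume e: "0 < e"
    have r1: "r < 1" using T.K_ge_1 by (auto simp: r_def)
    then obtain N where N: "r ^ N < e / (2 * T.K)"
      using real_arch_pow_inv[of "e / (2 * T.K)" r] e T.K_pos by auto
    have *: "qnorm T (u m \<ominus>\<^bsub>T\<^esub> u n) < e" if "n \<ge> N" "m \<ge> n" for m n
    proof -
      have "qnorm T (u m \<ominus>\<^bsub>T\<^esub> u n) \<le> 2 * T.K * r ^ n" using far[of n "m - n"] that by simp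
      also have "\<dots> \<le> 2 * T.K * r ^ N"
        using that r T.K_nonneg by (intro mult_left_mono power_decreasing) auto
      also have "\<dots> < e" using N T.K_pos by (simp add: field_simps)
      finally show ?thesis .
    qed
    have "qnorm T (u m \<ominus>\<^bsub>T\<^esub> u n) < e" if "n \<ge> N" "m \<ge> N" for m n
      using *[of n m] *[of m n] that T.qnorm_minus_commute[OF u u, of m n] by (cases "m \<ge> n") auto
    then show "\<exists>N. \<forall>m\<ge>N. \<forall>n\<ge>N. qnorm T (u m \<ominus>\<^bsub>T\<^esub> u n) < e" by blast
  qed
  moreover have "qconverges X (\<lambda>n. snd (u n)) x"
    unfolding qconverges_def
  proof (intro conjI x)
    have "(\<lambda>n. r ^ n) \<longlonglongrightarrow> 0" using r T.K_ge_1 by (intro LIMSEQ_power_zero) (auto simp: r_def)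
    then show "(\<lambda>n. qnorm X (snd (u n) \<ominus>\<^bsub>X\<^esub> x)) \<longlonglongrightarrow> 0"
      by (rule null_sequence_le[where C = "1 / (2 * X.K)"])
         (use a x in \<open>auto simp: u_def less_imp_le\<close>)
  qed
  ultimately show ?thesis using proj_eqI by blast
qed

end

text \<open>\<open>T y - \<Phi> x\<close> is the sum of \<open>T (y - \<Psi> x)\<close>, bounded
  since \<open>T\<close> is, and \<open>T (\<Psi> x) - \<Phi> x\<close>, bounded by hypothesis. This
  is the pushout map along \<open>T\<close>, up to a bounded perturbation of the quasilinear
  map.\<close>

lemma twisted_map_operator:
  assumes T1: "twisted Y X X0 \<Psi> Q" and T2: "twisted Y' X X0 \<Phi> Q'"
    and T: "T \<in> operators Y Y'" and near: "\<And>x. x \<in> X0 \<Longrightarrow> qnorm Y' (T (\<Psi> x) \<ominus>\<^bsub>Y'\<^esub> \<Phi> x) \<le> C * qnorm X x"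
  shows "map_prod T (\<lambda>x. x) \<in> operators (twisted_sum Y X X0 \<Psi>) (twisted_sum Y' X X0 \<Phi>)"
proof -
  interpret A: twisted Y X X0 \<Psi> Q by fact
  interpret B: twisted Y' X X0 \<Phi> Q' by fact
  obtain D where D: "0 \<le> D" "\<And>y. y \<in> carrier Y \<Longrightarrow> qnorm Y' (T y) \<le> D * qnorm Y y"
    using operators_bound[OF T A.Y.quasinormed] by blast
  define L where "L = B.Y.K * (D + \<bar>C\<bar>) + 1"
  show ?thesis
  proof (rule operatorsI[where C = L])
    fix v assume "v \<in> carrier A.T"
    then obtain y x where v: "v = (y, x)" "y \<in> carrier Y" "x \<in> X0" by (auto simp: A.T_simps)
    note c = A.Phi_closed[OF v(3)] B.Phi_closed[OF v(3)]
    show "map_prod T (\<lambda>x. x) v \<in> carrier B.T" using v by (simp add: B.T_simps operators_closed[OF T])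
    show "map_prod T (\<lambda>x. x) (c \<odot>\<^bsub>A.T\<^esub> v) = c \<odot>\<^bsub>B.T\<^esub> map_prod T (\<lambda>x. x) v" for c
      using v by (simp add: A.T_simps B.T_simps operators_smult[OF T])
    have "qnorm Y' (T y \<ominus>\<^bsub>Y'\<^esub> \<Phi> x) \<le> B.Y.K * (qnorm Y' (T y \<ominus>\<^bsub>Y'\<^esub> T (\<Psi> x)) + qnorm Y' (T (\<Psi> x) \<ominus>\<^bsub>Y'\<^esub> \<Phi> x))"
      using v c by (intro B.Y.qdist_triangle) (auto simp: operators_closed[OF T])
    also have "\<dots> \<le> B.Y.K * (D * qnorm Y (y \<ominus>\<^bsub>Y\<^esub> \<Psi> x) + \<bar>C\<bar> * qnorm X x)"
    proof (intro mult_left_mono add_mono B.Y.K_nonneg)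
      show "qnorm Y' (T y \<ominus>\<^bsub>Y'\<^esub> T (\<Psi> x)) \<le> D * qnorm Y (y \<ominus>\<^bsub>Y\<^esub> \<Psi> x)"
        using D(2)[of "y \<ominus>\<^bsub>Y\<^esub> \<Psi> x"] v c operators_minus[OF T A.Y.quasinormed B.Y.quasinormed] by simp
      show "qnorm Y' (T (\<Psi> x) \<ominus>\<^bsub>Y'\<^esub> \<Phi> x) \<le> \<bar>C\<bar> * qnorm X x"
        using near[OF v(3)] v mult_right_mono[OF abs_ge_self[of C], of "qnorm X x"] by simp
    qed
    also have "\<dots> \<le> B.Y.K * ((D + \<bar>C\<bar>) * (qnorm Y (y \<ominus>\<^bsub>Y\<^esub> \<Psi> x) + qnorm X x))"
      using D v c by (intro mult_left_mono B.Y.K_nonneg) (auto simp: algebra_simps)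
    finally have "qnorm Y' (T y \<ominus>\<^bsub>Y'\<^esub> \<Phi> x) \<le> B.Y.K * (D + \<bar>C\<bar>) * (qnorm Y (y \<ominus>\<^bsub>Y\<^esub> \<Psi> x) + qnorm X x)" by simp
    moreover have "qnorm X x \<le> 1 * (qnorm Y (y \<ominus>\<^bsub>Y\<^esub> \<Psi> x) + qnorm X x)" using v c by simp
    ultimately show "qnorm B.T (map_prod T (\<lambda>x. x) v) \<le> L * qnorm A.T v"
      unfolding L_def distrib_right using v by (simp add: A.T_simps B.T_simps)
    fix u assume "u \<in> carrier A.T"
    then obtain y' x' where u: "u = (y', x')" "y' \<in> carrier Y" "x' \<in> X0" by (auto simp: A.T_simps)
    show "map_prod T (\<lambda>x. x) (v \<oplus>\<^bsub>A.T\<^esub> u) = map_prod T (\<lambda>x. x) v \<oplus>\<^bsub>B.T\<^esub> map_prod T (\<lambda>x. x) u"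
      using v u by (simp add: A.T_simps B.T_simps operators_add[OF T])
  qed
qed

text \<open>The direct sum is the twisted sum by the zero map on all of \<open>X\<close>. It is
  complete as it stands and can be a middle term without passing to a completion.\<close>

lemma quasi_banach_product:
  assumes Y: "quasi_banach Y" and X: "quasi_banach X"
  shows "twisted Y X (carrier X) (\<lambda>_. \<zero>\<^bsub>Y\<^esub>) 0" "quasi_banach (twisted_sum Y X (carrier X) (\<lambda>_. \<zero>\<^bsub>Y\<^esub>))"
proof -
  interpret Y: qnormed Y by (rule qnormed.intro[OF quasi_banach_quasinormed[OF Y]])
  interpret X: qnormed X by (rule qnormed.intro[OF quasi_banach_quasinormed[OF X]])
  have smz: "c \<odot>\<^bsub>Y\<^esub> \<zero>\<^bsub>Y\<^esub> = \<zero>\<^bsub>Y\<^esub>" for c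
    using Y.smult_minus[OF Y.zero_closed Y.zero_closed, of c] by simp
  show tw: "twisted Y X (carrier X) (\<lambda>_. \<zero>\<^bsub>Y\<^esub>) 0"
  proof
    fix x and e :: real assume "x \<in> carrier X" "0 < e"
    then show "\<exists>x0\<in>carrier X. qnorm X (x0 \<ominus>\<^bsub>X\<^esub> x) < e" by (intro bexI[of _ x]) auto
  qed (auto simp: assms smz)
  interpret P: twisted Y X "carrier X" "\<lambda>_. \<zero>\<^bsub>Y\<^esub>" 0 by (rule tw)
  show "quasi_banach P.T"
    unfolding quasi_banach_def
  proof (intro conjI allI impI P.quasinormed_T)
    fix s assume s: "qcauchy P.T s"
    define y where "y n = fst (s n)" for n
    define x where "x n = snd (s n)" for n
    have sn: "s n = (y n, x n)" for n by (simp add: y_def x_def)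
    have y: "y n \<in> carrier Y" and x: "x n \<in> carrier X" for n
      using P.snd_carrier[OF s] by (auto simp: x_def y_def)
    have d: "qnorm P.T (s m \<ominus>\<^bsub>P.T\<^esub> s n) = qnorm Y (y m \<ominus>\<^bsub>Y\<^esub> y n) + qnorm X (x m \<ominus>\<^bsub>X\<^esub> x n)" for m n
      using x y by (simp add: sn P.T_minus P.T_simps)
    have d': "qnorm Y (y m \<ominus>\<^bsub>Y\<^esub> y n) \<le> qnorm P.T (s m \<ominus>\<^bsub>P.T\<^esub> s n)"
      "qnorm X (x m \<ominus>\<^bsub>X\<^esub> x n) \<le> qnorm P.T (s m \<ominus>\<^bsub>P.T\<^esub> s n)" for m n
      using x y unfolding d by auto
    have "qcauchy Y y" "qcauchy X x"
      using s y x d' unfolding qcauchy_def by (meson order_le_less_trans)+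
    then obtain a b where ab: "qconverges Y y a" "qconverges X x b"
      using assms unfolding quasi_banach_def by blast
    then have "qconverges P.T s (a, b)"
      using x y tendsto_add[of "\<lambda>n. qnorm Y (y n \<ominus>\<^bsub>Y\<^esub> a)" 0 _ "\<lambda>n. qnorm X (x n \<ominus>\<^bsub>X\<^esub> b)" 0]
      unfolding qconverges_def by (auto simp: sn P.T_minus P.T_simps)
    then show "\<exists>x. qconverges P.T s x" by blast
  qed
qed

section \<open>Induced sequences after coding\<close>

lemma quasi_banach_Z_space: "twisted Y X X0 \<Phi> Q \<Longrightarrow> quasi_banach (Z_space Y X X0 \<Phi>)"
  unfolding Z_space_def
  by (intro quasi_banach_transport inj_code_seq qnormed.quasi_banach_completion qnormed.intro
      twisted.quasinormed_T)

lemma Z_incl_eq: "twisted Y X X0 \<Phi> Q \<Longrightarrow> Z_incl Y X X0 \<Phi> y = code_seq (twisted.incl Y X X0 \<Phi> y)"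
  by (simp add: Z_incl_def twisted.incl_def)

lemma Z_proj_eq: "Z_proj X z = limit_map X snd (inv_into UNIV code_seq z)"
  by (simp add: Z_proj_def limit_map_def)

lemma Z_proj_code_seq [simp]: "Z_proj X (code_seq s) = limit_map X snd s"
  by (simp add: Z_proj_eq inv_f_f[OF inj_code_seq])

lemma Z_incl_operator:
  assumes "twisted Y X X0 \<Phi> Q"
  shows "Z_incl Y X X0 \<Phi> \<in> operators Y (Z_space Y X X0 \<Phi>)"
  using operators_to_transport[OF inj_code_seq twisted.completion_incl_operator[OF assms]]
  by (simp add: Z_space_def Z_incl_eq[OF assms, abs_def])

lemma Z_proj_operator:
  assumes "twisted Y X X0 \<Phi> Q"
  shows "Z_proj X \<in> operators (Z_space Y X X0 \<Phi>) X"
  using operators_from_transport[OF inj_code_seq twisted.completion_proj_operator[OF assms]]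
  by (simp add: Z_space_def Z_proj_eq[abs_def])

lemma Z_incl_eq_zero_iff:
  assumes "twisted Y X X0 \<Phi> Q" "y \<in> carrier Y"
  shows "Z_incl Y X X0 \<Phi> y = \<zero>\<^bsub>Z_space Y X X0 \<Phi>\<^esub> \<longleftrightarrow> y = \<zero>\<^bsub>Y\<^esub>"
proof -
  interpret twisted Y X X0 \<Phi> Q by fact
  show ?thesis
    using incl_inj[OF assms(2)] operators_zero[OF completion_incl_operator Y.quasinormed T.quasinormed_completion]
    by (auto simp: Z_incl_eq[OF assms(1)] Z_space_def transport_simps[OF inj_code_seq] inj_eq[OF inj_code_seq])
qed

lemma Z_proj_incl:
  assumes "twisted Y X X0 \<Phi> Q" "y \<in> carrier Y"
  shows "Z_proj X (Z_incl Y X X0 \<Phi> y) = \<zero>\<^bsub>X\<^esub>"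
  by (simp add: Z_incl_eq[OF assms(1)] twisted.proj_incl[OF assms])

lemma kernel_Z_proj:
  assumes "twisted Y X X0 \<Phi> Q"
  shows "{z \<in> carrier (Z_space Y X X0 \<Phi>). Z_proj X z = \<zero>\<^bsub>X\<^esub>} = Z_incl Y X X0 \<Phi> ` carrier Y"
proof -
  interpret twisted Y X X0 \<Phi> Q by fact
  show ?thesis
  proof (intro equalityI subsetI)
    fix z assume "z \<in> {z \<in> carrier (Z_space Y X X0 \<Phi>). Z_proj X z = \<zero>\<^bsub>X\<^esub>}"
    then obtain S where S: "z = code_seq S" "S \<in> carrier (completion T)" "proj S = \<zero>\<^bsub>X\<^esub>"
      by (auto simp: Z_space_def transport_simps[OF inj_code_seq])
    then obtain y where "y \<in> carrier Y" "S = incl y" using kernel_proj by blast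
    then show "z \<in> Z_incl Y X X0 \<Phi> ` carrier Y" using S by (auto simp: Z_incl_eq[OF assms])
  qed (use operators_closed[OF Z_incl_operator[OF assms]] Z_proj_incl[OF assms] in auto)
qed

lemma Z_proj_surj:
  assumes "twisted Y X X0 \<Phi> Q"
  shows "Z_proj X ` carrier (Z_space Y X X0 \<Phi>) = carrier X"
proof -
  interpret twisted Y X X0 \<Phi> Q by fact
  show ?thesis
  proof (intro equalityI subsetI)
    fix x assume "x \<in> carrier X"
    then obtain S where "S \<in> carrier (completion T)" "proj S = x" using proj_surj by blast
    then show "x \<in> Z_proj X ` carrier (Z_space Y X X0 \<Phi>)"
      by (auto simp: Z_space_def transport_simps[OF inj_code_seq] image_image)
  qed (use operators_closed[OF Z_proj_operator[OF assms]] in auto)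
qed

text \<open>As \<open>Z_proj E\<close> is onto and \<open>Z_incl E X X0 \<Psi>\<close> is injective,
  the composite has the kernel of the former and the image of the latter.\<close>

lemma spliced_sequence_exact:
  assumes A: "twisted Y E E0 \<Phi> Q" and B: "twisted E X X0 \<Psi> R"
  shows "spliced_sequence Y E E0 X X0 \<Phi> \<Psi> \<in> exact_sequences X Y"
proof -
  interpret A: twisted Y E E0 \<Phi> Q by fact
  interpret B: twisted E X X0 \<Psi> R by fact
  note pc = operators_closed[OF Z_proj_operator[OF A]]
  have "(\<lambda>z. Z_incl E X X0 \<Psi> (Z_proj E z)) \<in> operators (Z_space Y E E0 \<Phi>) (Z_space E X X0 \<Psi>)"
    by (rule operators_compose[OF Z_proj_operator[OF A] Z_incl_operator[OF B] A.X.quasinormed])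
  moreover have "{z \<in> carrier (Z_space Y E E0 \<Phi>). Z_incl E X X0 \<Psi> (Z_proj E z) = \<zero>\<^bsub>Z_space E X X0 \<Psi>\<^esub>}
      = Z_incl Y E E0 \<Phi> ` carrier Y"
    using Z_incl_eq_zero_iff[OF B pc] by (simp add: kernel_Z_proj[OF A, symmetric] cong: conj_cong)
  moreover have "(\<lambda>z. Z_incl E X X0 \<Psi> (Z_proj E z)) ` carrier (Z_space Y E E0 \<Phi>) = Z_incl E X X0 \<Psi> ` carrier E"
    by (simp add: Z_proj_surj[OF A, symmetric] image_image)
  ultimately show ?thesis
    using Z_incl_eq_zero_iff[OF A]
    by (auto simp: exact_sequences_def spliced_sequence_def a_kernel_def' o_def A.Y B.X
        quasi_banach_Z_space[OF A] quasi_banach_Z_space[OF B] Z_incl_operator[OF A] Z_proj_operator[OF B]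
        kernel_Z_proj[OF B] Z_proj_surj[OF B])
qed

section \<open>Arrows between four-term sequences\<close>

lemma ext2_arrowI:
  assumes "E \<in> exact_sequences X Y" "F \<in> exact_sequences X Y"
    "u1 \<in> operators (mid1 E) (mid1 F)" "u2 \<in> operators (mid2 E) (mid2 F)"
    "\<And>y. y \<in> carrier Y \<Longrightarrow> u1 (arr1 E y) = arr1 F y"
    "\<And>e. e \<in> carrier (mid1 E) \<Longrightarrow> u2 (arr2 E e) = arr2 F (u1 e)"
    "\<And>e. e \<in> carrier (mid2 E) \<Longrightarrow> arr3 F (u2 e) = arr3 E e"
  shows "(E, F) \<in> ext2_arrow X Y"
  using assms unfolding ext2_arrow_def by blast

lemma ext2_zero_exact:
  assumes Y: "quasi_banach Y" and X: "quasi_banach X"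
  shows "ext2_zero X Y \<in> exact_sequences X Y"
proof -
  interpret Y: qnormed Y by (rule qnormed.intro[OF quasi_banach_quasinormed[OF Y]])
  interpret X: qnormed X by (rule qnormed.intro[OF quasi_banach_quasinormed[OF X]])
  have "(\<lambda>y. y) \<in> operators Y Y" "(\<lambda>x. x) \<in> operators X X"
    by (rule operatorsI[where C = 1]; simp)+
  moreover have "(\<lambda>_. \<zero>\<^bsub>X\<^esub>) \<in> operators Y X"
    using X.smult_minus[OF X.zero_closed X.zero_closed] by (intro operatorsI[where C = 0]) auto
  ultimately show ?thesis using Y X Y.zero_closed
    by (auto simp: exact_sequences_def ext2_zero_def a_kernel_def')
qed

text \<open>A lift of \<open>\<Phi>'\<close> to \<open>Z(\<Phi>)\<close> gives an extension \<open>Z(\<Psi>)\<close> of \<open>X\<close> by \<open>Z(\<Phi>)\<close>. The sequence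
  \<open>0 \<rightarrow> Y \<rightarrow> Y \<oplus> Z(\<Phi>) \<rightarrow> Z(\<Psi>) \<rightarrow> X \<rightarrow> 0\<close> has arrows to the spliced sequence and to zero.\<close>

lemma lift_imp_ext2_trivial:
  fixes Y :: "'k::real_normed_field space"
  assumes A: "twisted Y E E0 \<Phi> Q" and B: "twisted E X X0 \<Phi>' R"
    and W: "twisted (Z_space Y E E0 \<Phi>) X X0 \<Psi> S"
    and near: "\<And>x. x \<in> X0 \<Longrightarrow> qnorm E (Z_proj E (\<Psi> x) \<ominus>\<^bsub>E\<^esub> \<Phi>' x) \<le> C * qnorm X x"
  shows "ext2_trivial X Y (spliced_sequence Y E E0 X X0 \<Phi> \<Phi>')"
proof -
  interpret A: twisted Y E E0 \<Phi> Q by fact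
  interpret B: twisted E X X0 \<Phi>' R by fact
  define Z where "Z = Z_space Y E E0 \<Phi>"
  interpret W: twisted Z X X0 \<Psi> S using W by (simp add: Z_def)
  note WZ = W.twisted_axioms
  note P = quasi_banach_product[OF A.Y W.Y]
  interpret P: twisted Y Z "carrier Z" "\<lambda>_. \<zero>\<^bsub>Y\<^esub>" 0 by (rule P(1))
  note iA = Z_incl_operator[OF A, folded Z_def] and pA = Z_proj_operator[OF A, folded Z_def]
  \<comment> \<open>The middle terms of a zigzag share the carrier type
    \<open>nat \<Rightarrow> 'k\<close>, so the direct sum is coded by interleaving.\<close>
  define M where "M = transport code_pair P.T"
  define G where "G = Z_space Z X X0 \<Psi>"
  define N where "N = Z_space E X X0 \<Phi>'"
  note iW = Z_incl_operator[OF WZ, folded G_def] and pW = Z_proj_operator[OF WZ, folded G_def]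
  have qM: "quasi_banach M" unfolding M_def by (rule quasi_banach_transport[OF inj_code_pair P(2)])
  have qG: "quasi_banach G" unfolding G_def by (rule quasi_banach_Z_space[OF WZ])
  have M_simps: "carrier M = code_pair ` (carrier Y \<times> carrier Z)" "\<zero>\<^bsub>M\<^esub> = code_pair (\<zero>\<^bsub>Y\<^esub>, \<zero>\<^bsub>Z\<^esub>)"
    unfolding M_def transport_simps[OF inj_code_pair] P.T_simps by auto
  define dec where "dec = inv_into UNIV (code_pair :: _ \<Rightarrow> nat \<Rightarrow> 'k)"
  have dec [simp]: "dec (code_pair v) = v" for v by (simp add: dec_def inv_f_f[OF inj_code_pair])
  have fstP: "fst \<in> operators P.T Y"
    by (rule operatorsI[where C = 1]) (auto simp: P.T_simps)
  have fstM: "(\<lambda>w. fst (dec w)) \<in> operators M Y" and sndM: "(\<lambda>w. snd (dec w)) \<in> operators M Z"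
    unfolding M_def dec_def
    using operators_from_transport[OF inj_code_pair fstP] operators_from_transport[OF inj_code_pair P.snd_operator]
    by auto
  define F where "F = \<lparr>mid1 = M, mid2 = G, arr1 = (\<lambda>y. code_pair (y, \<zero>\<^bsub>Z\<^esub>)),
     arr2 = (\<lambda>w. Z_incl Z X X0 \<Psi> (snd (dec w))), arr3 = Z_proj X\<rparr>"
  have F: "F \<in> exact_sequences X Y"
  proof -
    have a1: "(\<lambda>y. code_pair (y, \<zero>\<^bsub>Z\<^esub>)) \<in> operators Y M"
      unfolding M_def by (rule operators_to_transport[OF inj_code_pair P.incl_operator])
    have a2: "(\<lambda>w. Z_incl Z X X0 \<Psi> (snd (dec w))) \<in> operators M G"
      by (rule operators_compose[OF sndM iW W.Y.quasinormed])
    have k1: "{y \<in> carrier Y. code_pair (y, \<zero>\<^bsub>Z\<^esub>) = \<zero>\<^bsub>M\<^esub>} = {\<zero>\<^bsub>Y\<^esub>}"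
      by (auto simp: M_simps inj_eq[OF inj_code_pair])
    have k2: "{w \<in> carrier M. Z_incl Z X X0 \<Psi> (snd (dec w)) = \<zero>\<^bsub>G\<^esub>} = (\<lambda>y. code_pair (y, \<zero>\<^bsub>Z\<^esub>)) ` carrier Y"
      using Z_incl_eq_zero_iff[OF WZ, folded G_def] by (auto simp: M_simps)
    have k3: "(\<lambda>w. Z_incl Z X X0 \<Psi> (snd (dec w))) ` carrier M = Z_incl Z X X0 \<Psi> ` carrier Z"
    proof -
      have "(\<lambda>w. snd (dec w)) ` carrier M = snd ` (carrier Y \<times> carrier Z)"
        by (simp add: M_simps image_image)
      also have "\<dots> = carrier Z" using A.Y.zero_closed by (metis empty_iff snd_image_times)
      finally have "(\<lambda>w. snd (dec w)) ` carrier M = carrier Z" .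
      then show ?thesis by (metis image_image)
    qed
    show ?thesis
      unfolding exact_sequences_def a_kernel_def'
      using A.Y B.X qM qG a1 a2 pW k1 k2 k3 kernel_Z_proj[OF WZ, folded G_def] Z_proj_surj[OF WZ, folded G_def]
      by (simp add: F_def)
  qed
  have mp: "map_prod (Z_proj E) (\<lambda>x. x) \<in> operators W.T B.T"
    by (rule twisted_map_operator[OF WZ B pA]) (rule near)
  \<comment> \<open>Induced by \<open>(z, x) \<mapsto> (Z_proj E z, x)\<close>, which is bounded
    because \<open>\<Psi>\<close> lifts \<open>\<Phi>'\<close> up to a bounded error.\<close>
  define u2 where "u2 z = code_seq (completion_map B.T (map_prod (Z_proj E) (\<lambda>x. x)) (inv_into UNIV code_seq z))" for z
  have u2_op: "u2 \<in> operators G N"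
    unfolding u2_def[abs_def] G_def N_def Z_space_def
    using operators_from_transport[OF inj_code_seq
        operators_to_transport[OF inj_code_seq completion_map_operator[OF mp W.quasinormed_T B.quasinormed_T]]] .
  have u2_class: "u2 (code_seq (class_rep W.T s)) = code_seq (class_rep B.T (\<lambda>n. map_prod (Z_proj E) (\<lambda>x. x) (s n)))"
    if "qcauchy W.T s" for s
    using completion_map_class_rep[OF mp W.quasinormed_T B.quasinormed_T that]
    by (simp add: u2_def inv_f_f[OF inj_code_seq])
  \<comment> \<open>On the summand \<open>Y\<close> this has to be the inclusion, to match the first
    arrows; the second square is not disturbed, because \<open>Z_proj E\<close> kills that
    inclusion.\<close>
  define u1 where "u1 w = Z_incl Y E E0 \<Phi> (fst (dec w)) \<oplus>\<^bsub>Z\<^esub> snd (dec w)" for w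
  have u1_op: "u1 \<in> operators M Z"
  proof -
    have i: "(\<lambda>w. Z_incl Y E E0 \<Phi> (fst (dec w))) \<in> operators M Z"
      by (rule operators_compose[OF fstM iA A.Y.quasinormed])
    have qnM: "quasinormed M" by (rule quasi_banach_quasinormed[OF qM])
    obtain C1 where C1: "\<And>w. w \<in> carrier M \<Longrightarrow> qnorm Z (Z_incl Y E E0 \<Phi> (fst (dec w))) \<le> C1 * qnorm M w"
      using operators_bound[OF i qnM] by blast
    obtain C2 where C2: "\<And>w. w \<in> carrier M \<Longrightarrow> qnorm Z (snd (dec w)) \<le> C2 * qnorm M w"
      using operators_bound[OF sndM qnM] by blast
    show ?thesis
    proof (rule operatorsI[where C = "W.Y.K * (C1 + C2)"])
      fix w assume w: "w \<in> carrier M"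
      note cl = operators_closed[OF i w] operators_closed[OF sndM w]
      show "u1 w \<in> carrier Z" using cl by (simp add: u1_def)
      show "u1 (c \<odot>\<^bsub>M\<^esub> w) = c \<odot>\<^bsub>Z\<^esub> u1 w" for c
        using operators_smult[OF i w] operators_smult[OF sndM w] cl
        by (simp add: u1_def W.Y.smult_rdistr)
      have "qnorm Z (u1 w) \<le> W.Y.K * (C1 * qnorm M w + C2 * qnorm M w)"
        unfolding u1_def using cl C1[OF w] C2[OF w] W.Y.K_nonneg
        by (intro order_trans[OF W.Y.qnorm_add mult_left_mono]) auto
      then show "qnorm Z (u1 w) \<le> W.Y.K * (C1 + C2) * qnorm M w" by (simp add: algebra_simps)
      fix v assume v: "v \<in> carrier M"
      note cl' = operators_closed[OF i v] operators_closed[OF sndM v]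
      show "u1 (w \<oplus>\<^bsub>M\<^esub> v) = u1 w \<oplus>\<^bsub>Z\<^esub> u1 v"
        using operators_add[OF i w v] operators_add[OF sndM w v] cl cl'
        by (simp add: u1_def W.Y.a_ac)
    qed
  qed
  define E' where "E' = spliced_sequence Y E E0 X X0 \<Phi> \<Phi>'"
  have E': "E' \<in> exact_sequences X Y" unfolding E'_def by (rule spliced_sequence_exact[OF A B])
  have E'_sel: "mid1 E' = Z" "mid2 E' = N" "arr1 E' = Z_incl Y E E0 \<Phi>"
    "arr2 E' e = Z_incl E X X0 \<Phi>' (Z_proj E e)" "arr3 E' = Z_proj X" for e
    by (simp_all add: E'_def spliced_sequence_def Z_def N_def)
  have incl_u2: "u2 (Z_incl Z X X0 \<Psi> z) = Z_incl E X X0 \<Phi>' (Z_proj E z)" if "z \<in> carrier Z" for z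
    unfolding Z_incl_def using u2_class[OF W.qcauchy_incl[OF that]] by simp
  have proj_u2: "Z_proj X (u2 e) = Z_proj X e" if e: "e \<in> carrier G" for e
  proof -
    obtain S' where "S' \<in> carrier (completion W.T)" "e = code_seq S'"
      using e unfolding G_def Z_space_def transport_simps(1)[OF inj_code_seq] by blast
    then obtain s where s: "qcauchy W.T s" "e = code_seq (class_rep W.T s)"
      using W.T.completion_cases by blast
    have c: "qcauchy B.T (\<lambda>n. map_prod (Z_proj E) (\<lambda>x. x) (s n))"
      by (rule qcauchy_image[OF mp W.quasinormed_T B.quasinormed_T s(1)])
    have "limit_map X snd (class_rep B.T (\<lambda>n. map_prod (Z_proj E) (\<lambda>x. x) (s n))) = limit_map X snd (class_rep W.T s)"
      by (rule B.proj_eqI[OF c]) (use W.proj_class_rep[OF s(1)] in simp)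
    then show ?thesis using s u2_class by simp
  qed
  have "(F, E') \<in> ext2_arrow X Y"
  proof (rule ext2_arrowI[OF F E'])
    show "u1 \<in> operators (mid1 F) (mid1 E')" "u2 \<in> operators (mid2 F) (mid2 E')"
      using u1_op u2_op by (simp_all add: F_def E'_sel)
    show "u1 (arr1 F y) = arr1 E' y" if "y \<in> carrier Y" for y
      using operators_closed[OF iA that] by (simp add: F_def E'_sel u1_def)
    show "arr3 E' (u2 e) = arr3 F e" if "e \<in> carrier (mid2 F)" for e
      using proj_u2 that by (simp add: F_def E'_sel)
    show "u2 (arr2 F e) = arr2 E' (u1 e)" if eF: "e \<in> carrier (mid1 F)" for e
    proof -
      obtain y z where e: "e = code_pair (y, z)" "y \<in> carrier Y" "z \<in> carrier Z"
        using eF by (auto simp: F_def M_simps)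
      have "Z_proj E (u1 e) = Z_proj E (Z_incl Y E E0 \<Phi> y) \<oplus>\<^bsub>E\<^esub> Z_proj E z"
        using e operators_add[OF pA operators_closed[OF iA e(2)] e(3)] by (simp add: u1_def)
      also have "\<dots> = Z_proj E z"
        using Z_proj_incl[OF A e(2)] operators_closed[OF pA e(3)] by simp
      finally show ?thesis using incl_u2[OF e(3)] e by (simp add: F_def E'_sel)
    qed
  qed
  \<comment> \<open>Here \<open>Y\<close> is split off by the coordinate projection, and the middle
    square commutes since \<open>Z_proj X\<close> vanishes on the included copy of
    \<open>Z\<close>.\<close>
  moreover have "(F, ext2_zero X Y) \<in> ext2_arrow X Y"
  proof (rule ext2_arrowI[OF F ext2_zero_exact[OF A.Y B.X], where ?u1.0 = "\<lambda>w. fst (dec w)" and ?u2.0 = "Z_proj X"])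
    show "arr3 (ext2_zero X Y) (Z_proj X e) = arr3 F e" for e by (simp add: F_def ext2_zero_def)
    show "Z_proj X (arr2 F e) = arr2 (ext2_zero X Y) (fst (dec e))" if "e \<in> carrier (mid1 F)" for e
      using that Z_proj_incl[OF WZ] by (auto simp: F_def ext2_zero_def M_simps)
  qed (use fstM pW in \<open>simp_all add: F_def ext2_zero_def\<close>)
  ultimately have "(E', ext2_zero X Y) \<in> (ext2_arrow X Y \<union> (ext2_arrow X Y)\<inverse>)\<^sup>*"
    by (meson UnI1 UnI2 converseI rtrancl.rtrancl_refl rtrancl_into_rtrancl)
  then show ?thesis
    unfolding ext2_trivial_def ext2_equiv_def using E' ext2_zero_exact[OF A.Y B.X] by (simp add: E'_def)
qed

section \<open>The spaces \<open>\<ell>\<^sub>p\<close>\<close>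

lemma lp_simps:
  "\<zero>\<^bsub>lp p\<^esub> = (\<lambda>_. 0)" "x \<oplus>\<^bsub>lp p\<^esub> y = (\<lambda>n. x n + y n)" "c \<odot>\<^bsub>lp p\<^esub> x = (\<lambda>n. c * x n)"
  by (simp_all add: lp_def)

lemma modular_smult: "modular p (\<lambda>n. c * x n) = norm c powr p * modular p x"
  if "summable (\<lambda>n. norm (x n) powr p)" for c :: "'k::real_normed_field"
  using that by (simp add: modular_def norm_mult powr_mult suminf_mult)

lemma norm_powr_le_modular:
  "summable (\<lambda>n. norm (x n) powr p) \<Longrightarrow> norm (x n) powr p \<le> modular p x"
  unfolding modular_def using sum_le_suminf[of "\<lambda>n. norm (x n) powr p" "{n}"] by simp

text \<open>The passage from modulars to quasinorms; the factor \<open>2 powr (1 / p)\<close> is the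
  price of splitting the root of a sum.\<close>

lemma powr_root_le:
  fixes a b c L :: real
  assumes "0 < p" "0 \<le> a" "0 \<le> b" "0 \<le> c" "0 \<le> L" "a \<le> L * (b + c)"
  shows "a powr (1 / p) \<le> (2 * L) powr (1 / p) * (b powr (1 / p) + c powr (1 / p))"
proof -
  have "a powr (1 / p) \<le> (L * (b + c)) powr (1 / p)" using assms by (intro powr_mono2) auto
  also have "\<dots> = L powr (1 / p) * (b + c) powr (1 / p)" using assms by (simp add: powr_mult)
  also have "\<dots> \<le> L powr (1 / p) * (2 powr (1 / p) * (b powr (1 / p) + c powr (1 / p)))"
    using assms by (intro mult_left_mono powr_add_le) auto
  also have "\<dots> = (2 * L) powr (1 / p) * (b powr (1 / p) + c powr (1 / p))"
    using assms by (simp add: powr_mult mult_ac)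
  finally show ?thesis .
qed

lemma quasinormed_lp:
  assumes p: "0 < p"
  shows "quasinormed (lp p :: 'k::real_normed_field space)"
proof (rule quasinormedI[where C = "(2 * 2 powr p) powr (1 / p)"])
  fix x y :: "nat \<Rightarrow> 'k" assume xy: "x \<in> carrier (lp p)" "y \<in> carrier (lp p)"
  then show "x \<oplus>\<^bsub>lp p\<^esub> y \<in> carrier (lp p)"
    by (simp add: lp_simps carrier_lp_iff summable_norm_powr_add p)
  show "qnorm (lp p) (x \<oplus>\<^bsub>lp p\<^esub> y) \<le> (2 * 2 powr p) powr (1 / p) * (qnorm (lp p) x + qnorm (lp p) y)"
    unfolding qnorm_lp lp_simps using xy modular_add_le[of x p y] p
    by (intro powr_root_le) (auto simp: carrier_lp_iff modular_nonneg summable_norm_powr_add)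
next
  fix x :: "nat \<Rightarrow> 'k" assume x: "x \<in> carrier (lp p)"
  show "c \<odot>\<^bsub>lp p\<^esub> x \<in> carrier (lp p)" for c
    using x by (simp add: lp_simps carrier_lp_iff norm_mult powr_mult summable_mult)
  show "qnorm (lp p) (c \<odot>\<^bsub>lp p\<^esub> x) = norm c * qnorm (lp p) x" for c
    using x p by (simp add: qnorm_lp lp_simps carrier_lp_iff modular_smult modular_nonneg powr_mult powr_powr)
  show "0 \<le> qnorm (lp p) x" by (simp add: qnorm_lp)
  show "x = \<zero>\<^bsub>lp p\<^esub>" if "qnorm (lp p) x = 0"
  proof -
    have "modular p x = 0" using that by (simp add: qnorm_lp)
    then have "norm (x n) powr p \<le> 0" for n
      using norm_powr_le_modular[of x p n] x by (simp add: carrier_lp_iff)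
    then show ?thesis by (auto simp: lp_simps)
  qed
next
  show "\<zero>\<^bsub>lp p\<^esub> \<in> carrier (lp p :: 'k space)" by (simp add: carrier_lp_iff lp_simps)
  show "qnorm (lp p :: 'k space) \<zero>\<^bsub>lp p\<^esub> = 0" by (simp add: qnorm_lp lp_simps modular_def)
qed (auto simp: lp_simps algebra_simps)

lemma lp_minus:
  assumes "0 < p" "x \<in> carrier (lp p)" "y \<in> carrier (lp p)"
  shows "x \<ominus>\<^bsub>lp p\<^esub> y = (\<lambda>n. x n - y n :: 'k::real_normed_field)"
proof -
  interpret qnormed "lp p :: 'k space" by (rule qnormed.intro[OF quasinormed_lp[OF assms(1)]])
  show ?thesis using assms by (simp add: minus_alt lp_simps)
qed

lemma quasi_banach_lp:
  assumes p: "0 < p"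
  shows "quasi_banach (lp p :: 'k::{real_normed_field, banach} space)"
  unfolding quasi_banach_def
proof (intro conjI allI impI quasinormed_lp[OF p])
  interpret L: qnormed "lp p :: 'k space" by (rule qnormed.intro[OF quasinormed_lp[OF p]])
  fix s :: "nat \<Rightarrow> nat \<Rightarrow> 'k" assume s: "qcauchy (lp p) s"
  have sc: "s n \<in> carrier (lp p)" for n using L.qcauchyD[OF s] .
  have sd: "summable (\<lambda>k. norm (s m k - s n k) powr p)" for m n
    using L.minus_closed[OF sc sc, of m n] by (simp add: lp_minus[OF p sc sc] carrier_lp_iff)
  have ev: "\<exists>N. \<forall>m\<ge>N. \<forall>n\<ge>N. modular p (\<lambda>k. s m k - s n k) \<le> e powr p" if e: "0 < e" for e
  proof -
    obtain N where N: "\<And>m n. m \<ge> N \<Longrightarrow> n \<ge> N \<Longrightarrow> qnorm (lp p) (s m \<ominus>\<^bsub>lp p\<^esub> s n) < e"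
      using s e unfolding qcauchy_def by blast
    have "modular p (\<lambda>k. s m k - s n k) \<le> e powr p" if "m \<ge> N" "n \<ge> N" for m n
    proof -
      have "modular p (\<lambda>k. s m k - s n k) powr (1 / p) \<le> e"
        using N[OF that] by (simp add: lp_minus[OF p sc sc] qnorm_lp)
      then have "(modular p (\<lambda>k. s m k - s n k) powr (1 / p)) powr p \<le> e powr p"
        using p by (intro powr_mono2) auto
      then show ?thesis using p modular_nonneg[OF sd, of m n] by (simp add: powr_powr)
    qed
    then show ?thesis by blast
  qed
  have "Cauchy (\<lambda>n. s n k)" for k
  proof (rule metric_CauchyI)
    fix e :: real assume e: "0 < e"
    then obtain N where N: "\<And>m n. m \<ge> N \<Longrightarrow> n \<ge> N \<Longrightarrow> modular p (\<lambda>k. s m k - s n k) \<le> (e / 2) powr p"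
      using ev[of "e / 2"] by auto
    have "dist (s m k) (s n k) < e" if "m \<ge> N" "n \<ge> N" for m n
    proof -
      have "norm (s m k - s n k) powr p \<le> (e / 2) powr p"
        using norm_powr_le_modular[of "\<lambda>k. s m k - s n k" p k, OF sd] N[OF that] by linarith
      then have "norm (s m k - s n k) \<le> e / 2" using powr_less_mono2[of p "e / 2" "norm (s m k - s n k)"] p e by linarith
      then show ?thesis using e by (simp add: dist_norm)
    qed
    then show "\<exists>M. \<forall>m\<ge>M. \<forall>n\<ge>M. dist (s m k) (s n k) < e" by blast
  qed
  then have "\<forall>k. \<exists>l. (\<lambda>n. s n k) \<longlonglongrightarrow> l" by (simp add: Cauchy_convergent_iff convergent_def)
  then obtain x where x: "\<And>k. (\<lambda>n. s n k) \<longlonglongrightarrow> x k" by metis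
  have tail: "\<exists>N. \<forall>m\<ge>N. summable (\<lambda>k. norm (s m k - x k) powr p) \<and> modular p (\<lambda>k. s m k - x k) \<le> e powr p"
    if e: "0 < e" for e
  proof -
    obtain N where N: "\<And>m n. m \<ge> N \<Longrightarrow> n \<ge> N \<Longrightarrow> modular p (\<lambda>k. s m k - s n k) \<le> e powr p"
      using ev[OF e] by blast
    have "summable (\<lambda>k. norm (s m k - x k) powr p) \<and> modular p (\<lambda>k. s m k - x k) \<le> e powr p" if m: "m \<ge> N" for m
    proof -
      \<comment> \<open>Fatou's lemma by hand: finitely many coordinates at a time pass to the
        limit.\<close>
      have fin: "(\<Sum>k<j. norm (s m k - x k) powr p) \<le> e powr p" for j
      proof (rule LIMSEQ_le_const2)
        show "(\<lambda>n. \<Sum>k<j. norm (s m k - s n k) powr p) \<longlonglongrightarrow> (\<Sum>k<j. norm (s m k - x k) powr p)"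
        proof (rule tendsto_sum)
          fix k
          have "(\<lambda>n. norm (s m k - s n k)) \<longlonglongrightarrow> norm (s m k - x k)" by (intro tendsto_intros x)
          then show "(\<lambda>n. norm (s m k - s n k) powr p) \<longlonglongrightarrow> norm (s m k - x k) powr p"
            using p by (intro tendsto_powr') (auto intro: always_eventually)
        qed
        have "(\<Sum>k<j. norm (s m k - s n k) powr p) \<le> e powr p" if "n \<ge> N" for n
        proof -
          have "(\<Sum>k<j. norm (s m k - s n k) powr p) \<le> modular p (\<lambda>k. s m k - s n k)"
            unfolding modular_def by (rule sum_le_suminf[OF sd]) auto
          then show ?thesis using N[OF m that] by linarith
        qed
        then show "\<exists>N. \<forall>n\<ge>N. (\<Sum>k<j. norm (s m k - s n k) powr p) \<le> e powr p" by blast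
      qed
      have "summable (\<lambda>k. norm (s m k - x k) powr p)"
        by (rule summableI_nonneg_bounded[OF _ fin]) simp
      then show ?thesis unfolding modular_def using fin suminf_le_const by blast
    qed
    then show ?thesis by blast
  qed
  obtain N1 where N1: "summable (\<lambda>k. norm (s N1 k - x k) powr p)" using tail[of 1] by auto
  have xc: "x \<in> carrier (lp p)"
  proof -
    have d: "(\<lambda>k. s N1 k - x k) \<in> carrier (lp p)" using N1 by (simp add: carrier_lp_iff)
    show ?thesis using L.minus_closed[OF sc d, of N1] lp_minus[OF p sc d, of N1] by simp
  qed
  have "qconverges (lp p) s x"
    unfolding qconverges_def
  proof (intro conjI xc LIMSEQ_I)
    fix e :: real assume e: "0 < e"
    obtain N where N: "\<And>m. m \<ge> N \<Longrightarrow> summable (\<lambda>k. norm (s m k - x k) powr p) \<and> modular p (\<lambda>k. s m k - x k) \<le> (e / 2) powr p"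
      using tail[of "e / 2"] e by auto
    have "norm (qnorm (lp p) (s m \<ominus>\<^bsub>lp p\<^esub> x) - 0) < e" if "m \<ge> N" for m
    proof -
      have "modular p (\<lambda>k. s m k - x k) powr (1 / p) \<le> ((e / 2) powr p) powr (1 / p)"
        using N[OF that] p by (intro powr_mono2) (auto simp: modular_nonneg)
      also have "\<dots> = e / 2" using p e by (simp add: powr_powr)
      finally show ?thesis using e by (simp add: lp_minus[OF p sc xc] qnorm_lp)
    qed
    then show "\<exists>no. \<forall>n\<ge>no. norm (qnorm (lp p) (s n \<ominus>\<^bsub>lp p\<^esub> x) - 0) < e" by blast
  qed
  then show "\<exists>x. qconverges (lp p) s x" by blast
qed

lemma lp0_dense:
  fixes x :: "nat \<Rightarrow> 'k::real_normed_field"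
  assumes p: "0 < p" and x: "x \<in> carrier (lp p)" and e: "0 < e"
  shows "\<exists>x0\<in>lp0. qnorm (lp p) (x0 \<ominus>\<^bsub>lp p\<^esub> x) < e"
proof -
  have s: "summable (\<lambda>n. norm (x n) powr p)" using x by (simp add: carrier_lp_iff)
  obtain N where "\<forall>n\<ge>N. norm (\<Sum>i. norm (x (i + n)) powr p) < e powr p"
    using suminf_exist_split[OF _ s, of "e powr p"] e by auto
  then have N: "(\<Sum>i. norm (x (i + N)) powr p) < e powr p" by auto
  define x0 where "x0 n = (if n < N then x n else 0)" for n
  have x0: "x0 \<in> lp0" by (rule lp0I[of "{..<N}"]) (auto simp: x0_def)
  have sd: "summable (\<lambda>n. norm (x0 n - x n) powr p)"
    by (rule summable_comparison_test'[OF s, of 0]) (auto simp: x0_def)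
  have "modular p (\<lambda>n. x0 n - x n) = (\<Sum>i. norm (x (i + N)) powr p)"
    unfolding modular_def by (subst suminf_split_initial_segment[OF sd, of N]) (simp add: x0_def)
  then have "modular p (\<lambda>n. x0 n - x n) powr (1 / p) < (e powr p) powr (1 / p)"
    using N p modular_nonneg[OF sd] by (intro powr_less_mono2) auto
  then have "qnorm (lp p) (x0 \<ominus>\<^bsub>lp p\<^esub> x) < e"
    using p e by (simp add: lp_minus[OF p lp0_subset_lp[OF x0] x] qnorm_lp powr_powr)
  then show ?thesis using x0 by blast
qed

lemma lp0_subspace:
  "(\<lambda>_. 0) \<in> lp0" "x \<in> lp0 \<Longrightarrow> y \<in> lp0 \<Longrightarrow> (\<lambda>n. x n + y n) \<in> lp0" "x \<in> lp0 \<Longrightarrow> (\<lambda>n. c * x n) \<in> lp0"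
proof -
  show "(\<lambda>_. 0) \<in> lp0" by (simp add: lp0_def)
  show "(\<lambda>n. x n + y n) \<in> lp0" if "x \<in> lp0" "y \<in> lp0"
    by (rule lp0I[of "{n. x n \<noteq> 0} \<union> {n. y n \<noteq> 0}"]) (use that lp0_support in auto)
  show "(\<lambda>n. c * x n) \<in> lp0" if "x \<in> lp0"
    by (rule lp0I[of "{n. x n \<noteq> 0}"]) (use that lp0_support in auto)
qed

section \<open>Centralizers as quasilinear maps, and their lifts\<close>

lemma twisted_lpI:
  fixes \<Phi> :: "(nat \<Rightarrow> 'k::{real_normed_field, banach}) \<Rightarrow> 'a"
  assumes p: "0 < p" and Y: "quasi_banach Y"
    and closed: "\<And>x. x \<in> lp0 \<Longrightarrow> \<Phi> x \<in> carrier Y"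
    and smult: "\<And>c x. x \<in> lp0 \<Longrightarrow> \<Phi> (\<lambda>n. c * x n) = c \<odot>\<^bsub>Y\<^esub> \<Phi> x"
    and Q: "0 \<le> Q" and add: "\<And>x y. x \<in> lp0 \<Longrightarrow> y \<in> lp0 \<Longrightarrow>
      qnorm Y (\<Phi> (\<lambda>n. x n + y n) \<ominus>\<^bsub>Y\<^esub> (\<Phi> x \<oplus>\<^bsub>Y\<^esub> \<Phi> y)) \<le> Q * (qnorm (lp p) x + qnorm (lp p) y)"
  shows "twisted Y (lp p) lp0 \<Phi> Q"
  by unfold_locales
     (auto simp: lp_simps Y quasi_banach_lp[OF p] lp0_subspace lp0_subset_lp lp0_dense[OF p] closed smult Q add)

lemma centralizer_lift:
  fixes \<Phi> :: "(nat \<Rightarrow> 'k::real_normed_field) \<Rightarrow> (nat \<Rightarrow> 'k)"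
  assumes cen: "centralizer p \<Phi>" and p: "0 < p"
  shows "\<exists>\<Omega> H L. 0 \<le> L \<and> (\<forall>x\<in>lp0. \<Omega> x \<in> lp0 \<and> H x \<in> lp0) \<and>
    (\<forall>c x. \<Omega> (\<lambda>n. c * x n) = (\<lambda>n. c * \<Omega> x n) \<and> H (\<lambda>n. c * x n) = (\<lambda>n. c * H x n)) \<and>
    (\<forall>x\<in>lp0. qnorm (lp p) (\<lambda>n. \<Omega> x n - \<Phi> x n) \<le> L * qnorm (lp p) x) \<and>
    (\<forall>x\<in>lp0. \<forall>y\<in>lp0.
      qnorm (lp p) (\<lambda>n. \<Omega> (\<lambda>k. x k + y k) n - \<Omega> x n - \<Omega> y n) \<le> L * (qnorm (lp p) x + qnorm (lp p) y)) \<and>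
    (\<forall>x\<in>lp0. \<forall>y\<in>lp0.
      qnorm (lp p) (\<lambda>n. H (\<lambda>k. x k + y k) n - H x n - H y n
        - \<Phi> (\<lambda>n. \<Omega> (\<lambda>k. x k + y k) n - \<Omega> x n - \<Omega> y n) n) \<le> L * (qnorm (lp p) x + qnorm (lp p) y))"
proof -
  obtain \<Omega> H K where K: "0 \<le> K" and lp0: "\<forall>x\<in>lp0. \<Omega> x \<in> lp0 \<and> H x \<in> lp0"
    and hom: "\<forall>c x. \<Omega> (\<lambda>n. c * x n) = (\<lambda>n. c * \<Omega> x n) \<and> H (\<lambda>n. c * x n) = (\<lambda>n. c * H x n)"
    and near: "\<forall>x\<in>lp0. modular p (\<lambda>n. \<Omega> x n - \<Phi> x n) \<le> K * modular p x"
    and add: "\<forall>x\<in>lp0. \<forall>y\<in>lp0. let \<Delta> = (\<lambda>n. \<Omega> (\<lambda>k. x k + y k) n - \<Omega> x n - \<Omega> y n) in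
       modular p \<Delta> \<le> K * (modular p x + modular p y) \<and>
       modular p (\<lambda>n. H (\<lambda>k. x k + y k) n - H x n - H y n - \<Phi> \<Delta> n) \<le> K * (modular p x + modular p y)"
    using centralizer_lift_modular[OF cen p] by (elim exE conjE)
  interpret L: qnormed "lp p :: 'k space" by (rule qnormed.intro[OF quasinormed_lp[OF p]])
  define L where "L = (2 * K) powr (1 / p)"
  have lpD: "summable (\<lambda>n. norm (x n - y n) powr p)"
    if "x \<in> carrier (lp p)" "y \<in> carrier (lp p)" for x y :: "nat \<Rightarrow> 'k"
    using L.minus_closed[OF that] by (simp add: lp_minus[OF p that] carrier_lp_iff)
  have m0: "0 \<le> modular p x" if "x \<in> lp0" for x :: "nat \<Rightarrow> 'k"
    using lp0_subset_lp[OF that, of p] by (simp add: carrier_lp_iff modular_nonneg)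
  have lp0_diff: "(\<lambda>n. x n - y n) \<in> lp0" if "x \<in> lp0" "y \<in> lp0" for x y :: "nat \<Rightarrow> 'k"
    using lp0_subspace(2)[OF that(1) lp0_subspace(3)[OF that(2), of "- 1"]] by simp
  have lpc: "\<And>x :: nat \<Rightarrow> 'k. x \<in> lp0 \<Longrightarrow> x \<in> carrier (lp p)" by (rule lp0_subset_lp)
  show ?thesis
  proof (rule exI[of _ \<Omega>], rule exI[of _ H], rule exI[of _ L], intro conjI[OF _ conjI[OF lp0 conjI[OF hom]]] conjI ballI)
    show "0 \<le> L" by (simp add: L_def)
    show "qnorm (lp p) (\<lambda>n. \<Omega> x n - \<Phi> x n) \<le> L * qnorm (lp p) x" if x: "x \<in> lp0" for x
    proof -
      have "0 \<le> modular p (\<lambda>n. \<Omega> x n - \<Phi> x n)"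
        using lp0 x by (intro modular_nonneg lpD lpc centralizer_carrier[OF cen x]) auto
      \<comment> \<open>The two-term estimate is applied with second term 0, as
        \<open>0 powr (1 / p) = 0\<close>.\<close>
      then have "qnorm (lp p) (\<lambda>n. \<Omega> x n - \<Phi> x n) \<le> L * (modular p x powr (1 / p) + 0 powr (1 / p))"
        unfolding qnorm_lp L_def using near x m0[OF x] K p by (intro powr_root_le) auto
      then show ?thesis by (simp add: qnorm_lp)
    qed
    fix x y :: "nat \<Rightarrow> 'k" assume x: "x \<in> lp0" and y: "y \<in> lp0"
    define \<Delta> where "\<Delta> = (\<lambda>n. \<Omega> (\<lambda>k. x k + y k) n - \<Omega> x n - \<Omega> y n)"
    note xy = lp0_subspace(2)[OF x y]
    have \<Delta>: "\<Delta> \<in> lp0" unfolding \<Delta>_def using lp0 x y xy by (intro lp0_diff) auto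
    have Hd: "(\<lambda>n. H (\<lambda>k. x k + y k) n - H x n - H y n) \<in> lp0" using lp0 x y xy by (intro lp0_diff) auto
    have est: "modular p \<Delta> \<le> K * (modular p x + modular p y)"
      "modular p (\<lambda>n. H (\<lambda>k. x k + y k) n - H x n - H y n - \<Phi> \<Delta> n) \<le> K * (modular p x + modular p y)"
      using add[rule_format, OF x y] unfolding Let_def \<Delta>_def by auto
    have "qnorm (lp p) \<Delta> \<le> L * (qnorm (lp p) x + qnorm (lp p) y)"
      unfolding qnorm_lp L_def using est(1) m0[OF x] m0[OF y] m0[OF \<Delta>] K p by (intro powr_root_le)
    then show "qnorm (lp p) (\<lambda>n. \<Omega> (\<lambda>k. x k + y k) n - \<Omega> x n - \<Omega> y n) \<le> L * (qnorm (lp p) x + qnorm (lp p) y)"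
      unfolding \<Delta>_def .
    show "qnorm (lp p) (\<lambda>n. H (\<lambda>k. x k + y k) n - H x n - H y n
        - \<Phi> (\<lambda>n. \<Omega> (\<lambda>k. x k + y k) n - \<Omega> x n - \<Omega> y n) n) \<le> L * (qnorm (lp p) x + qnorm (lp p) y)"
      unfolding qnorm_lp L_def \<Delta>_def[symmetric]
      using est(2) m0[OF x] m0[OF y] modular_nonneg[OF lpD[OF lpc[OF Hd] centralizer_carrier[OF cen \<Delta>]]] K p
      by (intro powr_root_le)
  qed
qed

text \<open>The lift sends \<open>x\<close> to the class of the constant sequence
  \<open>(H x, \<Omega> x)\<close>. Its defect is the class of a pair \<open>(h, \<Delta>)\<close>,
  whose quasinorm in the twisted sum is that of \<open>h - \<Phi> \<Delta>\<close> plus that of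
  \<open>\<Delta>\<close>: exactly the two quantities bounded in \<open>centralizer_lift\<close>.
  The scalars form any complete normed field, which covers the real and the complex case
  together.\<close>

lemma spliced_centralizer_trivial:
  fixes \<Phi> :: "(nat \<Rightarrow> 'k::{real_normed_field, banach}) \<Rightarrow> (nat \<Rightarrow> 'k)"
  assumes cen: "centralizer p \<Phi>" and p: "0 < p"
  shows "ext2_trivial (lp p) (lp p) (spliced_sequence (lp p) (lp p) lp0 (lp p) lp0 \<Phi> \<Phi>)"
proof -
  obtain \<Omega> H L where L: "0 \<le> L" and lp0: "\<forall>x\<in>lp0. \<Omega> x \<in> lp0 \<and> H x \<in> lp0"
    and hom: "\<forall>c x. \<Omega> (\<lambda>n. c * x n) = (\<lambda>n. c * \<Omega> x n) \<and> H (\<lambda>n. c * x n) = (\<lambda>n. c * H x n)"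
    and near: "\<forall>x\<in>lp0. qnorm (lp p) (\<lambda>n. \<Omega> x n - \<Phi> x n) \<le> L * qnorm (lp p) x"
    and \<Omega>_add: "\<forall>x\<in>lp0. \<forall>y\<in>lp0.
      qnorm (lp p) (\<lambda>n. \<Omega> (\<lambda>k. x k + y k) n - \<Omega> x n - \<Omega> y n) \<le> L * (qnorm (lp p) x + qnorm (lp p) y)"
    and H_add: "\<forall>x\<in>lp0. \<forall>y\<in>lp0.
      qnorm (lp p) (\<lambda>n. H (\<lambda>k. x k + y k) n - H x n - H y n
        - \<Phi> (\<lambda>n. \<Omega> (\<lambda>k. x k + y k) n - \<Omega> x n - \<Omega> y n) n) \<le> L * (qnorm (lp p) x + qnorm (lp p) y)"
    using centralizer_lift[OF cen p] by (elim exE conjE)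
  note near = near[rule_format] and \<Omega>_add = \<Omega>_add[rule_format] and H_add = H_add[rule_format]
  have \<Omega>: "\<And>x. x \<in> lp0 \<Longrightarrow> \<Omega> x \<in> lp0" and H: "\<And>x. x \<in> lp0 \<Longrightarrow> H x \<in> lp0" using lp0 by auto
  interpret V: qnormed "lp p :: 'k space" by (rule qnormed.intro[OF quasinormed_lp[OF p]])
  note lpc = lp0_subset_lp[where p = p and 'a = 'k]
  note \<Phi>c = centralizer_carrier[OF cen]
  have near': "qnorm (lp p) (\<Omega> x \<ominus>\<^bsub>lp p\<^esub> \<Phi> x) \<le> L * qnorm (lp p) x" if "x \<in> lp0" for x
    using near[OF that] by (simp add: lp_minus[OF p lpc[OF \<Omega>[OF that]] \<Phi>c[OF that]])
  \<comment> \<open>\<open>\<Phi>\<close> is quasilinear because it stays within \<open>L\<close> of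
    \<open>\<Omega>\<close>, which is. The constant collects the quasi-triangle inequalities along
    the chain \<open>\<Phi> z\<close>, \<open>\<Omega> z\<close>,
    \<open>\<Omega> x + \<Omega> y\<close>, \<open>\<Phi> x + \<Phi> y\<close>.\<close>
  define Q where "Q = V.K * (L * V.K + V.K * (L + V.K * L))"
  have Q: "0 \<le> Q" using L V.K_nonneg by (simp add: Q_def)
  have A: "twisted (lp p) (lp p) lp0 \<Phi> Q"
  proof (rule twisted_lpI[OF p quasi_banach_lp[OF p] \<Phi>c _ Q])
    show "\<Phi> (\<lambda>n. c * x n) = c \<odot>\<^bsub>lp p\<^esub> \<Phi> x" if "x \<in> lp0" for c x
      unfolding lp_simps by (rule centralizer_scale[OF cen that])
    fix x y :: "nat \<Rightarrow> 'k" assume x: "x \<in> lp0" and y: "y \<in> lp0"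
    note xy = lp0_subspace(2)[OF x y]
    define z where "z = (\<lambda>n. x n + y n)"
    have z: "z \<in> lp0" using xy by (simp add: z_def)
    define m where "m = qnorm (lp p) x + qnorm (lp p) y"
    note c = lpc[OF \<Omega>[OF x]] lpc[OF \<Omega>[OF y]] lpc[OF \<Omega>[OF z]] \<Phi>c[OF x] \<Phi>c[OF y] \<Phi>c[OF z]
    have 1: "qnorm (lp p) (\<Phi> z \<ominus>\<^bsub>lp p\<^esub> \<Omega> z) \<le> L * (V.K * m)"
    proof -
      have "qnorm (lp p) z \<le> V.K * m"
        using V.qnorm_add[OF lpc[OF x] lpc[OF y]] by (simp add: z_def m_def lp_simps)
      then have "L * qnorm (lp p) z \<le> L * (V.K * m)" using L by (rule mult_left_mono)
      then show ?thesis using near'[OF z] V.qnorm_minus_commute[OF c(6,3)] by simp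
    qed
    have 2: "qnorm (lp p) (\<Omega> z \<ominus>\<^bsub>lp p\<^esub> (\<Omega> x \<oplus>\<^bsub>lp p\<^esub> \<Omega> y)) \<le> L * m"
      unfolding lp_minus[OF p c(3) V.a_closed[OF c(1,2)]]
      using \<Omega>_add[OF x y] by (simp add: lp_simps z_def m_def diff_diff_eq)
    have 3: "qnorm (lp p) ((\<Omega> x \<oplus>\<^bsub>lp p\<^esub> \<Omega> y) \<ominus>\<^bsub>lp p\<^esub> (\<Phi> x \<oplus>\<^bsub>lp p\<^esub> \<Phi> y)) \<le> V.K * (L * m)"
      using near'[OF x] near'[OF y] V.K_nonneg
      by (intro order_trans[OF V.qdist_add[OF c(1,2,4,5)] mult_left_mono]) (auto simp: m_def distrib_left)
    have 4: "qnorm (lp p) (\<Omega> z \<ominus>\<^bsub>lp p\<^esub> (\<Phi> x \<oplus>\<^bsub>lp p\<^esub> \<Phi> y)) \<le> V.K * (L * m + V.K * (L * m))"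
      using 2 3 V.K_nonneg
      by (intro order_trans[OF V.qdist_triangle[OF c(3) V.a_closed[OF c(1,2)] V.a_closed[OF c(4,5)]] mult_left_mono] add_mono)
    have "qnorm (lp p) (\<Phi> z \<ominus>\<^bsub>lp p\<^esub> (\<Phi> x \<oplus>\<^bsub>lp p\<^esub> \<Phi> y)) \<le> V.K * (L * (V.K * m) + V.K * (L * m + V.K * (L * m)))"
      using 1 4 V.K_nonneg
      by (intro order_trans[OF V.qdist_triangle[OF c(6,3) V.a_closed[OF c(4,5)]] mult_left_mono] add_mono)
    also have "\<dots> = Q * m" by (simp add: Q_def algebra_simps)
    finally show "qnorm (lp p) (\<Phi> (\<lambda>n. x n + y n) \<ominus>\<^bsub>lp p\<^esub> (\<Phi> x \<oplus>\<^bsub>lp p\<^esub> \<Phi> y)) \<le> Q * (qnorm (lp p) x + qnorm (lp p) y)"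
      by (simp add: z_def m_def)
  qed
  interpret A: twisted "lp p" "lp p" lp0 \<Phi> Q by (rule A)
  define Z where "Z = Z_space (lp p) (lp p) lp0 \<Phi>"
  have qZ: "quasi_banach Z" unfolding Z_def by (rule quasi_banach_Z_space[OF A])
  note qnZ = quasi_banach_quasinormed[OF qZ]
  interpret Z: qnormed Z by (rule qnormed.intro[OF qnZ])
  define emb where "emb v = code_seq (class_rep A.T (\<lambda>_. v))" for v
  have emb: "emb \<in> operators A.T Z"
    unfolding emb_def[abs_def] Z_def Z_space_def
    by (rule operators_to_transport[OF inj_code_seq const_class_operator[OF A.quasinormed_T]])
  obtain C where C: "0 \<le> C" "\<And>v. v \<in> carrier A.T \<Longrightarrow> qnorm Z (emb v) \<le> C * qnorm A.T v"
    using operators_bound[OF emb A.quasinormed_T] by blast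
  define \<Psi> where "\<Psi> x = emb (H x, \<Omega> x)" for x
  have inT: "(H x, \<Omega> x) \<in> carrier A.T" if "x \<in> lp0" for x
    using that by (simp add: A.T_simps H \<Omega> lpc)
  have W: "twisted Z (lp p) lp0 \<Psi> (C * (2 * L))"
  proof (rule twisted_lpI[OF p qZ])
    show "\<Psi> x \<in> carrier Z" if "x \<in> lp0" for x
      unfolding \<Psi>_def by (rule operators_closed[OF emb inT[OF that]])
    show "\<Psi> (\<lambda>n. c * x n) = c \<odot>\<^bsub>Z\<^esub> \<Psi> x" if "x \<in> lp0" for c x
      using operators_smult[OF emb inT[OF that], of c] by (simp add: \<Psi>_def hom A.T_simps(4)) (simp add: lp_simps)
    fix x y :: "nat \<Rightarrow> 'k" assume x: "x \<in> lp0" and y: "y \<in> lp0"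
    note xy = lp0_subspace(2)[OF x y]
    define z where "z = (\<lambda>n. x n + y n)"
    have z: "z \<in> lp0" using xy by (simp add: z_def)
    define h where "h = H z \<ominus>\<^bsub>lp p\<^esub> (H x \<oplus>\<^bsub>lp p\<^esub> H y)"
    define \<Delta> where "\<Delta> = \<Omega> z \<ominus>\<^bsub>lp p\<^esub> (\<Omega> x \<oplus>\<^bsub>lp p\<^esub> \<Omega> y)"
    have \<Delta>_eq: "\<Delta> = (\<lambda>n. \<Omega> (\<lambda>k. x k + y k) n - \<Omega> x n - \<Omega> y n)"
      unfolding \<Delta>_def using lp_minus[OF p lpc[OF \<Omega>[OF z]] V.a_closed[OF lpc[OF \<Omega>[OF x]] lpc[OF \<Omega>[OF y]]]]
      by (simp add: lp_simps z_def diff_diff_eq)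
    have h_eq: "h = (\<lambda>n. H (\<lambda>k. x k + y k) n - H x n - H y n)"
      unfolding h_def using lp_minus[OF p lpc[OF H[OF z]] V.a_closed[OF lpc[OF H[OF x]] lpc[OF H[OF y]]]]
      by (simp add: lp_simps z_def diff_diff_eq)
    have add0: "\<Omega> x \<oplus>\<^bsub>lp p\<^esub> \<Omega> y \<in> lp0" using lp0_subspace(2)[OF \<Omega>[OF x] \<Omega>[OF y]] by (simp add: lp_simps)
    have \<Delta>: "\<Delta> \<in> lp0" unfolding \<Delta>_def by (rule A.X0_minus[OF \<Omega>[OF z] add0])
    have h: "h \<in> carrier (lp p)" unfolding h_def using H x y z by (intro V.minus_closed V.a_closed lpc)
    have sum: "(H x, \<Omega> x) \<oplus>\<^bsub>A.T\<^esub> (H y, \<Omega> y) = (H x \<oplus>\<^bsub>lp p\<^esub> H y, \<Omega> x \<oplus>\<^bsub>lp p\<^esub> \<Omega> y)" by (rule A.T_simps(3))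
    have "\<Psi> z \<ominus>\<^bsub>Z\<^esub> (\<Psi> x \<oplus>\<^bsub>Z\<^esub> \<Psi> y) = emb ((H z, \<Omega> z) \<ominus>\<^bsub>A.T\<^esub> ((H x, \<Omega> x) \<oplus>\<^bsub>A.T\<^esub> (H y, \<Omega> y)))"
      unfolding \<Psi>_def operators_minus[OF emb A.quasinormed_T qnZ inT[OF z] A.T.a_closed[OF inT[OF x] inT[OF y]]]
        operators_add[OF emb inT[OF x] inT[OF y]] ..
    also have "(H z, \<Omega> z) \<ominus>\<^bsub>A.T\<^esub> ((H x, \<Omega> x) \<oplus>\<^bsub>A.T\<^esub> (H y, \<Omega> y)) = (h, \<Delta>)"
      unfolding sum h_def \<Delta>_def using H \<Omega> x y z add0 by (intro A.T_minus V.a_closed lpc)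
    finally have eq: "\<Psi> z \<ominus>\<^bsub>Z\<^esub> (\<Psi> x \<oplus>\<^bsub>Z\<^esub> \<Psi> y) = emb (h, \<Delta>)" .
    have "qnorm Z (emb (h, \<Delta>)) \<le> C * qnorm A.T (h, \<Delta>)" using h \<Delta> by (intro C(2)) (simp add: A.T_simps)
    also have "qnorm A.T (h, \<Delta>) = qnorm (lp p) (\<lambda>n. h n - \<Phi> \<Delta> n) + qnorm (lp p) \<Delta>"
      by (simp add: A.T_simps(5) lp_minus[OF p h \<Phi>c[OF \<Delta>]])
    also have "C * \<dots> \<le> C * (L * (qnorm (lp p) x + qnorm (lp p) y) + L * (qnorm (lp p) x + qnorm (lp p) y))"
      unfolding h_eq \<Delta>_eq using H_add[OF x y] \<Omega>_add[OF x y] C(1) by (intro mult_left_mono add_mono)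
    also have "\<dots> = C * (2 * L) * (qnorm (lp p) x + qnorm (lp p) y)" by simp
    finally show "qnorm Z (\<Psi> (\<lambda>n. x n + y n) \<ominus>\<^bsub>Z\<^esub> (\<Psi> x \<oplus>\<^bsub>Z\<^esub> \<Psi> y)) \<le> C * (2 * L) * (qnorm (lp p) x + qnorm (lp p) y)"
      using eq by (simp add: z_def)
  qed (use C L in auto)
  \<comment> \<open>The lift covers \<open>\<Omega>\<close> and not \<open>\<Phi>\<close> itself;
    their bounded distance is all that the criterion for triviality asks for.\<close>
  have "Z_proj (lp p) (\<Psi> x) = \<Omega> x" if "x \<in> lp0" for x
    using A.proj_const[OF lpc[OF H[OF that]] \<Omega>[OF that]] by (simp add: \<Psi>_def emb_def)
  then show ?thesis
    using near' by (intro lift_imp_ext2_trivial[OF A A W[unfolded Z_def], where C = L]) simp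
qed

theorem proposition5p3:
  fixes p :: real
  assumes "0 < p"
  shows "(\<forall>\<Phi> :: (nat \<Rightarrow> real) \<Rightarrow> (nat \<Rightarrow> real). centralizer p \<Phi> \<longrightarrow>
            ext2_trivial (lp p) (lp p) (spliced_sequence (lp p) (lp p) lp0 (lp p) lp0 \<Phi> \<Phi>)) \<and>
         (\<forall>\<Phi> :: (nat \<Rightarrow> complex) \<Rightarrow> (nat \<Rightarrow> complex). centralizer p \<Phi> \<longrightarrow>
            ext2_trivial (lp p) (lp p) (spliced_sequence (lp p) (lp p) lp0 (lp p) lp0 \<Phi> \<Phi>))"
  by (intro conjI allI impI spliced_centralizer_trivial assms)

end
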